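(* Let $d\ge 1$ and let $G=(V,E)$ be a graph on at least $d+1$ vertices. Then $G$ is $d$-joined if and only if for every generic realization $(G,p)$ in $\mathbb{R}^d$, every realization $(G,q)$ in $\mathbb{R}^d$ that is equivalent to $(G,p)$ is congruent to $(G,F(p))$ for some reduced sequence $F$ of partial $d$-reflections of $G$.
   Context: A $d$-dimensional realization (framework) of a graph $G=(V,E)$ is a pair $(G,p)$ with $p:V\to\mathbb{R}^d$; it is generic if the $d|V|$ coordinates of the points $p(v)$, $v\in V$, are algebraically independent over $\mathbb{Q}$. Realizations $(G,p),(G,q)$ are equivalent if $\|p(u)-p(v)\|=\|q(u)-q(v)\|$ for every edge $uv\in E$, and congruent if this holds for every pair $u,v\in V$. A framework $(G,p)$ is rigid if there is $\varepsilon>0$ such that every equivalent $(G,q)$ with $\|p(v)-q(v)\|<\varepsilon$ for all $v$ is congruent to $(G,p)$; $G$ is rigid in $\mathbb{R}^d$ if its generic $d$-dimensional realizations are rigid. A pair $\{u,v\}$ is globally linked in $G$ in $\mathbb{R}^d$ if for every generic realization $(G,p)$ in $\mathbb{R}^d$ and every equivalent realization $(G,q)$ in $\mathbb{R}^d$ we have $\|p(u)-p(v)\|=\|q(u)-q(v)\|$. $\kappa(G,u,v)$ denotes the maximum number of internally vertex-disjoint $u$–$v$ paths in $G$. $G$ is called $d$-joined if $|V|\ge d+1$, $G$ is rigid in $\mathbb{R}^d$, and for all $u,v\in V$: $\{u,v\}$ is globally linked in $G$ in $\mathbb{R}^d$ if and only if $uv\in E$ or $\kappa(G,u,v)\ge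 d+1$. A set $S\subseteq V$ is a separator if $G-S$ is disconnected, a $d$-separator if moreover $|S|=d$. $G$ is $d$-connected if it has at least $d+1$ vertices and no separator of size at most $d-1$. For $X\subseteq V$, $N_G(X)$ is the set of vertices outside $X$ with a neighbour in $X$. A $d$-fragment is a nonempty $X\subseteq V$ with $|N_G(X)|=d$ and $\overline{X}:=V-X-N_G(X)$ nonempty ($\overline X$ is the complement of $X$). Two $d$-separators $S,T$ cross if $S$ contains vertices from at least two components of $G-T$ (this relation is symmetric); two $d$-fragments cross if their neighbour sets cross, and are noncrossing otherwise. For a $d$-fragment $X$ and a framework $(G,p)$ with $\{p(s):s\in N_G(X)\}$ affinely independent, the partial reflection $\mathcal{R}_X(p)$ is defined by $\mathcal{R}_X(p)(v)=p(v)$ for $v\in X\cup N_G(X)$ and $\mathcal{R}_X(p)(v)$ = the orthogonal reflection of $p(v)$ in the affine hyperplane spanned by $\{p(s):s\in N_G(X)\}$ for $v\in\overline X$. A sequence of partial $d$-reflections is a tuple $F=(\mathcal{R}_{X_1},\dots,\mathcal{R}_{X_k})$ of $d$-fragments $X_i$ ($k=0$ allowed: the trivial sequence, acting as the identity), acting by $F(p)=\mathcal{R}_{X_k}(\cdots\mathcal{R}_{X_1}(p))$; this is defined for every generic $p$ (partial reflections map generic frameworks to generic frameworks). $F$ is reduced if it is trivial or $X_1,\dots,X_k$ are pairwise noncrossing and $N_G(X_1),\dots,N_G(X_k)$ are pairwise distinct. *)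

theory Defs
  imports "HOL-Analysis.Analysis" "HOL-Library.Poly_Mapping" "Graph_Theory.Graph_Theory"
begin

text \<open>
  Finite simple graphs are terms \<open>G\<close> satisfying \<^locale>\<open>pair_graph\<close>: finite, loopless, symmetric
  digraphs without parallel arcs, so that an edge \<open>uv\<close> is the pair of arcs \<open>(u, v)\<close>, \<open>(v, u)\<close>.
  The dimension \<open>d\<close> is the cardinality of a finite index type \<open>'n\<close>.  A realization is a
  function \<open>p :: 'a \<Rightarrow> real ^ 'n\<close>; only its values on \<^term>\<open>pverts G\<close> are ever relevant.
\<close>

subsection \<open>Frameworks\<close>

text \<open>Polynomials over the rationals in variables indexed by \<open>'i\<close> are represented as finitely
  supported functions from monomials (finitely supported exponent functions) to coefficients.\<close>

definition eval_poly :: "('i \<Rightarrow> real) \<Rightarrow> (('i \<Rightarrow>\<^sub>0 nat) \<Rightarrow>\<^sub>0 rat) \<Rightarrow> real" where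
  "eval_poly x P = (\<Sum>m\<in>Poly_Mapping.keys P.
     of_rat (Poly_Mapping.lookup P m) *
     (\<Prod>i\<in>Poly_Mapping.keys m. x i ^ Poly_Mapping.lookup m i))"

definition alg_independent_on :: "'i set \<Rightarrow> ('i \<Rightarrow> real) \<Rightarrow> bool" where
  "alg_independent_on I x \<longleftrightarrow>
     (\<forall>P. (\<forall>m\<in>Poly_Mapping.keys P. Poly_Mapping.keys m \<subseteq> I) \<and> eval_poly x P = 0 \<longrightarrow> P = 0)"

definition generic :: "'a pair_pre_digraph \<Rightarrow> ('a \<Rightarrow> real ^ 'n) \<Rightarrow> bool" where
  "generic G p \<longleftrightarrow> alg_independent_on (pverts G \<times> UNIV) (\<lambda>(v, i). p v $ i)"

definition equivalent_fw ::
    "'a pair_pre_digraph \<Rightarrow> ('a \<Rightarrow> real ^ 'n) \<Rightarrow> ('a \<Rightarrow> real ^ 'n) \<Rightarrow> bool" where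
  "equivalent_fw G p q \<longleftrightarrow> (\<forall>(u, v)\<in>parcs G. norm (p u - p v) = norm (q u - q v))"

definition congruent_fw ::
    "'a pair_pre_digraph \<Rightarrow> ('a \<Rightarrow> real ^ 'n) \<Rightarrow> ('a \<Rightarrow> real ^ 'n) \<Rightarrow> bool" where
  "congruent_fw G p q \<longleftrightarrow>
     (\<forall>u\<in>pverts G. \<forall>v\<in>pverts G. norm (p u - p v) = norm (q u - q v))"

definition rigid_fw :: "'a pair_pre_digraph \<Rightarrow> ('a \<Rightarrow> real ^ 'n) \<Rightarrow> bool" where
  "rigid_fw G p \<longleftrightarrow>
     (\<exists>\<epsilon>>0. \<forall>q. equivalent_fw G p q \<and> (\<forall>v\<in>pverts G. norm (p v - q v) < \<epsilon>) \<longrightarrow> congruent_fw G p q)"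

definition rigid_graph :: "'n::finite itself \<Rightarrow> 'a pair_pre_digraph \<Rightarrow> bool" where
  "rigid_graph _ G \<longleftrightarrow> (\<forall>p :: 'a \<Rightarrow> real ^ 'n. generic G p \<longrightarrow> rigid_fw G p)"

definition globally_linked ::
    "'n::finite itself \<Rightarrow> 'a pair_pre_digraph \<Rightarrow> 'a \<Rightarrow> 'a \<Rightarrow> bool" where
  "globally_linked _ G u v \<longleftrightarrow>
     (\<forall>p q :: 'a \<Rightarrow> real ^ 'n. generic G p \<and> equivalent_fw G p q \<longrightarrow>
        norm (p u - p v) = norm (q u - q v))"

subsection \<open>Local connectivity and d-joined graphs\<close>

definition paths_between :: "'a pair_pre_digraph \<Rightarrow> 'a \<Rightarrow> 'a \<Rightarrow> 'a list set" where
  "paths_between G u v = {xs. vpath xs (with_proj G) \<and> hd xs = u \<and> last xs = v}"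

text \<open>For distinct \<open>u\<close>, \<open>v\<close> in a finite graph the maximum is over a finite nonempty set; see
  \<open>finite_disjoint_path_counts\<close> below.\<close>

definition kappa :: "'a pair_pre_digraph \<Rightarrow> 'a \<Rightarrow> 'a \<Rightarrow> nat" where
  "kappa G u v = Max {card Q | Q. Q \<subseteq> paths_between G u v \<and>
     pairwise (\<lambda>xs ys. set xs \<inter> set ys \<subseteq> {u, v}) Q}"

definition d_joined :: "'n::finite itself \<Rightarrow> 'a pair_pre_digraph \<Rightarrow> bool" where
  "d_joined n G \<longleftrightarrow>
     card (pverts G) \<ge> CARD('n) + 1 \<and> rigid_graph n G \<and>
     (\<forall>u\<in>pverts G. \<forall>v\<in>pverts G. u \<noteq> v \<longrightarrow>
        (globally_linked n G u v \<longleftrightarrow> (u, v) \<in> parcs G \<or> kappa G u v \<ge> CARD('n) + 1))"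

subsection \<open>Fragments and crossing\<close>

definition nbhd :: "'a pair_pre_digraph \<Rightarrow> 'a set \<Rightarrow> 'a set" where
  "nbhd G X = {v \<in> pverts G - X. \<exists>x\<in>X. (x, v) \<in> parcs G}"

definition frag_compl :: "'a pair_pre_digraph \<Rightarrow> 'a set \<Rightarrow> 'a set" where
  "frag_compl G X = pverts G - X - nbhd G X"

definition fragment :: "nat \<Rightarrow> 'a pair_pre_digraph \<Rightarrow> 'a set \<Rightarrow> bool" where
  "fragment d G X \<longleftrightarrow>
     X \<subseteq> pverts G \<and> X \<noteq> {} \<and> card (nbhd G X) = d \<and> frag_compl G X \<noteq> {}"

text \<open>Since \<open>G\<close> is symmetric, the strongly connected components of \<open>G - T\<close> are its components.\<close>

definition components_minus :: "'a pair_pre_digraph \<Rightarrow> 'a set \<Rightarrow> 'a set set" where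
  "components_minus G T = pre_digraph.sccs_verts (with_proj G \<restriction> (pverts G - T))"

definition separators_cross :: "'a pair_pre_digraph \<Rightarrow> 'a set \<Rightarrow> 'a set \<Rightarrow> bool" where
  "separators_cross G S T \<longleftrightarrow>
     (\<exists>C\<in>components_minus G T. \<exists>D\<in>components_minus G T.
        C \<noteq> D \<and> S \<inter> C \<noteq> {} \<and> S \<inter> D \<noteq> {})"

definition fragments_cross :: "'a pair_pre_digraph \<Rightarrow> 'a set \<Rightarrow> 'a set \<Rightarrow> bool" where
  "fragments_cross G X Y \<longleftrightarrow> separators_cross G (nbhd G X) (nbhd G Y)"

subsection \<open>Partial reflections\<close>

text \<open>Orthogonal reflection in an affine subspace: the orthogonal projection of \<open>x\<close> is the closest
  point.\<close>

definition reflect_in :: "'e::euclidean_space set \<Rightarrow> 'e \<Rightarrow> 'e" where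
  "reflect_in H x = 2 *\<^sub>R closest_point H x - x"

text \<open>Defined for all \<open>p\<close>; it is the reflection in a hyperplane if \<open>X\<close> is a \<open>d\<close>-fragment and the
  points of \<^term>\<open>nbhd G X\<close> are affinely independent, in particular if \<open>p\<close> is generic.\<close>

definition partial_reflection ::
    "'a pair_pre_digraph \<Rightarrow> 'a set \<Rightarrow> ('a \<Rightarrow> real ^ 'n) \<Rightarrow> 'a \<Rightarrow> real ^ 'n" where
  "partial_reflection G X p v =
     (if v \<in> frag_compl G X then reflect_in (affine hull (p ` nbhd G X)) (p v) else p v)"

text \<open>A sequence of partial reflections is given by its list of fragments; the first one in the
  list acts first.\<close>

definition apply_reflections ::
    "'a pair_pre_digraph \<Rightarrow> 'a set list \<Rightarrow> ('a \<Rightarrow> real ^ 'n) \<Rightarrow> 'a \<Rightarrow> real ^ 'n" where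
  "apply_reflections G Xs p = fold (partial_reflection G) Xs p"

definition reflection_sequence :: "nat \<Rightarrow> 'a pair_pre_digraph \<Rightarrow> 'a set list \<Rightarrow> bool" where
  "reflection_sequence d G Xs \<longleftrightarrow> (\<forall>X\<in>set Xs. fragment d G X)"

definition reduced_sequence :: "'a pair_pre_digraph \<Rightarrow> 'a set list \<Rightarrow> bool" where
  "reduced_sequence G Xs \<longleftrightarrow>
     (\<forall>i<length Xs. \<forall>j<length Xs. i \<noteq> j \<longrightarrow>
        \<not> fragments_cross G (Xs ! i) (Xs ! j) \<and> nbhd G (Xs ! i) \<noteq> nbhd G (Xs ! j))"

subsection \<open>Adequacy of the encodings\<close>

lemma finite_disjoint_path_counts:
  assumes "pair_graph G"
  shows "finite {card Q | Q. Q \<subseteq> paths_between G u v \<and>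
           pairwise (\<lambda>xs ys. set xs \<inter> set ys \<subseteq> {u, v}) Q}" (is "finite ?A")
    and "{card Q | Q. Q \<subseteq> paths_between G u v \<and>
           pairwise (\<lambda>xs ys. set xs \<inter> set ys \<subseteq> {u, v}) Q} \<noteq> {}"
proof -
  interpret pair_graph G by fact
  have "paths_between G u v \<subseteq> {xs. set xs \<subseteq> pverts G \<and> distinct xs}"
    by (auto simp: paths_between_def vpath_def vwalk_def)
  then have "finite (paths_between G u v)"
    using finite_subset_distinct[OF pair_finite_verts] finite_subset by blast
  then have "finite (card ` Pow (paths_between G u v))"
    by simp
  then show "finite ?A"
    by (rule rev_finite_subset) auto
  show "?A \<noteq> {}"
    by (auto intro!: exI[of _ "{}"])
qed

lemma reflect_in_affine:
  fixes H :: "'e::euclidean_space set"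
  assumes "affine H" "H \<noteq> {}"
  shows "midpoint x (reflect_in H x) \<in> H"
    and "a \<in> H \<Longrightarrow> b \<in> H \<Longrightarrow> (reflect_in H x - x) \<bullet> (a - b) = 0"
proof -
  define c where "c = closest_point H x"
  have cl: "closed H"
    using closed_affine_hull[of H] assms(1) by (metis affine_hull_eq)
  have cv: "convex H"
    using assms(1) by (rule affine_imp_convex)
  have c: "c \<in> H"
    unfolding c_def by (rule closest_point_in_set[OF cl assms(2)])
  then show "midpoint x (reflect_in H x) \<in> H"
    by (simp add: midpoint_def reflect_in_def c_def)
  have le: "(x - c) \<bullet> (y - c) \<le> 0" if "y \<in> H" for y
    unfolding c_def by (rule closest_point_dot[OF cv cl that])
  have eq: "(x - c) \<bullet> (y - c) = 0" if y: "y \<in> H" for y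
  proof -
    have "2 *\<^sub>R c + (-1) *\<^sub>R y \<in> H"
      by (rule mem_affine[OF assms(1) c y]) simp
    from le[OF this] have "(x - c) \<bullet> (y - c) \<ge> 0"
      by (simp add: inner_diff_right inner_add_right)
    with le[OF y] show ?thesis by simp
  qed
  show "(reflect_in H x - x) \<bullet> (a - b) = 0" if "a \<in> H" "b \<in> H"
  proof -
    have "(reflect_in H x - x) = (-2) *\<^sub>R (x - c)"
      by (simp add: reflect_in_def c_def algebra_simps scaleR_2)
    moreover have "(x - c) \<bullet> (a - b) = 0"
      using eq[OF that(1)] eq[OF that(2)] by (simp add: inner_diff_right)
    ultimately show ?thesis by simp
  qed
qed

end

theory Submission
  imports Defs
begin

text \<open>
  At a generic point every linear dependence between rows of the rigidity matrix is the specialization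
  of a polynomial one.  Together with the identity
  \<open>|q u - q v|\<^sup>2 - |p u - p v|\<^sup>2 = 2 (m u - m v) \<bullet> (x u - x v)\<close> for \<open>q = p + x\<close>, \<open>m = p + x / 2\<close>, this shows
  that nontrivial infinitesimal flexes of generic frameworks integrate to real ones.  Explicit
  infinitesimal flexes then show that a rigid graph has no separator of size less than \<open>d\<close> and no two
  crossing \<open>d\<close>-separators.

  If the graph is \<open>d\<close>-joined, Menger's theorem turns "not separated by a \<open>d\<close>-separator" into "globally
  linked", so in a realization equivalent to a generic one only distances between vertices split by
  some \<open>d\<close>-separator can differ.  As the separators do not cross, they can be treated one after
  another: after an isometry that fixes a separator \<open>S\<close>, a vertex not split from \<open>S\<close> by anything is either
  correct or the mirror image of its correct place, uniformly on each component of \<open>G - S\<close>, and one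
  partial reflection repairs this.  Conversely, there are finitely many reduced sequences, so
  equivalent realizations that are close are congruent, and no partial reflection separates
  vertices joined by \<open>d + 1\<close> disjoint paths; other nonadjacent pairs change distance under a reflection
  in a hyperplane through a separator of size at most \<open>d\<close>.
\<close>

section \<open>Menger's theorem\<close>

text \<open>The passage from infinitesimal to real flexes has to work at an arbitrary generic point.
  Only the edges of a row basis are solved for, by a contraction; all other edges then keep their
  lengths because a dependence with polynomial coefficients also holds at the midpoint of the old
  and the new framework, where its leading coefficient, nonzero at \<open>p\<close>, is still
  nonzero.

  Crossing d-separators cut the graph into four corners, and the flex depends on which corners are
  empty. If two opposite ones are nonempty, counting forces both boundaries to have exactly d
  vertices, so that a hyperplane passes through each; otherwise one side of a separator lies inside
  the other separator, and a different flex is needed.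

  When separators are treated one by one, the intermediate frameworks are known only through their
  distances. The induction therefore carries, in place of genericity, the right distances on pairs
  not split by the remaining separators and the dimension of the span of each of these.\<close>

definition avoiding :: "('a \<times> 'a) set \<Rightarrow> 'a set \<Rightarrow> ('a \<times> 'a) set" where
  "avoiding E S = {(a, b) \<in> E. a \<notin> S \<and> b \<notin> S}"

text \<open>Deleted vertices only lose their arcs, so the reflexive closure still relates each of
  them to itself; the ends are therefore taken from \<open>A - S\<close> and \<open>B - S\<close>.
  The sets \<open>A\<close> and \<open>B\<close> may overlap, and then \<open>S\<close> must contain
  the overlap.\<close>

definition separates :: "('a \<times> 'a) set \<Rightarrow> 'a set \<Rightarrow> 'a set \<Rightarrow> 'a set \<Rightarrow> bool" where
  "separates E A B S \<longleftrightarrow> (\<forall>a\<in>A - S. \<forall>b\<in>B - S. (a, b) \<notin> (avoiding E S)\<^sup>*)"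

definition path_in :: "('a \<times> 'a) set \<Rightarrow> 'a list \<Rightarrow> bool" where
  "path_in E xs \<longleftrightarrow> xs \<noteq> [] \<and> distinct xs \<and> successively (\<lambda>a b. (a, b) \<in> E) xs"

lemma avoiding_converse: "avoiding (E\<inverse>) S = (avoiding E S)\<inverse>"
  by (auto simp: avoiding_def)

lemma separates_converse: "separates (E\<inverse>) B A S \<longleftrightarrow> separates E A B S"
  by (auto simp: separates_def avoiding_converse rtrancl_converse)

lemma avoiding_walk:
  assumes "xs \<noteq> []" "successively (\<lambda>a b. (a, b) \<in> E) xs" "set xs \<inter> S = {}"
  shows "(hd xs, last xs) \<in> (avoiding E S)\<^sup>*"
  using assms
proof (induction xs rule: induct_list012)
  case (3 a b xs)
  then have "(b, last (b # xs)) \<in> (avoiding E S)\<^sup>*" "(a, b) \<in> avoiding E S"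
    by (auto simp: avoiding_def)
  then show ?case by (auto intro: converse_rtrancl_into_rtrancl)
qed auto

lemma separates_insert_arc:
  assumes "separates E A B S"
  shows "separates (insert (x, y) E) A B (insert x S)"
    and "separates (insert (x, y) E) A B (insert y S)"
proof -
  have "avoiding (insert (x, y) E) (insert x S) \<subseteq> avoiding E S"
    "avoiding (insert (x, y) E) (insert y S) \<subseteq> avoiding E S"
    by (auto simp: avoiding_def)
  then have "(avoiding (insert (x, y) E) (insert x S))\<^sup>* \<subseteq> (avoiding E S)\<^sup>*"
    "(avoiding (insert (x, y) E) (insert y S))\<^sup>* \<subseteq> (avoiding E S)\<^sup>*"
    by (simp_all add: rtrancl_mono)
  then show "separates (insert (x, y) E) A B (insert x S)"
    "separates (insert (x, y) E) A B (insert y S)"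
    using assms by (auto simp: separates_def)
qed

text \<open>A walk avoiding \<open>W\<close> could use the new arc only after reaching
  \<open>x\<close> inside \<open>E\<close>, which \<open>W\<close> prevents, and for the same reason
  it never enters \<open>S\<close>. It is therefore a walk of \<open>E\<close> that avoids
  \<open>S\<close>. The induction has to carry these facts together.\<close>

lemma separates_through_tail:
  assumes S: "separates E A B S" and W: "separates E A (insert x S) W"
  shows "separates (insert (x, y) E) A B W"
  unfolding separates_def
proof (intro ballI notI)
  fix a b assume a: "a \<in> A - W" and b: "b \<in> B - W"
    and ab: "(a, b) \<in> (avoiding (insert (x, y) E) W)\<^sup>*"
  have a': "a \<notin> insert x S"
    using W a unfolding separates_def by blast
  from ab have "(a, b) \<in> (avoiding E W)\<^sup>* \<and> (a, b) \<in> (avoiding E S)\<^sup>* \<and> b \<notin> insert x S"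
  proof (induction rule: rtrancl_induct)
    case base
    then show ?case using a' by simp
  next
    case (step b c)
    then have bc: "(b, c) \<in> avoiding E W"
      by (auto simp: avoiding_def)
    with step have ac: "(a, c) \<in> (avoiding E W)\<^sup>*" by auto
    have "c \<notin> insert x S"
      using W a bc ac unfolding separates_def avoiding_def by blast
    then have "(b, c) \<in> avoiding E S"
      using bc step by (auto simp: avoiding_def)
    with step ac \<open>c \<notin> insert x S\<close> show ?case by auto
  qed
  then show False
    using S a a' b unfolding separates_def by blast
qed

lemma separates_through_head:
  assumes "separates E A B S" and "separates E (insert y S) B W"
  shows "separates (insert (x, y) E) A B W"
proof -
  have "separates (insert (y, x) (E\<inverse>)) B A W"
    using assms by (intro separates_through_tail[where S = S]) (simp_all add: separates_converse)
  moreover have "insert (y, x) (E\<inverse>) = (insert (x, y) E)\<inverse>" by auto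
  ultimately have "separates ((insert (x, y) E)\<inverse>) B A W" by simp
  then show ?thesis by (simp only: separates_converse)
qed

text \<open>There are as many paths as points of \<open>T\<close>, and disjoint paths have different
  markers \<open>\<phi> xs\<close>, so marking is a bijection. Hence a path contains no point of
  \<open>T\<close> besides its own marker. The markers will be \<open>last\<close> and
  \<open>hd\<close>.\<close>

lemma disjoint_paths_index:
  fixes \<phi> :: "'a list \<Rightarrow> 'a"
  assumes fin: "finite T" and card: "card P = card T"
    and \<phi>: "\<And>xs. xs \<in> P \<Longrightarrow> \<phi> xs \<in> T \<and> \<phi> xs \<in> set xs"
    and dis: "pairwise (\<lambda>xs ys. set xs \<inter> set ys = {}) P"
  shows "\<exists>f. (\<forall>t\<in>T. f t \<in> P \<and> \<phi> (f t) = t) \<and>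
    (\<forall>s\<in>T. \<forall>t\<in>T. s \<noteq> t \<longrightarrow> set (f s) \<inter> set (f t) = {}) \<and>
    (\<forall>s\<in>T. \<forall>t\<in>T. s \<in> set (f t) \<longrightarrow> s = t)"
proof -
  have "inj_on \<phi> P"
    using \<phi> dis by (fastforce simp: inj_on_def pairwise_def)
  moreover have "\<phi> ` P \<subseteq> T" using \<phi> by blast
  ultimately have "\<phi> ` P = T"
    using fin card by (simp add: card_image card_subset_eq)
  then have f: "inv_into P \<phi> t \<in> P \<and> \<phi> (inv_into P \<phi> t) = t" if "t \<in> T" for t
    using that by (auto simp: inv_into_into f_inv_into_f)
  have d: "set (inv_into P \<phi> s) \<inter> set (inv_into P \<phi> t) = {}"
    if "s \<in> T" "t \<in> T" "s \<noteq> t" for s t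
    using f[OF that(1)] f[OF that(2)] that(3) dis unfolding pairwise_def by metis
  have "s = t" if "s \<in> T" "t \<in> T" "s \<in> set (inv_into P \<phi> t)" for s t
    using d[OF that(1,2)] that f[OF that(1)] \<phi> by (metis disjoint_iff)
  with f d show ?thesis by blast
qed

lemma path_in_mono: "path_in E xs \<Longrightarrow> E \<subseteq> F \<Longrightarrow> path_in F xs"
  by (auto simp: path_in_def elim: successively_mono)

text \<open>Induction on the arcs. If deleting \<open>(x, y)\<close> admits a separator
  \<open>S\<close> with fewer than k points, it has exactly k - 1, and \<open>insert x S\<close> and
  \<open>insert y S\<close> are minimum separators of the larger graph. Disjoint paths into the
  first set and out of the second are glued in \<open>S\<close> and across the new arc.\<close>

theorem Menger:
  assumes "finite E" "finite A" "finite B"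
    and "\<And>S. finite S \<Longrightarrow> separates E A B S \<Longrightarrow> k \<le> card S"
  shows "\<exists>P. card P = k \<and> finite P \<and> (\<forall>xs\<in>P. path_in E xs \<and> hd xs \<in> A \<and> last xs \<in> B) \<and>
           pairwise (\<lambda>xs ys. set xs \<inter> set ys = {}) P"
  using assms
proof (induction E arbitrary: A B rule: finite_induct)
  case empty
  \<comment> \<open>Without arcs the only paths are single vertices of
    \<open>A \<inter> B\<close>.\<close>
  have "separates {} A B (A \<inter> B)"
    by (auto simp: separates_def avoiding_def)
  then have "k \<le> card (A \<inter> B)" using empty by auto
  then obtain Z where Z: "Z \<subseteq> A \<inter> B" "card Z = k" "finite Z"
    by (metis obtain_subset_with_card_n)
  have "card ((\<lambda>z. [z]) ` Z) = k"
    using Z(2) by (simp add: card_image inj_on_def)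
  with Z show ?case
    by (intro exI[of _ "(\<lambda>z. [z]) ` Z"]) (auto simp: pairwise_def path_in_def)
next
  case (insert e E)
  obtain x y where e: "e = (x, y)" by force
  show ?case
  proof (cases "\<forall>S. finite S \<longrightarrow> separates E A B S \<longrightarrow> k \<le> card S")
    case True
    with insert.IH[OF insert.prems(1,2)] show ?thesis
      by (meson path_in_mono subset_insertI)
  next
    case False
    then obtain S where S: "finite S" "separates E A B S" "card S < k" by auto
    have kx: "k \<le> card (insert x S)" and ky: "k \<le> card (insert y S)"
      using separates_insert_arc[OF S(2)] insert.prems(3) S(1) e by blast+
    then have xy: "x \<notin> S" "y \<notin> S" and cx: "card (insert x S) = k" and cy: "card (insert y S) = k"
      using S by (auto simp: card_insert_if split: if_splits)
    have "k \<le> card W" if "finite W" "separates E A (insert x S) W" for W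
      using separates_through_tail[OF S(2) that(2)] insert.prems(3) that(1) e by blast
    then have "\<exists>P. card P = k \<and> finite P \<and>
        (\<forall>xs\<in>P. path_in E xs \<and> hd xs \<in> A \<and> last xs \<in> insert x S) \<and>
        pairwise (\<lambda>xs ys. set xs \<inter> set ys = {}) P"
      by (intro insert.IH) (auto simp: S(1) insert.prems(1,2))
    then obtain P where P: "card P = k" "finite P" "\<forall>xs\<in>P. path_in E xs \<and> hd xs \<in> A \<and> last xs \<in> insert x S"
      "pairwise (\<lambda>xs ys. set xs \<inter> set ys = {}) P"
      by blast
    have "k \<le> card W" if "finite W" "separates E (insert y S) B W" for W
      using separates_through_head[OF S(2) that(2)] insert.prems(3) that(1) e by blast
    then have "\<exists>P. card P = k \<and> finite P \<and>
        (\<forall>xs\<in>P. path_in E xs \<and> hd xs \<in> insert y S \<and> last xs \<in> B) \<and>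
        pairwise (\<lambda>xs ys. set xs \<inter> set ys = {}) P"
      by (intro insert.IH) (auto simp: S(1) insert.prems(1,2))
    then obtain Q where Q: "card Q = k" "finite Q" "\<forall>xs\<in>Q. path_in E xs \<and> hd xs \<in> insert y S \<and> last xs \<in> B"
      "pairwise (\<lambda>xs ys. set xs \<inter> set ys = {}) Q"
      by blast
    have "\<exists>f. (\<forall>t\<in>insert x S. f t \<in> P \<and> last (f t) = t) \<and>
        (\<forall>s\<in>insert x S. \<forall>t\<in>insert x S. s \<noteq> t \<longrightarrow> set (f s) \<inter> set (f t) = {}) \<and>
        (\<forall>s\<in>insert x S. \<forall>t\<in>insert x S. s \<in> set (f t) \<longrightarrow> s = t)"
    proof (rule disjoint_paths_index)
      show "last xs \<in> insert x S \<and> last xs \<in> set xs" if "xs \<in> P" for xs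
        using P(3) that by (simp add: path_in_def)
    qed (simp_all only: finite_insert S(1) P(1,4) cx)
    then obtain f where f_all: "\<forall>t\<in>insert x S. f t \<in> P \<and> last (f t) = t"
        "\<forall>s\<in>insert x S. \<forall>t\<in>insert x S. s \<noteq> t \<longrightarrow> set (f s) \<inter> set (f t) = {}"
        "\<forall>s\<in>insert x S. \<forall>t\<in>insert x S. s \<in> set (f t) \<longrightarrow> s = t"
      by (elim exE conjE)
    note f = f_all(1)[rule_format] and fd = f_all(2)[rule_format]
      and fu = f_all(3)[rule_format]
    have "\<exists>f. (\<forall>t\<in>insert y S. f t \<in> Q \<and> hd (f t) = t) \<and>
        (\<forall>s\<in>insert y S. \<forall>t\<in>insert y S. s \<noteq> t \<longrightarrow> set (f s) \<inter> set (f t) = {}) \<and>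
        (\<forall>s\<in>insert y S. \<forall>t\<in>insert y S. s \<in> set (f t) \<longrightarrow> s = t)"
    proof (rule disjoint_paths_index)
      show "hd xs \<in> insert y S \<and> hd xs \<in> set xs" if "xs \<in> Q" for xs
        using Q(3) that by (simp add: path_in_def)
    qed (simp_all only: finite_insert S(1) Q(1,4) cy)
    then obtain g where g_all: "\<forall>t\<in>insert y S. g t \<in> Q \<and> hd (g t) = t"
        "\<forall>s\<in>insert y S. \<forall>t\<in>insert y S. s \<noteq> t \<longrightarrow> set (g s) \<inter> set (g t) = {}"
        "\<forall>s\<in>insert y S. \<forall>t\<in>insert y S. s \<in> set (g t) \<longrightarrow> s = t"
      by (elim exE conjE)
    note g = g_all(1)[rule_format] and gd = g_all(2)[rule_format]
      and gu = g_all(3)[rule_format]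
    \<comment> \<open>If the two paths met outside \<open>S\<close>, the start of the first and the
      end of the second would form a walk from \<open>A\<close> to \<open>B\<close> avoiding
      \<open>S\<close>, as each path meets its set of markers only in its own marker.\<close>
    have meet: "r = s \<and> r = t \<and> r \<in> S"
      if s: "s \<in> insert x S" and t: "t \<in> insert y S" and r: "r \<in> set (f s)" "r \<in> set (g t)" for r s t
    proof -
      have fs: "path_in E (f s)" "hd (f s) \<in> A" "last (f s) = s" using f[OF s] P by auto
      have gt: "path_in E (g t)" "last (g t) \<in> B" "hd (g t) = t" using g[OF t] Q by auto
      have "r \<in> S"
      proof (rule ccontr)
        assume rS: "r \<notin> S"
        obtain us vs where uv: "f s = us @ r # vs" using r(1) by (meson split_list)
        obtain us' vs' where uv': "g t = us' @ r # vs'" using r(2) by (meson split_list)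
        have d1: "z \<notin> S" if "z \<in> set us" for z
        proof
          assume "z \<in> S"
          then have "z = s" using that fu s uv by auto
          moreover have "s \<in> set (r # vs)" using fs(3) uv by (metis last_appendR last_in_set list.distinct(1))
          ultimately show False using that fs(1) uv by (auto simp: path_in_def)
        qed
        have d2: "z \<notin> S" if "z \<in> set vs'" for z
        proof
          assume "z \<in> S"
          then have "z = t" using that gu t uv' by auto
          moreover have "t \<in> set (us' @ [r])" using gt(3) uv' by (cases us') auto
          ultimately show False using that gt(1) uv' by (auto simp: path_in_def)
        qed
        have "(hd (us @ [r]), last (us @ [r])) \<in> (avoiding E S)\<^sup>*"
          using fs(1) uv d1 rS
          by (intro avoiding_walk) (auto simp: path_in_def successively_append_iff)
        moreover have "hd (us @ [r]) = hd (f s)" using uv by (cases us) auto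
        moreover have "(hd (r # vs'), last (r # vs')) \<in> (avoiding E S)\<^sup>*"
          using gt(1) uv' d2 rS
          by (intro avoiding_walk) (auto simp: path_in_def successively_append_iff)
        moreover have "last (r # vs') = last (g t)" using uv' by simp
        ultimately have "(hd (f s), last (g t)) \<in> (avoiding E S)\<^sup>*"
          by (metis last_snoc list.sel(1) rtrancl_trans)
        moreover have "hd (f s) \<notin> S" using uv d1 rS by (cases us) auto
        moreover have "last (g t) \<notin> S" using uv' d2 rS by auto
        ultimately show False using S(2) fs(2) gt(2) unfolding separates_def by blast
      qed
      then show ?thesis using fu gu s t r by blast
    qed
    define \<sigma> where "\<sigma> s = (if s = x then y else s)" for s
    \<comment> \<open>For \<open>s\<close> in \<open>S\<close> the two paths share the vertex
      \<open>s\<close>, hence the \<open>tl\<close>; the path ending in \<open>x\<close> goes on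
      over the new arc to \<open>y\<close>.\<close>
    define h where "h s = (if s = x then f x @ g y else f s @ tl (g s))" for s
    have \<sigma>: "\<sigma> s \<in> insert y S" if "s \<in> insert x S" for s
      using that by (auto simp: \<sigma>_def)
    have seth: "set (h s) = set (f s) \<union> set (g (\<sigma> s))" if "s \<in> insert x S" for s
    proof (cases "s = x")
      case False
      then have sS: "s \<in> S" using that by auto
      then have "g s \<noteq> []" "hd (g s) = s" using g Q by (auto simp: path_in_def)
      then have "set (g s) = insert s (set (tl (g s)))" by (metis list.collapse list.simps(15))
      moreover have "s \<in> set (f s)" using f[of s] sS P by (metis insertCI last_in_set path_in_def)
      ultimately show ?thesis using False by (auto simp: h_def \<sigma>_def)
    qed (auto simp: h_def \<sigma>_def)
    have hne: "h s \<noteq> []" if "s \<in> insert x S" for s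
      using f[OF that] P(3) by (auto simp: h_def path_in_def)
    have hp: "path_in (insert e E) (h s) \<and> hd (h s) \<in> A \<and> last (h s) \<in> B" if s: "s \<in> insert x S" for s
    proof -
      have fs: "path_in E (f s)" "hd (f s) \<in> A" "last (f s) = s" using f[OF s] P by auto
      have gt: "path_in E (g (\<sigma> s))" "last (g (\<sigma> s)) \<in> B" "hd (g (\<sigma> s)) = \<sigma> s"
        using g[OF \<sigma>[OF s]] Q by auto
      have fs': "successively (\<lambda>a b. (a, b) \<in> insert e E) (f s)"
        and gt': "successively (\<lambda>a b. (a, b) \<in> insert e E) (g (\<sigma> s))"
        using path_in_mono[OF fs(1), of "insert e E"] path_in_mono[OF gt(1), of "insert e E"]
        by (auto simp: path_in_def)
      show ?thesis
      proof (cases "s = x")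
        case True
        have "set (f x) \<inter> set (g y) = {}"
          using meet[of x y] xy by auto
        then show ?thesis
          using fs gt fs' gt' True e
          by (auto simp: path_in_def h_def \<sigma>_def successively_append_iff hd_append)
      next
        case False
        then have sS: "s \<in> S" using s by auto
        from False gt have gs: "g s \<noteq> []" "distinct (g s)" "hd (g s) = s" "\<sigma> s = s"
          by (auto simp: \<sigma>_def path_in_def)
        then obtain zs where zs: "g s = s # zs" by (metis list.collapse)
        have "set (f s) \<inter> set zs = {}"
        proof -
          have "r = s" if "r \<in> set (f s)" "r \<in> set zs" for r
            using meet[of s s r] sS that zs by auto
          then show ?thesis using gs zs by auto
        qed
        moreover have "successively (\<lambda>a b. (a, b) \<in> insert e E) (f s @ zs)"
          using fs fs' gt' gs(4) zs
          by (cases zs) (auto simp: successively_append_iff)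
        moreover have "last (f s @ zs) \<in> B"
          using gt(2) gs(4) zs fs(3) by (cases zs) auto
        ultimately show ?thesis
          using fs gs zs False by (auto simp: path_in_def h_def hd_append)
      qed
    qed
    have dis: "set (h s) \<inter> set (h s') = {}" if "s \<in> insert x S" "s' \<in> insert x S" "s \<noteq> s'" for s s'
    proof -
      have "\<sigma> s \<noteq> \<sigma> s'" using that xy by (auto simp: \<sigma>_def)
      then have 1: "set (g (\<sigma> s)) \<inter> set (g (\<sigma> s')) = {}" using gd \<sigma> that by auto
      have 2: "set (f s) \<inter> set (f s') = {}" using fd that by auto
      have 3: "set (f s) \<inter> set (g (\<sigma> s')) = {}"
        if "s \<in> insert x S" "s' \<in> insert x S" "s \<noteq> s'" for s s'
      proof -
        have "r \<notin> set (g (\<sigma> s'))" if r: "r \<in> set (f s)" for r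
        proof
          assume "r \<in> set (g (\<sigma> s'))"
          with meet[OF \<open>s \<in> insert x S\<close> \<sigma>[OF \<open>s' \<in> insert x S\<close>] r]
          have "r = s \<and> r = \<sigma> s' \<and> r \<in> S" by blast
          then show False using \<open>s \<noteq> s'\<close> xy by (auto simp: \<sigma>_def split: if_splits)
        qed
        then show ?thesis by blast
      qed
      show ?thesis using 1 2 3[OF that] 3[OF that(2,1)] seth that by auto
    qed
    have "inj_on h (insert x S)"
    proof (rule inj_onI, rule ccontr)
      fix s t assume st: "s \<in> insert x S" "t \<in> insert x S" "h s = h t" "s \<noteq> t"
      have "set (h s) \<inter> set (h t) = {}" by (rule dis[OF st(1,2,4)])
      then show False using st(3) hne[OF st(1)] by simp
    qed
    then have "card (h ` insert x S) = k" using card_image cx by blast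
    moreover have "pairwise (\<lambda>xs ys. set xs \<inter> set ys = {}) (h ` insert x S)"
    proof (rule pairwiseI)
      fix xs ys assume "xs \<in> h ` insert x S" "ys \<in> h ` insert x S" "xs \<noteq> ys"
      then obtain s t where "s \<in> insert x S" "t \<in> insert x S" "s \<noteq> t" "xs = h s" "ys = h t"
        by blast
      then show "set xs \<inter> set ys = {}" using dis by simp
    qed
    ultimately show ?thesis
      using hp S(1) by (intro exI[of _ "h ` insert x S"] conjI) simp_all
  qed
qed

section \<open>Rational polynomials in the coordinates of a configuration\<close>

abbreviation monomial_value :: "('i \<Rightarrow> real) \<Rightarrow> ('i \<Rightarrow>\<^sub>0 nat) \<Rightarrow> real" where
  "monomial_value x m \<equiv> (\<Prod>i\<in>Poly_Mapping.keys m. x i ^ Poly_Mapping.lookup m i)"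

lemma monomial_value_superset:
  assumes "finite K" "Poly_Mapping.keys m \<subseteq> K"
  shows "monomial_value x m = (\<Prod>i\<in>K. x i ^ Poly_Mapping.lookup m i)"
  using assms by (intro prod.mono_neutral_left) (auto simp: in_keys_iff)

lemma monomial_value_add: "monomial_value x (m + m') = monomial_value x m * monomial_value x m'"
proof -
  let ?K = "Poly_Mapping.keys m \<union> Poly_Mapping.keys m'"
  have "Poly_Mapping.keys (m + m') \<subseteq> ?K" by (rule keys_add)
  then have "monomial_value x (m + m') = (\<Prod>i\<in>?K. x i ^ Poly_Mapping.lookup (m + m') i)"
    by (intro monomial_value_superset) simp
  moreover have "monomial_value x m = (\<Prod>i\<in>?K. x i ^ Poly_Mapping.lookup m i)"
    "monomial_value x m' = (\<Prod>i\<in>?K. x i ^ Poly_Mapping.lookup m' i)"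
    by (intro monomial_value_superset; simp)+
  ultimately show ?thesis
    by (simp only: lookup_add power_add prod.distrib)
qed

lemma eval_poly_zero [simp]: "eval_poly x 0 = 0"
  by (simp add: eval_poly_def)

lemma eval_poly_single: "eval_poly x (Poly_Mapping.single m c) = of_rat c * monomial_value x m"
  by (simp add: eval_poly_def)

lemma eval_poly_add: "eval_poly x (P + Q) = eval_poly x P + eval_poly x Q"
  unfolding eval_poly_def
  by (rule setsum_keys_plus_distrib) (simp_all add: of_rat_add distrib_right)

lemma eval_poly_sum: "eval_poly x (\<Sum>a\<in>A. P a) = (\<Sum>a\<in>A. eval_poly x (P a))"
  by (induction A rule: infinite_finite_induct) (simp_all add: eval_poly_add)

abbreviation coordinates :: "('a \<Rightarrow> real ^ 'n) \<Rightarrow> 'a \<times> 'n \<Rightarrow> real" where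
  "coordinates p \<equiv> (\<lambda>(v, i). p v $ i)"

definition generic_on :: "'a set \<Rightarrow> ('a \<Rightarrow> real ^ 'n) \<Rightarrow> bool" where
  "generic_on V p \<longleftrightarrow> alg_independent_on (V \<times> UNIV) (coordinates p)"

text \<open>Polynomials are handled as functions of the configuration, so that closure rules apply
  directly to terms such as determinants. The witness is the same for all \<open>p\<close>, which
  makes vanishing at one generic configuration a statement about coefficients.\<close>

definition config_poly :: "'a set \<Rightarrow> (('a \<Rightarrow> real ^ 'n) \<Rightarrow> real) \<Rightarrow> bool" where
  "config_poly V F \<longleftrightarrow> (\<exists>P. (\<forall>m\<in>Poly_Mapping.keys P. Poly_Mapping.keys m \<subseteq> V \<times> UNIV) \<and>
     (\<forall>p. F p = eval_poly (coordinates p) P))"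

lemma config_poly_monomial:
  assumes "Poly_Mapping.keys m \<subseteq> V \<times> UNIV"
  shows "config_poly V (\<lambda>p. of_rat c * monomial_value (coordinates p) m)"
  unfolding config_poly_def using assms
  by (intro exI[of _ "Poly_Mapping.single m c"]) (auto simp: eval_poly_single split: if_splits)

lemma config_poly_const: "config_poly V (\<lambda>p. of_rat c)"
  using config_poly_monomial[of 0 V c] by simp

lemma config_poly_0: "config_poly V (\<lambda>p. 0)" and config_poly_1: "config_poly V (\<lambda>p. 1)"
  using config_poly_const[of V 0] config_poly_const[of V 1] by simp_all

lemma config_poly_coordinate: "v \<in> V \<Longrightarrow> config_poly V (\<lambda>p. p v $ i)"
  using config_poly_monomial[of "Poly_Mapping.single (v, i) 1" V 1] by simp

lemma config_poly_add:
  assumes "config_poly V F" "config_poly V H"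
  shows "config_poly V (\<lambda>p. F p + H p)"
proof -
  obtain P Q where P: "\<forall>m\<in>Poly_Mapping.keys P. Poly_Mapping.keys m \<subseteq> V \<times> UNIV"
      "\<forall>p. F p = eval_poly (coordinates p) P"
    and Q: "\<forall>m\<in>Poly_Mapping.keys Q. Poly_Mapping.keys m \<subseteq> V \<times> UNIV"
      "\<forall>p. H p = eval_poly (coordinates p) Q"
    using assms unfolding config_poly_def by blast
  have "\<forall>m\<in>Poly_Mapping.keys (P + Q). Poly_Mapping.keys m \<subseteq> V \<times> UNIV"
    using P(1) Q(1) keys_add[of P Q] by blast
  moreover have "\<forall>p. F p + H p = eval_poly (coordinates p) (P + Q)"
    by (simp add: eval_poly_add P(2) Q(2))
  ultimately show ?thesis
    unfolding config_poly_def by blast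
qed

lemma config_poly_sum:
  "(\<And>a. a \<in> A \<Longrightarrow> config_poly V (F a)) \<Longrightarrow> config_poly V (\<lambda>p. \<Sum>a\<in>A. F a p)"
  by (induction A rule: infinite_finite_induct) (simp_all add: config_poly_0 config_poly_add)

lemma config_poly_mult:
  assumes "config_poly V F" "config_poly V H"
  shows "config_poly V (\<lambda>p. F p * H p)"
proof -
  obtain P Q where P: "\<forall>m\<in>Poly_Mapping.keys P. Poly_Mapping.keys m \<subseteq> V \<times> UNIV"
      "\<forall>p. F p = eval_poly (coordinates p) P"
    and Q: "\<forall>m\<in>Poly_Mapping.keys Q. Poly_Mapping.keys m \<subseteq> V \<times> UNIV"
      "\<forall>p. H p = eval_poly (coordinates p) Q"
    using assms unfolding config_poly_def by blast
  have eq: "F p * H p = (\<Sum>m\<in>Poly_Mapping.keys P. \<Sum>m'\<in>Poly_Mapping.keys Q.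
      of_rat (Poly_Mapping.lookup P m * Poly_Mapping.lookup Q m') *
      monomial_value (coordinates p) (m + m'))" for p
    unfolding P(2)[rule_format] Q(2)[rule_format] eval_poly_def sum_product monomial_value_add
    by (intro sum.cong refl) (simp add: of_rat_mult)
  have "Poly_Mapping.keys (m + m') \<subseteq> V \<times> UNIV"
    if "m \<in> Poly_Mapping.keys P" "m' \<in> Poly_Mapping.keys Q" for m m'
    using P(1) Q(1) keys_add[of m m'] that by blast
  then show ?thesis
    unfolding eq by (intro config_poly_sum config_poly_monomial)
qed

lemma config_poly_diff:
  assumes "config_poly V F" "config_poly V H"
  shows "config_poly V (\<lambda>p. F p - H p)"
  using config_poly_add[OF assms(1) config_poly_mult[OF config_poly_const[of V "-1"] assms(2)]]
  by (simp add: of_rat_minus)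

lemma config_poly_prod:
  "(\<And>a. a \<in> A \<Longrightarrow> config_poly V (F a)) \<Longrightarrow> config_poly V (\<lambda>p. \<Prod>a\<in>A. F a p)"
  by (induction A rule: infinite_finite_induct) (simp_all add: config_poly_1 config_poly_mult)

text \<open>All arguments from genericity come down to this: a polynomial relation over the
  rationals that holds at one generic configuration is an identity.\<close>

lemma config_poly_eq_0:
  assumes "generic_on V p" "config_poly V F" "F p = 0"
  shows "F q = 0"
proof -
  obtain P where P: "\<forall>m\<in>Poly_Mapping.keys P. Poly_Mapping.keys m \<subseteq> V \<times> UNIV"
      "\<forall>p. F p = eval_poly (coordinates p) P"
    using assms(2) unfolding config_poly_def by blast
  then have "P = 0"
    using assms(1,3) unfolding generic_on_def alg_independent_on_def by auto
  with P(2) show ?thesis by simp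
qed

lemma config_poly_tendsto:
  assumes "config_poly V F" "\<And>v. v \<in> V \<Longrightarrow> ((\<lambda>t. x t v) \<longlongrightarrow> p v) net"
  shows "((\<lambda>t. F (x t)) \<longlongrightarrow> F p) net"
proof -
  obtain P where P: "\<forall>m\<in>Poly_Mapping.keys P. Poly_Mapping.keys m \<subseteq> V \<times> UNIV"
      "\<forall>p. F p = eval_poly (coordinates p) P"
    using assms(1) unfolding config_poly_def by blast
  have "((\<lambda>t. x t v $ i) \<longlongrightarrow> p v $ i) net" if "(v, i) \<in> Poly_Mapping.keys m" "m \<in> Poly_Mapping.keys P"
    for v i m
    using P(1) that by (intro tendsto_vec_nth assms(2)) blast
  then show ?thesis
    unfolding P(2)[rule_format] eval_poly_def
    by (intro tendsto_sum tendsto_mult tendsto_prod tendsto_power tendsto_const) auto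
qed

subsection \<open>Existence of generic configurations\<close>

text \<open>Union over the countably many finite supports. It is applied twice, to exponent
  functions and then to polynomials, whose supports are sets of exponent functions.\<close>

lemma countable_poly_mapping:
  fixes M :: "'m set"
  assumes "countable M"
  shows "countable {P :: 'm \<Rightarrow>\<^sub>0 ('c :: {zero, countable}). Poly_Mapping.keys P \<subseteq> M}"
proof -
  have fin: "countable {P :: 'm \<Rightarrow>\<^sub>0 'c. Poly_Mapping.keys P \<subseteq> F}" if "finite F" for F
  proof (rule countable_image_inj_on)
    let ?r = "\<lambda>P :: 'm \<Rightarrow>\<^sub>0 'c. restrict (Poly_Mapping.lookup P) F"
    have "countable (PiE F (\<lambda>_. UNIV :: 'c set))"
      using that by (intro countable_PiE) simp_all
    then show "countable (?r ` {P. Poly_Mapping.keys P \<subseteq> F})"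
      by (rule countable_subset[rotated]) (auto simp: PiE_def)
    show "inj_on ?r {P. Poly_Mapping.keys P \<subseteq> F}"
    proof (rule inj_onI, rule poly_mapping_eqI)
      fix P Q :: "'m \<Rightarrow>\<^sub>0 'c" and k
      assume PQ: "P \<in> {P. Poly_Mapping.keys P \<subseteq> F}" "Q \<in> {P. Poly_Mapping.keys P \<subseteq> F}" "?r P = ?r Q"
      show "Poly_Mapping.lookup P k = Poly_Mapping.lookup Q k"
      proof (cases "k \<in> F")
        case True
        then show ?thesis using fun_cong[OF PQ(3), of k] by simp
      next
        case False
        then have "k \<notin> Poly_Mapping.keys P" "k \<notin> Poly_Mapping.keys Q" using PQ(1,2) by blast+
        then show ?thesis by (simp add: in_keys_iff)
      qed
    qed
  qed
  have "countable (\<Union>F\<in>{A. finite A \<and> A \<subseteq> M}. {P :: 'm \<Rightarrow>\<^sub>0 'c. Poly_Mapping.keys P \<subseteq> F})"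
    by (rule countable_UN[OF countable_Collect_finite_subset[OF assms]]) (simp add: fin)
  then show ?thesis
    by (rule countable_subset[rotated]) (blast intro: finite_keys)
qed

text \<open>As a polynomial in the last variable, \<open>P\<close> has as coefficients the values at
  \<open>x\<close> of polynomials in the variables of \<open>I\<close>. One of these is a nonzero
  polynomial, so by independence its value is not 0 and the univariate polynomial is
  nonzero.\<close>

lemma finite_roots_eval_poly:
  assumes alg: "alg_independent_on I x" and i: "i \<notin> I"
    and P: "\<forall>m\<in>Poly_Mapping.keys P. Poly_Mapping.keys m \<subseteq> insert i I" "P \<noteq> 0"
  shows "finite {t. eval_poly (x(i := t)) P = 0}"
proof -
  define rem where "rem = Poly_Mapping.update i (0 :: nat)"
  have lrem: "Poly_Mapping.lookup (rem m) j = (if j = i then 0 else Poly_Mapping.lookup m j)" for m j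
    by (simp add: rem_def lookup_update)
  have krem: "Poly_Mapping.keys (rem m) = Poly_Mapping.keys m - {i}" for m
    by (auto simp: in_keys_iff lrem split: if_splits)
  have mv: "monomial_value (x(i := t)) m = monomial_value x (rem m) * t ^ Poly_Mapping.lookup m i"
    for t m
  proof -
    have "monomial_value (x(i := t)) m =
        (\<Prod>j\<in>insert i (Poly_Mapping.keys m). (x(i := t)) j ^ Poly_Mapping.lookup m j)"
      by (rule monomial_value_superset) auto
    also have "\<dots> = t ^ Poly_Mapping.lookup m i *
        (\<Prod>j\<in>Poly_Mapping.keys m - {i}. (x(i := t)) j ^ Poly_Mapping.lookup m j)"
      by (subst prod.insert_remove) auto
    also have "(\<Prod>j\<in>Poly_Mapping.keys m - {i}. (x(i := t)) j ^ Poly_Mapping.lookup m j) =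
        monomial_value x (rem m)"
      unfolding krem by (intro prod.cong) (auto simp: lrem)
    finally show ?thesis by simp
  qed
  define q where "q = (\<Sum>m\<in>Poly_Mapping.keys P.
    monom (of_rat (Poly_Mapping.lookup P m) * monomial_value x (rem m)) (Poly_Mapping.lookup m i))"
  have poly_q: "poly q t = eval_poly (x(i := t)) P" for t
    unfolding q_def poly_sum poly_monom eval_poly_def mv by (simp only: mult.assoc)
  obtain m0 where m0: "m0 \<in> Poly_Mapping.keys P"
    using P(2) keys_eq_empty by blast
  \<comment> \<open>\<open>K\<close> collects the terms having the same power of the variable
    \<open>i\<close> as \<open>m0\<close>. Deleting that power is injective on \<open>K\<close>, so
    no cancellation occurs in \<open>R\<close>.\<close>
  define K where "K = {m \<in> Poly_Mapping.keys P. Poly_Mapping.lookup m i = Poly_Mapping.lookup m0 i}"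
  define R where "R = (\<Sum>m\<in>K. Poly_Mapping.single (rem m) (Poly_Mapping.lookup P m))"
  have fK: "finite K" by (simp add: K_def)
  have inj: "m = m'" if "m \<in> K" "m' \<in> K" "rem m = rem m'" for m m'
  proof (rule poly_mapping_eqI)
    fix j
    show "Poly_Mapping.lookup m j = Poly_Mapping.lookup m' j"
      using lrem[of m j] lrem[of m' j] that by (auto simp: K_def split: if_splits)
  qed
  have "Poly_Mapping.lookup R (rem m0) = (\<Sum>m\<in>K. if m = m0 then Poly_Mapping.lookup P m else 0)"
    unfolding R_def lookup_sum
    using inj m0 by (intro sum.cong) (auto simp: lookup_single when_def K_def)
  also have "\<dots> \<noteq> 0"
    using m0 fK by (simp add: K_def in_keys_iff)
  finally have "R \<noteq> 0" by auto
  moreover have "\<forall>m\<in>Poly_Mapping.keys R. Poly_Mapping.keys m \<subseteq> I"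
  proof
    fix m assume "m \<in> Poly_Mapping.keys R"
    then obtain m' where "m' \<in> K" "m = rem m'"
      using keys_sum[of "\<lambda>m. Poly_Mapping.single (rem m) (Poly_Mapping.lookup P m)" K]
      unfolding R_def by (auto split: if_splits)
    then show "Poly_Mapping.keys m \<subseteq> I"
      using P(1) by (auto simp: krem K_def)
  qed
  ultimately have "eval_poly x R \<noteq> 0"
    using alg unfolding alg_independent_on_def by blast
  moreover have "coeff q (Poly_Mapping.lookup m0 i) = eval_poly x R"
  proof -
    have "coeff q (Poly_Mapping.lookup m0 i) = (\<Sum>m\<in>Poly_Mapping.keys P.
        if Poly_Mapping.lookup m i = Poly_Mapping.lookup m0 i
        then of_rat (Poly_Mapping.lookup P m) * monomial_value x (rem m) else 0)"
      by (simp add: q_def coeff_sum)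
    also have "\<dots> = eval_poly x R"
      unfolding R_def eval_poly_sum eval_poly_single K_def by (simp add: sum.inter_filter)
    finally show ?thesis .
  qed
  ultimately have "q \<noteq> 0" by auto
  then show ?thesis
    using poly_roots_finite[of q] by (simp add: poly_q)
qed

text \<open>A new coordinate has to avoid the finitely many roots of each of countably many
  polynomials, and the reals are uncountable.\<close>

lemma ex_alg_independent:
  assumes "finite I"
  shows "\<exists>x. alg_independent_on I x"
  using assms
proof (induction I rule: finite_induct)
  case empty
  have "P = 0" if "\<forall>m\<in>Poly_Mapping.keys P. Poly_Mapping.keys m \<subseteq> {}" "eval_poly (\<lambda>_. 0) P = 0"
    for P :: "('a \<Rightarrow>\<^sub>0 nat) \<Rightarrow>\<^sub>0 rat"
  proof -
    have "Poly_Mapping.keys P \<subseteq> {0}"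
      using that(1) by auto
    then have "eval_poly (\<lambda>_. 0) P = of_rat (Poly_Mapping.lookup P 0)"
      by (cases "Poly_Mapping.keys P = {}") (auto simp: eval_poly_def subset_singleton_iff)
    with that(2) have "0 \<notin> Poly_Mapping.keys P"
      by (simp add: in_keys_iff)
    with \<open>Poly_Mapping.keys P \<subseteq> {0}\<close> have "Poly_Mapping.keys P = {}" by blast
    then show ?thesis by simp
  qed
  then show ?case
    unfolding alg_independent_on_def by blast
next
  case (insert i I)
  then obtain x where x: "alg_independent_on I x" by blast
  let ?M = "{m :: 'a \<Rightarrow>\<^sub>0 nat. Poly_Mapping.keys m \<subseteq> insert i I}"
  let ?PP = "{P :: ('a \<Rightarrow>\<^sub>0 nat) \<Rightarrow>\<^sub>0 rat. Poly_Mapping.keys P \<subseteq> ?M}"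
  have "countable (insert i I)"
    using insert.hyps(1) by (simp add: countable_finite)
  then have "countable ?M" by (rule countable_poly_mapping)
  then have "countable ?PP" by (rule countable_poly_mapping)
  then have "countable (?PP - {0})" by (rule countable_subset[rotated]) blast
  moreover have "countable {t. eval_poly (x(i := t)) P = 0}" if "P \<in> ?PP - {0}" for P
  proof (rule countable_finite, rule finite_roots_eval_poly[OF x insert.hyps(2)])
    show "\<forall>m\<in>Poly_Mapping.keys P. Poly_Mapping.keys m \<subseteq> insert i I" "P \<noteq> 0"
      using that by blast+
  qed
  ultimately have "countable (\<Union>P\<in>?PP - {0}. {t. eval_poly (x(i := t)) P = 0})"
    by (rule countable_UN)
  then have "(\<Union>P\<in>?PP - {0}. {t. eval_poly (x(i := t)) P = 0}) \<noteq> (UNIV :: real set)"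
    using uncountable_UNIV_real by (intro notI) (simp only:)
  then obtain t where t: "t \<notin> (\<Union>P\<in>?PP - {0}. {t. eval_poly (x(i := t)) P = 0})"
    by (auto simp only: set_eq_iff UNIV_I simp_thms)
  have "alg_independent_on (insert i I) (x(i := t))"
    unfolding alg_independent_on_def
  proof (intro allI impI, rule ccontr)
    fix P assume P: "(\<forall>m\<in>Poly_Mapping.keys P. Poly_Mapping.keys m \<subseteq> insert i I) \<and>
      eval_poly (x(i := t)) P = 0" "P \<noteq> 0"
    then have "P \<in> ?PP - {0}" by auto
    moreover have "t \<in> {t. eval_poly (x(i := t)) P = 0}" using P(1) by (simp only: mem_Collect_eq)
    ultimately show False using t by (simp only: UN_I simp_thms)
  qed
  then show ?case by blast
qed

text \<open>Supplies the witness for pairs that are not globally linked: a claim about every generic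
  realization would be empty if there were none.\<close>

lemma ex_generic_on:
  assumes "finite V"
  shows "\<exists>p :: 'a \<Rightarrow> real ^ 'n. generic_on V p"
proof -
  obtain x :: "'a \<times> 'n \<Rightarrow> real" where x: "alg_independent_on (V \<times> UNIV) x"
    using ex_alg_independent[of "V \<times> (UNIV :: 'n set)"] assms by (auto simp: finite_cartesian_product)
  have eq: "coordinates (\<lambda>v. \<chi> i. x (v, i)) = x" by (rule ext) (simp add: case_prod_beta)
  have "generic_on V (\<lambda>v. \<chi> i. x (v, i))"
    unfolding generic_on_def eq by (rule x)
  then show ?thesis by blast
qed

section \<open>Affine interpolation at generic points\<close>

text \<open>The index \<open>None\<close> stands for the constant term. With d + 1 points the matrix
  is square, and its kernel consists of the affine functions that vanish at all of them.\<close>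

definition affine_matrix :: "('n option \<Rightarrow> 'a) \<Rightarrow> ('a \<Rightarrow> real ^ 'n) \<Rightarrow> real ^ 'n option ^ 'n option" where
  "affine_matrix \<phi> p = (\<chi> i j. case j of None \<Rightarrow> 1 | Some k \<Rightarrow> p (\<phi> i) $ k)"

lemma sum_option_UNIV: "(\<Sum>j\<in>UNIV. f j) = f None + (\<Sum>k\<in>UNIV. f (Some k))"
  for f :: "'n::finite option \<Rightarrow> real"
  by (simp add: UNIV_option_conv sum.reindex)

lemma affine_matrix_vector:
  "(affine_matrix \<phi> p *v z) $ i = (\<chi> k. z $ Some k) \<bullet> p (\<phi> i) + z $ None"
  by (simp add: affine_matrix_def matrix_vector_mult_def sum_option_UNIV inner_vec_def mult.commute)

lemma det_affine_matrix_config_poly: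
  assumes "range \<phi> \<subseteq> V"
  shows "config_poly V (\<lambda>p :: 'a \<Rightarrow> real ^ 'n. det (affine_matrix \<phi> p))"
proof -
  have "config_poly V (\<lambda>p :: 'a \<Rightarrow> real ^ 'n. affine_matrix \<phi> p $ i $ j)" for i j
    using assms by (cases j) (auto simp: affine_matrix_def config_poly_1 intro: config_poly_coordinate)
  moreover have "config_poly V (\<lambda>p :: 'a \<Rightarrow> real ^ 'n. of_int k)" for k
    using config_poly_const[of V "of_int k"] by simp
  ultimately show ?thesis
    unfolding det_def by (intro config_poly_sum config_poly_mult config_poly_prod)
qed

lemma det_affine_matrix_generic:
  fixes p :: "'a \<Rightarrow> real ^ 'n"
  assumes gen: "generic_on V p" and "range \<phi> \<subseteq> V" and inj: "inj \<phi>"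
  shows "det (affine_matrix \<phi> p) \<noteq> 0"
proof
  assume "det (affine_matrix \<phi> p) = 0"
  \<comment> \<open>The determinant would then vanish identically, but it does not at the standard simplex.\<close>
  then have 0: "det (affine_matrix \<phi> q) = 0" for q :: "'a \<Rightarrow> real ^ 'n"
    using config_poly_eq_0[OF gen det_affine_matrix_config_poly] assms(2) by blast
  define q :: "'a \<Rightarrow> real ^ 'n" where
    "q v = (case inv \<phi> v of None \<Rightarrow> 0 | Some k \<Rightarrow> axis k 1)" for v
  have "z = 0" if z: "affine_matrix \<phi> q *v z = 0" for z
  proof -
    have row: "(\<chi> k. z $ Some k) \<bullet> q (\<phi> i) + z $ None = 0" for i
      using affine_matrix_vector[of \<phi> q z i] z by simp
    have none: "z $ None = 0"
      using row[of None] inj by (simp add: q_def)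
    have "z $ Some k = 0" for k
      using row[of "Some k"] none inj by (simp add: q_def inner_axis)
    with none show "z = 0"
      by (auto simp: vec_eq_iff split: option.split) (metis option.exhaust)
  qed
  then have "invertible (affine_matrix \<phi> q)"
    by (simp add: invertible_left_inverse matrix_left_invertible_ker)
  with 0 show False by (simp add: invertible_det_nz)
qed

text \<open>Padding \<open>U\<close> to exactly d + 1 vertices makes the system square and
  invertible. The velocities of all flexes below are built from affine functions obtained in this
  way.\<close>

lemma generic_interpolation:
  fixes p :: "'a \<Rightarrow> real ^ 'n"
  assumes gen: "generic_on V p" and V: "finite V" "CARD('n) + 1 \<le> card V"
    and U: "U \<subseteq> V" "card U \<le> CARD('n) + 1"
  shows "\<exists>g c. \<forall>u\<in>U. g \<bullet> p u + c = r u"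
proof -
  obtain W where W: "U \<subseteq> W" "W \<subseteq> V" "card W = CARD('n) + 1"
    using exists_subset_between[OF U(2) V(2) U(1) V(1)] by blast
  have "card (UNIV :: 'n option set) = card W"
    using W(3) by simp
  then obtain \<phi> :: "'n option \<Rightarrow> 'a" where \<phi>: "bij_betw \<phi> UNIV W"
    using finite_same_card_bij[of "UNIV :: 'n option set" W] finite_subset[OF W(2) V(1)] by auto
  have "invertible (affine_matrix \<phi> p)"
    using det_affine_matrix_generic[OF gen, of \<phi>] \<phi> W(2)
    by (auto simp: invertible_det_nz bij_betw_def)
  then obtain B where B: "affine_matrix \<phi> p ** B = mat 1"
    by (auto simp: invertible_right_inverse)
  define z where "z = B *v (\<chi> i. r (\<phi> i))"
  have "affine_matrix \<phi> p *v z = (\<chi> i. r (\<phi> i))"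
    by (simp add: z_def matrix_vector_mul_assoc B)
  then have "(\<chi> k. z $ Some k) \<bullet> p (\<phi> i) + z $ None = r (\<phi> i)" for i
    using affine_matrix_vector[of \<phi> p z i] by simp
  then have "\<forall>u\<in>U. (\<chi> k. z $ Some k) \<bullet> p u + z $ None = r u"
    using \<phi> W(1) by (auto simp: bij_betw_def)
  then show ?thesis by blast
qed

lemma generic_affine_eq_0:
  fixes p :: "'a \<Rightarrow> real ^ 'n"
  assumes gen: "generic_on V p" and U: "finite U" "U \<subseteq> V" "CARD('n) + 1 \<le> card U"
    and 0: "\<forall>u\<in>U. g \<bullet> p u + c = 0"
  shows "g = 0 \<and> c = 0"
proof -
  obtain W where W: "W \<subseteq> U" "card W = CARD('n) + 1"
    using obtain_subset_with_card_n[OF U(3)] by metis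
  have "card (UNIV :: 'n option set) = card W"
    using W(2) by simp
  then obtain \<phi> :: "'n option \<Rightarrow> 'a" where \<phi>: "bij_betw \<phi> UNIV W"
    using finite_same_card_bij[of "UNIV :: 'n option set" W] finite_subset[OF W(1) U(1)] by auto
  define z :: "real ^ 'n option" where "z = (\<chi> j. case j of None \<Rightarrow> c | Some k \<Rightarrow> g $ k)"
  have zg: "(\<chi> k. z $ Some k) = g" "z $ None = c"
    by (simp_all add: z_def vec_eq_iff)
  have "\<phi> i \<in> U" for i
    using \<phi> W(1) by (auto simp: bij_betw_def)
  then have "affine_matrix \<phi> p *v z = 0"
    using 0 by (simp add: vec_eq_iff affine_matrix_vector zg)
  moreover have "invertible (affine_matrix \<phi> p)"
    using det_affine_matrix_generic[OF gen, of \<phi>] \<phi> W(1) U(2)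
    by (auto simp: invertible_det_nz bij_betw_def)
  ultimately have "z = 0"
    by (simp add: invertible_left_inverse matrix_left_invertible_ker)
  with zg show ?thesis by (auto simp: vec_eq_iff)
qed

section \<open>Infinitesimal flexes of generic frameworks integrate\<close>

text \<open>The row of the rigidity matrix at \<open>x\<close> belonging to the edge
  \<open>e\<close>, applied to the velocities \<open>y\<close>. Written as a symmetric bilinear
  form, it can also be expanded in the point \<open>x\<close>.\<close>

definition edge_form :: "'a \<times> 'a \<Rightarrow> ('a \<Rightarrow> real ^ 'n) \<Rightarrow> ('a \<Rightarrow> real ^ 'n) \<Rightarrow> real" where
  "edge_form e x y = (x (fst e) - x (snd e)) \<bullet> (y (fst e) - y (snd e))"

lemma edge_form_commute: "edge_form e x y = edge_form e y x"
  by (simp add: edge_form_def inner_commute)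

lemma edge_form_right:
  "edge_form e x (\<lambda>z. y z + y' z) = edge_form e x y + edge_form e x y'"
  "edge_form e x (\<lambda>z. c *\<^sub>R y z) = c * edge_form e x y"
  by (simp_all add: edge_form_def inner_simps algebra_simps)

lemma edge_form_left:
  "edge_form e (\<lambda>z. y z + y' z) x = edge_form e y x + edge_form e y' x"
  "edge_form e (\<lambda>z. c *\<^sub>R y z) x = c * edge_form e y x"
  by (simp_all add: edge_form_def inner_simps algebra_simps)

lemma edge_form_sum_right: "edge_form e x (\<lambda>z. \<Sum>i\<in>A. y i z) = (\<Sum>i\<in>A. edge_form e x (y i))"
  by (simp add: edge_form_def inner_sum_right sum_subtractf[symmetric])

lemma edge_form_sum_left: "edge_form e (\<lambda>z. \<Sum>i\<in>A. y i z) x = (\<Sum>i\<in>A. edge_form e (y i) x)"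
  by (simp add: edge_form_def inner_sum_left sum_subtractf[symmetric])

text \<open>\<open>I\<close> is a basis of the row space and \<open>L\<close> a dual family of
  velocities, so the coefficients in the expansion of a row are its values on \<open>L\<close>.
  Growing both together keeps the linear algebra inside finite sums over edges.\<close>

lemma dual_family:
  fixes p :: "'a \<Rightarrow> real ^ 'n"
  assumes "finite E"
  shows "\<exists>I\<subseteq>E. \<exists>L. (\<forall>i\<in>I. \<forall>j\<in>I. edge_form i p (L j) = (if i = j then 1 else 0)) \<and>
    (\<forall>e\<in>E. \<forall>w. edge_form e p w = (\<Sum>i\<in>I. edge_form e p (L i) * edge_form i p w))"
  using assms
proof (induction E rule: finite_induct)
  case (insert e E)
  from insert.IH obtain I L where I: "I \<subseteq> E"
    and dual: "\<forall>i\<in>I. \<forall>j\<in>I. edge_form i p (L j) = (if i = j then 1 else 0)"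
    and span: "\<forall>e\<in>E. \<forall>w. edge_form e p w = (\<Sum>i\<in>I. edge_form e p (L i) * edge_form i p w)"
    by (elim exE conjE)
  note dual = dual[rule_format] and span = span[rule_format]
  have fI: "finite I" and eI: "e \<notin> I" using I insert.hyps by (auto intro: finite_subset)
  show ?case
  proof (cases "\<forall>w. edge_form e p w = (\<Sum>i\<in>I. edge_form e p (L i) * edge_form i p w)")
    case True
    have sub: "I \<subseteq> insert e E" using I by blast
    have span': "edge_form f p w = (\<Sum>i\<in>I. edge_form f p (L i) * edge_form i p w)"
      if "f \<in> insert e E" for f w
    proof (cases "f = e")
      case eq: True
      show ?thesis unfolding eq by (rule True[rule_format])
    next
      case False
      then show ?thesis using that by (intro span) simp
    qed
    show ?thesis
    proof (intro exI[of _ I] conjI exI[of _ L] ballI allI)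
      show "I \<subseteq> insert e E" by (rule sub)
    next
      fix i j assume "i \<in> I" "j \<in> I"
      then show "edge_form i p (L j) = (if i = j then 1 else 0)" by (rule dual)
    next
      fix f w assume "f \<in> insert e E"
      then show "edge_form f p w = (\<Sum>i\<in>I. edge_form f p (L i) * edge_form i p w)" by (rule span')
    qed
  next
    case False
    then obtain w where w: "edge_form e p w \<noteq> (\<Sum>i\<in>I. edge_form e p (L i) * edge_form i p w)"
      by blast
    define \<delta> where "\<delta> = edge_form e p w - (\<Sum>i\<in>I. edge_form e p (L i) * edge_form i p w)"
    \<comment> \<open>Subtracting the part of \<open>w\<close> seen by the rows of \<open>I\<close>
      leaves velocities that all rows of \<open>E\<close> annihilate; division by
      \<open>\<delta>\<close> makes the new row take the value 1 on them.\<close>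
    define w1 where "w1 = (\<lambda>z. (1 / \<delta>) *\<^sub>R (w z + (\<Sum>i\<in>I. (- edge_form i p w) *\<^sub>R L i z)))"
    have \<delta>: "\<delta> \<noteq> 0" using w by (simp add: \<delta>_def)
    have fw1: "edge_form f p w1 =
        (edge_form f p w - (\<Sum>i\<in>I. edge_form f p (L i) * edge_form i p w)) / \<delta>" for f
      unfolding w1_def edge_form_right edge_form_sum_right
      by (simp add: sum_negf mult.commute)
    have Ew1: "edge_form f p w1 = 0" if "f \<in> E" for f
      using fw1[of f] span[OF that, of w] by simp
    have ew1: "edge_form e p w1 = 1"
      using fw1[of e] \<delta> by (simp add: \<delta>_def)
    define L' where "L' i = (if i = e then w1 else (\<lambda>z. L i z + (- edge_form e p (L i)) *\<^sub>R w1 z))" for i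
    have fL': "edge_form f p (L' i) = edge_form f p (L i)" if "f \<in> E" "i \<in> I" for f i
      using that eI Ew1[OF that(1)] by (auto simp: L'_def edge_form_right simp del: scaleR_minus_left)
    have eL': "edge_form e p (L' i) = 0" if "i \<in> I" for i
      using that eI ew1 by (auto simp: L'_def edge_form_right simp del: scaleR_minus_left)
    have L'e: "L' e = w1" by (simp add: L'_def)
    have dual': "edge_form i p (L' j) = (if i = j then 1 else 0)" if "i \<in> insert e I" "j \<in> insert e I" for i j
    proof -
      consider "i = e" "j = e" | "i = e" "j \<in> I" | "i \<in> I" "j = e" | "i \<in> I" "j \<in> I"
        using \<open>i \<in> insert e I\<close> \<open>j \<in> insert e I\<close> by blast
      then show ?thesis
      proof cases
        case 1
        then show ?thesis using ew1 L'e by simp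
      next
        case 2
        then show ?thesis using eL' eI by auto
      next
        case 3
        then have "i \<in> E" "i \<noteq> j" using I eI by auto
        then show ?thesis using Ew1[of i] L'e 3 by simp
      next
        case 4
        then have "i \<in> E" using I by auto
        then show ?thesis using fL'[of i j] dual 4 by simp
      qed
    qed
    have span': "edge_form f p v = (\<Sum>i\<in>insert e I. edge_form f p (L' i) * edge_form i p v)"
      if "f \<in> insert e E" for f v
    proof (cases "f = e")
      case True
      then show ?thesis using fI eI ew1 eL' L'e by simp
    next
      case False
      then have "f \<in> E" using that by simp
      then show ?thesis
        using span[of f v] fI eI Ew1 fL' L'e by simp
    qed
    have sub: "insert e I \<subseteq> insert e E" using I by blast
    show ?thesis
    proof (intro exI[of _ "insert e I"] conjI exI[of _ L'] ballI allI)
      show "insert e I \<subseteq> insert e E" by (rule sub)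
    next
      fix i j assume "i \<in> insert e I" "j \<in> insert e I"
      then show "edge_form i p (L' j) = (if i = j then 1 else 0)" by (rule dual')
    next
      fix f w assume "f \<in> insert e E"
      then show "edge_form f p w = (\<Sum>i\<in>insert e I. edge_form f p (L' i) * edge_form i p w)"
        by (rule span')
    qed
  qed
qed simp

section \<open>Small quadratic systems solved by contraction\<close>

lemma weighted_sum_bound:
  fixes b \<gamma> :: "'i \<Rightarrow> real"
  assumes "\<And>j. j \<in> J \<Longrightarrow> \<bar>\<gamma> j\<bar> \<le> D"
  shows "\<bar>\<Sum>j\<in>J. b j * \<gamma> j\<bar> \<le> (\<Sum>j\<in>J. \<bar>b j\<bar>) * D"
proof -
  have "\<bar>\<Sum>j\<in>J. b j * \<gamma> j\<bar> \<le> (\<Sum>j\<in>J. \<bar>b j * \<gamma> j\<bar>)" by (rule sum_abs)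
  also have "\<dots> \<le> (\<Sum>j\<in>J. \<bar>b j\<bar> * D)"
    using assms by (intro sum_mono) (simp add: abs_mult mult_left_mono)
  finally show ?thesis by (simp add: sum_distrib_right)
qed

text \<open>Banach's fixed point theorem in coordinates. On the box of radius \<open>M\<close> the
  right-hand side stays within 1 of \<open>a\<close> and contracts by 1/2 once \<epsilon> is small.
  What matters later is that \<open>M\<close> does not depend on \<epsilon>, so that \<epsilon>
  times \<gamma> vanishes in the limit.\<close>

lemma quadratic_fixpoint:
  fixes a :: "'i \<Rightarrow> real" and b :: "'i \<Rightarrow> 'i \<Rightarrow> real" and c :: "'i \<Rightarrow> 'i \<times> 'i \<Rightarrow> real"
  assumes I: "finite I"
  shows "\<exists>M>0. \<exists>\<epsilon>0>0. \<forall>\<epsilon>. 0 < \<epsilon> \<longrightarrow> \<epsilon> < \<epsilon>0 \<longrightarrow> (\<exists>\<gamma>. (\<forall>i\<in>I. \<bar>\<gamma> i\<bar> \<le> M) \<and>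
    (\<forall>i\<in>I. \<gamma> i = a i + \<epsilon> * (\<Sum>j\<in>I. b i j * \<gamma> j) +
       \<epsilon>\<^sup>2 * (\<Sum>q\<in>I \<times> I. c i q * (\<gamma> (fst q) * \<gamma> (snd q)))))"
proof -
  define A where "A = (\<Sum>i\<in>I. \<bar>a i\<bar>)"
  define B where "B = (\<Sum>i\<in>I. \<Sum>j\<in>I. \<bar>b i j\<bar>)"
  define C where "C = (\<Sum>i\<in>I. \<Sum>q\<in>I \<times> I. \<bar>c i q\<bar>)"
  define M where "M = A + 1"
  \<comment> \<open>Up to a factor \<epsilon>, \<open>B * M + C * M\<^sup>2\<close> bounds the
    distance to \<open>a\<close> and \<open>B + 2 * C * M\<close> the Lipschitz constant; the
    summand 1 forces \<epsilon> \<le> 1, so that its square is at most \<epsilon>.\<close>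
  define K where "K = B * M + C * M\<^sup>2 + B + 2 * C * M + 1"
  have pos: "A \<ge> 0" "B \<ge> 0" "C \<ge> 0" by (auto simp: A_def B_def C_def intro!: sum_nonneg)
  then have M: "M > 0" by (simp add: M_def)
  have Kparts: "0 \<le> B * M" "0 \<le> C * M\<^sup>2" "0 \<le> C * M" using pos M by simp_all
  then have K: "K \<ge> 1" using pos by (simp add: K_def)
  have "\<exists>\<gamma>. (\<forall>i\<in>I. \<bar>\<gamma> i\<bar> \<le> M) \<and> (\<forall>i\<in>I. \<gamma> i = a i + \<epsilon> * (\<Sum>j\<in>I. b i j * \<gamma> j) +
       \<epsilon>\<^sup>2 * (\<Sum>q\<in>I \<times> I. c i q * (\<gamma> (fst q) * \<gamma> (snd q))))"
    if \<epsilon>: "0 < \<epsilon>" "\<epsilon> < 1 / (2 * K)" for \<epsilon>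
  proof -
    have "\<epsilon> * (2 * K) < 1" using \<epsilon> K by (simp add: field_simps)
    then have eK: "\<epsilon> * K < 1 / 2" by simp
    have "\<epsilon> * 1 \<le> \<epsilon> * K" using K \<epsilon> by (intro mult_left_mono) auto
    then have e1: "\<epsilon> \<le> 1" using eK by simp
    then have e2: "\<epsilon>\<^sup>2 \<le> \<epsilon>" using \<epsilon> by (simp add: power2_eq_square mult_left_le)
    define \<Phi> where "\<Phi> \<gamma> i = a i + \<epsilon> * (\<Sum>j\<in>I. b i j * \<gamma> j) +
       \<epsilon>\<^sup>2 * (\<Sum>q\<in>I \<times> I. c i q * (\<gamma> (fst q) * \<gamma> (snd q)))" for \<gamma> i
    have ai: "\<bar>a i\<bar> \<le> A" if "i \<in> I" for i
      using I that unfolding A_def by (intro member_le_sum) auto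
    have bi: "(\<Sum>j\<in>I. \<bar>b i j\<bar>) \<le> B" if "i \<in> I" for i
      using I that unfolding B_def
      by (intro member_le_sum[where f = "\<lambda>i. \<Sum>j\<in>I. \<bar>b i j\<bar>"]) (auto intro: sum_nonneg)
    have ci: "(\<Sum>q\<in>I \<times> I. \<bar>c i q\<bar>) \<le> C" if "i \<in> I" for i
      using I that unfolding C_def
      by (intro member_le_sum[where f = "\<lambda>i. \<Sum>q\<in>I \<times> I. \<bar>c i q\<bar>"]) (auto intro: sum_nonneg)
    have lin: "\<bar>\<epsilon> * (\<Sum>j\<in>I. b i j * \<gamma> j)\<bar> \<le> \<epsilon> * (B * D)"
      if i: "i \<in> I" and g: "\<And>j. j \<in> I \<Longrightarrow> \<bar>\<gamma> j\<bar> \<le> D" for i \<gamma> D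
    proof -
      have D: "D \<ge> 0" using g[OF i] abs_ge_zero order_trans by blast
      have "\<bar>\<Sum>j\<in>I. b i j * \<gamma> j\<bar> \<le> (\<Sum>j\<in>I. \<bar>b i j\<bar>) * D" by (rule weighted_sum_bound[OF g])
      also have "\<dots> \<le> B * D" using bi[OF i] D by (rule mult_right_mono)
      finally show ?thesis using \<epsilon> by (simp add: abs_mult mult_left_mono)
    qed
    have quad: "\<bar>\<epsilon>\<^sup>2 * (\<Sum>q\<in>I \<times> I. c i q * \<gamma> q)\<bar> \<le> \<epsilon> * (C * D)"
      if i: "i \<in> I" and g: "\<And>q. q \<in> I \<times> I \<Longrightarrow> \<bar>\<gamma> q\<bar> \<le> D" for i \<gamma> D
    proof -
      have D: "D \<ge> 0" using g[of "(i, i)"] i abs_ge_zero order_trans by blast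
      have "\<bar>\<Sum>q\<in>I \<times> I. c i q * \<gamma> q\<bar> \<le> (\<Sum>q\<in>I \<times> I. \<bar>c i q\<bar>) * D" by (rule weighted_sum_bound[OF g])
      also have "\<dots> \<le> C * D" using ci[OF i] D by (rule mult_right_mono)
      finally have "\<epsilon>\<^sup>2 * \<bar>\<Sum>q\<in>I \<times> I. c i q * \<gamma> q\<bar> \<le> \<epsilon> * (C * D)"
        using \<epsilon> e2 by (intro mult_mono) auto
      then show ?thesis by (simp add: abs_mult)
    qed
    have box: "\<bar>\<Phi> \<gamma> i\<bar> \<le> M" if i: "i \<in> I" and g: "\<And>j. j \<in> I \<Longrightarrow> \<bar>\<gamma> j\<bar> \<le> M" for \<gamma> i
    proof -
      have "\<bar>\<gamma> (fst q) * \<gamma> (snd q)\<bar> \<le> M\<^sup>2" if "q \<in> I \<times> I" for q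
        using that g M by (auto simp: abs_mult power2_eq_square intro!: mult_mono)
      then have "\<bar>\<epsilon>\<^sup>2 * (\<Sum>q\<in>I \<times> I. c i q * (\<gamma> (fst q) * \<gamma> (snd q)))\<bar> \<le> \<epsilon> * (C * M\<^sup>2)"
        by (rule quad[OF i])
      moreover have "\<bar>\<epsilon> * (\<Sum>j\<in>I. b i j * \<gamma> j)\<bar> \<le> \<epsilon> * (B * M)" by (rule lin[OF i g])
      ultimately have "\<bar>\<Phi> \<gamma> i\<bar> \<le> A + \<epsilon> * (B * M) + \<epsilon> * (C * M\<^sup>2)"
        using ai[OF i] unfolding \<Phi>_def by linarith
      also have "\<dots> = A + \<epsilon> * (B * M + C * M\<^sup>2)" by (simp add: algebra_simps)
      also have "\<epsilon> * (B * M + C * M\<^sup>2) \<le> \<epsilon> * K"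
        using Kparts pos \<epsilon> by (intro mult_left_mono) (auto simp: K_def)
      finally show ?thesis using eK by (simp add: M_def)
    qed
    have contr: "\<bar>\<Phi> \<gamma> i - \<Phi> \<gamma>' i\<bar> \<le> D / 2"
      if i: "i \<in> I" and g: "\<And>j. j \<in> I \<Longrightarrow> \<bar>\<gamma> j\<bar> \<le> M" "\<And>j. j \<in> I \<Longrightarrow> \<bar>\<gamma>' j\<bar> \<le> M"
        and d: "\<And>j. j \<in> I \<Longrightarrow> \<bar>\<gamma> j - \<gamma>' j\<bar> \<le> D" for \<gamma> \<gamma>' i D
    proof -
      have D: "D \<ge> 0" using d[OF i] abs_ge_zero order_trans by blast
      have "\<bar>\<gamma> (fst q) * \<gamma> (snd q) - \<gamma>' (fst q) * \<gamma>' (snd q)\<bar> \<le> 2 * M * D" if q: "q \<in> I \<times> I" for q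
      proof -
        have q': "fst q \<in> I" "snd q \<in> I" using q by auto
        have eq: "\<gamma> (fst q) * \<gamma> (snd q) - \<gamma>' (fst q) * \<gamma>' (snd q) =
            (\<gamma> (fst q) - \<gamma>' (fst q)) * \<gamma> (snd q) + \<gamma>' (fst q) * (\<gamma> (snd q) - \<gamma>' (snd q))"
          by (simp add: algebra_simps)
        have "\<bar>(\<gamma> (fst q) - \<gamma>' (fst q)) * \<gamma> (snd q)\<bar> \<le> D * M"
          unfolding abs_mult using d[OF q'(1)] g(1)[OF q'(2)] D by (intro mult_mono) auto
        moreover have "\<bar>\<gamma>' (fst q) * (\<gamma> (snd q) - \<gamma>' (snd q))\<bar> \<le> M * D"
          unfolding abs_mult using d[OF q'(2)] g(2)[OF q'(1)] M by (intro mult_mono) auto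
        ultimately show ?thesis unfolding eq by (simp add: algebra_simps)
      qed
      then have 1: "\<bar>\<epsilon>\<^sup>2 * (\<Sum>q\<in>I \<times> I. c i q * (\<gamma> (fst q) * \<gamma> (snd q) - \<gamma>' (fst q) * \<gamma>' (snd q)))\<bar>
          \<le> \<epsilon> * (C * (2 * M * D))" by (rule quad[OF i])
      have 2: "\<bar>\<epsilon> * (\<Sum>j\<in>I. b i j * (\<gamma> j - \<gamma>' j))\<bar> \<le> \<epsilon> * (B * D)" by (rule lin[OF i d])
      have "\<Phi> \<gamma> i - \<Phi> \<gamma>' i = \<epsilon> * (\<Sum>j\<in>I. b i j * (\<gamma> j - \<gamma>' j)) +
          \<epsilon>\<^sup>2 * (\<Sum>q\<in>I \<times> I. c i q * (\<gamma> (fst q) * \<gamma> (snd q) - \<gamma>' (fst q) * \<gamma>' (snd q)))"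
        by (simp add: \<Phi>_def right_diff_distrib sum_subtractf)
      then have "\<bar>\<Phi> \<gamma> i - \<Phi> \<gamma>' i\<bar> \<le> \<epsilon> * (B * D) + \<epsilon> * (C * (2 * M * D))"
        using 1 2 by linarith
      also have "\<dots> = \<epsilon> * (B + 2 * C * M) * D" by (simp add: algebra_simps)
      also have "\<dots> \<le> \<epsilon> * K * D"
        using Kparts pos \<epsilon> D by (intro mult_right_mono mult_left_mono) (auto simp: K_def)
      also have "\<dots> \<le> 1 / 2 * D" using eK D by (intro mult_right_mono) auto
      finally show ?thesis by simp
    qed
    define s where "s n = (\<Phi> ^^ n) (\<lambda>_. 0)" for n
    have s_Suc: "s (Suc n) i = \<Phi> (s n) i" for n i by (simp add: s_def)
    have sM: "\<bar>s n i\<bar> \<le> M" if "i \<in> I" for n i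
      using that
    proof (induction n arbitrary: i)
      case 0
      then show ?case using M by (simp add: s_def)
    next
      case (Suc n)
      then show ?case using box by (simp add: s_Suc)
    qed
    have sd: "\<bar>s (Suc n) i - s n i\<bar> \<le> M * (1 / 2) ^ n" if "i \<in> I" for n i
      using that
    proof (induction n arbitrary: i)
      case 0
      then show ?case using sM[of i 1] by (simp add: s_def)
    next
      case (Suc n)
      have "\<bar>\<Phi> (s (Suc n)) i - \<Phi> (s n) i\<bar> \<le> M * (1 / 2) ^ n / 2"
        by (rule contr[OF Suc.prems sM sM Suc.IH])
      then show ?case by (simp add: s_Suc)
    qed
    have "convergent (\<lambda>n. s n i)" if i: "i \<in> I" for i
    proof -
      have "summable (\<lambda>n. s (Suc n) i - s n i)"
      proof (rule summable_comparison_test')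
        show "summable (\<lambda>n. M * (1 / 2 :: real) ^ n)" by (intro summable_mult summable_geometric) simp
        show "norm (s (Suc n) i - s n i) \<le> M * (1 / 2) ^ n" if "n \<ge> 0" for n
          using sd[OF i] by simp
      qed
      then have "convergent (\<lambda>n. \<Sum>k<n. s (Suc k) i - s k i)"
        by (simp add: summable_iff_convergent)
      moreover have "(\<Sum>k<n. s (Suc k) i - s k i) = s n i" for n
        by (subst sum_lessThan_telescope) (simp add: s_def)
      ultimately show ?thesis by simp
    qed
    then have g: "(\<lambda>n. s n i) \<longlonglongrightarrow> lim (\<lambda>n. s n i)" if "i \<in> I" for i
      using that by (simp add: convergent_LIMSEQ_iff)
    define g where "g i = lim (\<lambda>n. s n i)" for i
    note g = g[folded g_def]
    have "\<bar>g i\<bar> \<le> M" if "i \<in> I" for i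
      using tendsto_rabs[OF g[OF that]] sM[OF that] by (intro LIMSEQ_le_const2) auto
    moreover have "g i = \<Phi> g i" if i: "i \<in> I" for i
    proof -
      have "(\<lambda>n. \<Phi> (s n) i) \<longlonglongrightarrow> \<Phi> g i"
        unfolding \<Phi>_def using g by (intro tendsto_intros) auto
      moreover have "(\<lambda>n. s (Suc n) i) \<longlonglongrightarrow> g i" using g[OF i] by (rule LIMSEQ_Suc)
      ultimately show ?thesis unfolding s_Suc using LIMSEQ_unique by blast
    qed
    ultimately show ?thesis unfolding \<Phi>_def by (intro exI[of _ g] conjI ballI)
  qed
  then show ?thesis
    using M K by (intro exI[of _ M] conjI exI[of _ "1 / (2 * K)"]) auto
qed

text \<open>Cramer's rule by fraction-free elimination: the real coefficients \<open>a\<close> are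
  replaced by elements of the ring \<open>R\<close>, at the price of a nonzero factor
  \<open>D\<close>. The rows may be dependent. \<open>R\<close> will be the ring of values at
  \<open>p\<close> of rational polynomials.\<close>

lemma fraction_free_solution:
  fixes R :: "real set" and r :: "'i \<Rightarrow> 'j \<Rightarrow> real"
  assumes R: "0 \<in> R" "1 \<in> R" "\<And>x y. x \<in> R \<Longrightarrow> y \<in> R \<Longrightarrow> x - y \<in> R"
      "\<And>x y. x \<in> R \<Longrightarrow> y \<in> R \<Longrightarrow> x * y \<in> R"
    and "finite I" "\<And>i j. i \<in> I \<Longrightarrow> j \<in> J \<Longrightarrow> r i j \<in> R" "\<And>j. j \<in> J \<Longrightarrow> s j \<in> R"
    and "\<And>j. j \<in> J \<Longrightarrow> s j = (\<Sum>i\<in>I. a i * r i j)"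
  shows "\<exists>D D'. D \<in> R \<and> D \<noteq> 0 \<and> (\<forall>i\<in>I. D' i \<in> R) \<and> (\<forall>j\<in>J. D * s j = (\<Sum>i\<in>I. D' i * r i j))"
  using assms(5-)
proof (induction I arbitrary: r s rule: finite_induct)
  case empty
  then show ?case using R(2) by (intro exI[of _ 1]) auto
next
  case (insert i0 I)
  have neg: "- x \<in> R" if "x \<in> R" for x using R(3)[OF R(1) that] by simp
  have add: "x + y \<in> R" if "x \<in> R" "y \<in> R" for x y using R(3)[OF that(1) neg[OF that(2)]] by simp
  have sums: "(\<Sum>i\<in>A. f i) \<in> R" if "\<And>i. i \<in> A \<Longrightarrow> f i \<in> R" for f :: "'i \<Rightarrow> real" and A
    using that by (induction A rule: infinite_finite_induct) (auto intro: R(1) add)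
  have sI: "s j = a i0 * r i0 j + (\<Sum>i\<in>I. a i * r i j)" if "j \<in> J" for j
    using insert.prems(3)[OF that] insert.hyps by simp
  show ?case
  proof (cases "\<forall>j\<in>J. r i0 j = 0")
    case True
    have "s j = (\<Sum>i\<in>I. a i * r i j)" if "j \<in> J" for j using sI[OF that] True that by simp
    then have "\<exists>D D'. D \<in> R \<and> D \<noteq> 0 \<and> (\<forall>i\<in>I. D' i \<in> R) \<and> (\<forall>j\<in>J. D * s j = (\<Sum>i\<in>I. D' i * r i j))"
      using insert.prems(1,2) by (intro insert.IH) blast+
    then obtain D D' where D: "D \<in> R" "D \<noteq> 0"
      "\<forall>i\<in>I. D' i \<in> R" "\<forall>j\<in>J. D * s j = (\<Sum>i\<in>I. D' i * r i j)" by (elim exE conjE)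
    have "(\<Sum>i\<in>I. (D'(i0 := 0)) i * r i j) = (\<Sum>i\<in>I. D' i * r i j)" for j
      using insert.hyps(2) by (intro sum.cong) auto
    with D have "\<forall>j\<in>J. D * s j = (\<Sum>i\<in>insert i0 I. (D'(i0 := 0)) i * r i j)"
      using insert.hyps True by simp
    moreover have "\<forall>i\<in>insert i0 I. (D'(i0 := 0)) i \<in> R" using D(3) R(1) by simp
    ultimately show ?thesis using D(1,2) by blast
  next
    case False
    then obtain j0 where j0: "j0 \<in> J" "r i0 j0 \<noteq> 0" by blast
    define \<pi> where "\<pi> = r i0 j0"
    \<comment> \<open>Cross-multiplication with the pivot makes row \<open>i0\<close> and column
      \<open>j0\<close> vanish without any division.\<close>
    define r' where "r' i j = \<pi> * r i j - r i j0 * r i0 j" for i j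
    define s' where "s' j = \<pi> * s j - s j0 * r i0 j" for j
    have \<pi>: "\<pi> \<noteq> 0" "\<pi> \<in> R" using j0 insert.prems(1) by (auto simp: \<pi>_def)
    have "\<exists>D D'. D \<in> R \<and> D \<noteq> 0 \<and> (\<forall>i\<in>I. D' i \<in> R) \<and> (\<forall>j\<in>J. D * s' j = (\<Sum>i\<in>I. D' i * r' i j))"
    proof (rule insert.IH)
      show "r' i j \<in> R" if "i \<in> I" "j \<in> J" for i j
        using that insert.prems(1) j0(1) \<pi>(2) unfolding r'_def by (intro R) auto
      show "s' j \<in> R" if "j \<in> J" for j
        using that insert.prems(1,2) j0(1) \<pi>(2) unfolding s'_def by (intro R) auto
      show "s' j = (\<Sum>i\<in>I. a i * r' i j)" if "j \<in> J" for j
      proof -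
        have "(\<Sum>i\<in>I. a i * r' i j) = \<pi> * (\<Sum>i\<in>I. a i * r i j) - (\<Sum>i\<in>I. a i * r i j0) * r i0 j"
          by (simp add: r'_def right_diff_distrib sum_subtractf sum_distrib_left sum_distrib_right mult.left_commute mult.assoc)
        then show ?thesis
          unfolding s'_def sI[OF that] sI[OF j0(1)] by (simp add: \<pi>_def algebra_simps)
      qed
    qed
    then obtain D D' where D: "D \<in> R" "D \<noteq> 0" "\<forall>i\<in>I. D' i \<in> R"
      and eq: "\<forall>j\<in>J. D * s' j = (\<Sum>i\<in>I. D' i * r' i j)" by (elim exE conjE)
    \<comment> \<open>Expanding the equation for \<open>s'\<close> and \<open>r'\<close> shows that
      this is the coefficient left over for row \<open>i0\<close>.\<close>
    define D0 where "D0 = D * s j0 - (\<Sum>i\<in>I. D' i * r i j0)"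
    define D'' where "D'' i = (if i = i0 then D0 else D' i * \<pi>)" for i
    have D0: "D0 \<in> R"
      unfolding D0_def using D j0(1) insert.prems by (intro R sums) auto
    have "D * \<pi> * s j = (\<Sum>i\<in>insert i0 I. D'' i * r i j)" if j: "j \<in> J" for j
    proof -
      have "(\<Sum>i\<in>I. D' i * r' i j) = (\<Sum>i\<in>I. D' i * \<pi> * r i j) - (\<Sum>i\<in>I. D' i * r i j0) * r i0 j"
        by (simp add: r'_def right_diff_distrib sum_subtractf sum_distrib_right mult.assoc)
      then have "D * \<pi> * s j = D0 * r i0 j + (\<Sum>i\<in>I. D' i * \<pi> * r i j)"
        using eq j by (simp add: s'_def D0_def algebra_simps)
      also have "(\<Sum>i\<in>I. D' i * \<pi> * r i j) = (\<Sum>i\<in>I. D'' i * r i j)"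
        using insert.hyps(2) by (intro sum.cong) (auto simp: D''_def)
      finally show ?thesis using insert.hyps by (simp add: D''_def)
    qed
    moreover have "\<forall>i\<in>insert i0 I. D'' i \<in> R" using D0 D(3) R(4)[OF _ \<pi>(2)] by (simp add: D''_def)
    moreover have "D * \<pi> \<in> R" "D * \<pi> \<noteq> 0" using D(2) \<pi> R(4)[OF D(1) \<pi>(2)] by simp_all
    ultimately show ?thesis by blast
  qed
qed

section \<open>Dependences of rigidity rows as polynomial identities\<close>

abbreviation unit_config :: "'a \<Rightarrow> 'n \<Rightarrow> 'a \<Rightarrow> real ^ 'n" where
  "unit_config v k \<equiv> (\<lambda>x. if x = v then axis k 1 else 0)"

lemma edge_form_unit_config:
  "edge_form e m (unit_config v k) =
    (if fst e = v then (m (fst e) - m (snd e)) $ k else 0) -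
    (if snd e = v then (m (fst e) - m (snd e)) $ k else 0)"
  by (simp add: edge_form_def inner_diff_right inner_axis)

lemma edge_form_expand:
  fixes w :: "'a \<Rightarrow> real ^ 'n"
  assumes "finite V" "e \<in> V \<times> V"
  shows "edge_form e m w = (\<Sum>v\<in>V. \<Sum>k\<in>UNIV. w v $ k * edge_form e m (unit_config v k))"
proof -
  let ?M = "m (fst e) - m (snd e)"
  have "(\<Sum>v\<in>V. \<Sum>k\<in>UNIV. w v $ k * edge_form e m (unit_config v k)) =
      (\<Sum>v\<in>V. (if fst e = v then w v \<bullet> ?M else 0) - (if snd e = v then w v \<bullet> ?M else 0))"
    unfolding edge_form_unit_config
    by (intro sum.cong refl) (simp add: inner_vec_def right_diff_distrib sum_subtractf)
  also have "\<dots> = w (fst e) \<bullet> ?M - w (snd e) \<bullet> ?M"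
    using assms by (auto simp: sum_subtractf)
  also have "\<dots> = edge_form e m w"
    by (simp add: edge_form_def inner_diff_right inner_commute)
  finally show ?thesis by (rule sym)
qed

lemma edge_form_unit_config_poly:
  assumes "e \<in> V \<times> V"
  shows "config_poly V (\<lambda>m. edge_form e m (unit_config v k))"
proof -
  have 1: "config_poly V (\<lambda>m. (m (fst e) - m (snd e)) $ k)"
    using assms by (auto intro!: config_poly_diff config_poly_coordinate)
  have "config_poly V (\<lambda>m. if P then (m (fst e) - m (snd e)) $ k else 0)" for P
    using 1 config_poly_0 by (cases P) simp_all
  then show ?thesis
    unfolding edge_form_unit_config by (intro config_poly_diff)
qed

text \<open>A linear dependence between rows of the rigidity matrix at a generic point is the
  specialization of a polynomial one, so it persists at all nearby points.\<close>

lemma generic_dependence_persists: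
  fixes p :: "'a \<Rightarrow> real ^ 'n"
  assumes gen: "generic_on V p" and V: "finite V" and I: "finite I" "I \<subseteq> V \<times> V" and e: "e \<in> V \<times> V"
    and dep: "\<And>w. edge_form e p w = (\<Sum>i\<in>I. a i * edge_form i p w)"
  shows "\<exists>D D'. config_poly V D \<and> D p \<noteq> 0 \<and>
    (\<forall>m w. D m * edge_form e m w = (\<Sum>i\<in>I. D' i m * edge_form i m w))"
proof -
  \<comment> \<open>The subring of the reals generated over the rationals by the coordinates of the
    points \<open>p v\<close> with \<open>v\<close> in \<open>V\<close>. Coefficients found in it
    lift to polynomials, which can be evaluated at every configuration.\<close>
  define R where "R = {F p |F. config_poly V F}"
  have RI: "F p \<in> R" if "config_poly V F" for F using that unfolding R_def by blast
  have RE: "\<exists>F. config_poly V F \<and> x = F p" if "x \<in> R" for x using that unfolding R_def by blast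
  define u where "u j = unit_config (fst j) (snd j)" for j :: "'a \<times> 'n"
  have mem: "edge_form f p (u j) \<in> R" if "f \<in> V \<times> V" for f j
    unfolding u_def by (rule RI[OF edge_form_unit_config_poly[OF that]])
  have "\<exists>D D'. D \<in> R \<and> D \<noteq> 0 \<and> (\<forall>i\<in>I. D' i \<in> R) \<and>
      (\<forall>j\<in>UNIV. D * edge_form e p (u j) = (\<Sum>i\<in>I. D' i * edge_form i p (u j)))"
  proof (rule fraction_free_solution)
    show "0 \<in> R" "1 \<in> R" using RI[OF config_poly_0] RI[OF config_poly_1] .
    show "x - y \<in> R" "x * y \<in> R" if xy: "x \<in> R" "y \<in> R" for x y
    proof -
      obtain F H where F: "config_poly V F" "x = F p" and H: "config_poly V H" "y = H p"
        using RE[OF xy(1)] RE[OF xy(2)] by (elim exE conjE)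
      show "x - y \<in> R" "x * y \<in> R"
        using RI[OF config_poly_diff[OF F(1) H(1)]] RI[OF config_poly_mult[OF F(1) H(1)]]
        unfolding F(2) H(2) .
    qed
    show "edge_form e p (u j) \<in> R" for j using e by (rule mem)
    show "edge_form i p (u j) \<in> R" if "i \<in> I" for i j using I(2) that by (intro mem) blast
    show "edge_form e p (u j) = (\<Sum>i\<in>I. a i * edge_form i p (u j))" for j by (rule dep)
  qed (rule I(1))
  then obtain d d' where d: "d \<in> R" "d \<noteq> 0" "\<forall>i\<in>I. d' i \<in> R"
    and eq: "\<forall>j\<in>UNIV. d * edge_form e p (u j) = (\<Sum>i\<in>I. d' i * edge_form i p (u j))"
    by (elim exE conjE)
  obtain D where D: "config_poly V D" "d = D p" using RE[OF d(1)] by (elim exE conjE)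
  have "\<forall>i\<in>I. \<exists>F. config_poly V F \<and> d' i = F p" using d(3) by (intro ballI RE) (rule bspec)
  then obtain D' where D': "\<forall>i\<in>I. config_poly V (D' i) \<and> d' i = D' i p" by (rule bchoice[THEN exE])
  \<comment> \<open>Tested on a unit velocity, the dependence is a polynomial relation that holds at
    the generic \<open>p\<close>, hence everywhere; linearity in \<open>w\<close> extends it to all
    velocities.\<close>
  have unit: "D m * edge_form e m (u j) = (\<Sum>i\<in>I. D' i m * edge_form i m (u j))" for m j
  proof -
    let ?F = "\<lambda>m. D m * edge_form e m (u j) - (\<Sum>i\<in>I. D' i m * edge_form i m (u j))"
    have "config_poly V ?F"
      using D(1) D' I(2) e unfolding u_def
      by (intro config_poly_diff config_poly_sum config_poly_mult edge_form_unit_config_poly) auto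
    moreover have "?F p = 0"
    proof -
      have "(\<Sum>i\<in>I. D' i p * edge_form i p (u j)) = (\<Sum>i\<in>I. d' i * edge_form i p (u j))"
        using D' by (intro sum.cong) auto
      then show ?thesis using eq[rule_format, OF UNIV_I, of j] D(2) by simp
    qed
    ultimately have "?F m = 0" by (rule config_poly_eq_0[OF gen])
    then show ?thesis by simp
  qed
  have "D m * edge_form e m w = (\<Sum>i\<in>I. D' i m * edge_form i m w)" for m w
  proof -
    have "D m * edge_form e m w = (\<Sum>v\<in>V. \<Sum>k\<in>UNIV. w v $ k * (D m * edge_form e m (u (v, k))))"
      unfolding edge_form_expand[OF V e, of m w] u_def fst_conv snd_conv
      by (simp add: sum_distrib_left mult.left_commute)
    also have "\<dots> = (\<Sum>v\<in>V. \<Sum>k\<in>UNIV. \<Sum>i\<in>I. D' i m * (w v $ k * edge_form i m (u (v, k))))"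
      unfolding unit by (simp add: sum_distrib_left mult.left_commute)
    also have "\<dots> = (\<Sum>v\<in>V. \<Sum>i\<in>I. \<Sum>k\<in>UNIV. D' i m * (w v $ k * edge_form i m (u (v, k))))"
      by (intro sum.cong refl sum.swap)
    also have "\<dots> = (\<Sum>i\<in>I. \<Sum>v\<in>V. \<Sum>k\<in>UNIV. D' i m * (w v $ k * edge_form i m (u (v, k))))"
      by (rule sum.swap)
    also have "\<dots> = (\<Sum>i\<in>I. D' i m * edge_form i m w)"
    proof (rule sum.cong[OF refl])
      fix i assume "i \<in> I"
      then have "i \<in> V \<times> V" using I(2) by blast
      show "(\<Sum>v\<in>V. \<Sum>k\<in>UNIV. D' i m * (w v $ k * edge_form i m (u (v, k)))) = D' i m * edge_form i m w"
        unfolding edge_form_expand[OF V \<open>i \<in> V \<times> V\<close>, of m w] u_def fst_conv snd_conv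
        by (simp add: sum_distrib_left)
    qed
    finally show ?thesis .
  qed
  with D d(2) show ?thesis by (intro exI[of _ D] exI[of _ D']) simp
qed

section \<open>Integration of infinitesimal flexes\<close>

lemma edge_form_lincomb_right:
  "edge_form e x (\<lambda>z. \<Sum>i\<in>A. g i *\<^sub>R y i z) = (\<Sum>i\<in>A. g i * edge_form e x (y i))"
  using edge_form_sum_right[of e x "\<lambda>i z. g i *\<^sub>R y i z" A] by (simp add: edge_form_right)

lemma edge_form_lincomb_left:
  "edge_form e (\<lambda>z. \<Sum>i\<in>A. g i *\<^sub>R y i z) x = (\<Sum>i\<in>A. g i * edge_form e (y i) x)"
  using edge_form_sum_left[of e "\<lambda>i z. g i *\<^sub>R y i z" A x] by (simp add: edge_form_left)

lemma norm_diff_eq_iff_edge_form: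
  "norm ((p u + x u) - (p w + x w)) = norm (p u - p w) \<longleftrightarrow>
    edge_form (u, w) (\<lambda>z. p z + (1 / 2) *\<^sub>R x z) x = 0"
proof -
  have "(norm ((p u + x u) - (p w + x w)))\<^sup>2 - (norm (p u - p w))\<^sup>2 =
      2 * edge_form (u, w) (\<lambda>z. p z + (1 / 2) *\<^sub>R x z) x"
    by (simp add: edge_form_def power2_norm_eq_inner algebra_simps inner_commute)
  moreover have "norm ((p u + x u) - (p w + x w)) = norm (p u - p w) \<longleftrightarrow>
      (norm ((p u + x u) - (p w + x w)))\<^sup>2 = (norm (p u - p w))\<^sup>2"
    by (simp add: power2_eq_iff_nonneg)
  ultimately show ?thesis by auto
qed

text \<open>The new framework is \<open>p\<close> plus t times \<open>y\<close>, where
  \<open>y\<close> is \<open>v\<close> plus t times a combination of the \<open>L i\<close>. The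
  combination is chosen to keep the lengths of the basis edges; the other edges follow by the
  dependence at the midpoint \<open>m t\<close>. Since \<open>y\<close> tends to \<open>v\<close>,
  the pair \<open>(a, b)\<close> still changes its distance for small t.\<close>

theorem generic_flex_integrates:
  fixes p v :: "'a \<Rightarrow> real ^ 'n"
  assumes gen: "generic_on V p" and V: "finite V" and E: "E \<subseteq> V \<times> V"
    and flex: "\<And>e. e \<in> E \<Longrightarrow> edge_form e p v = 0"
    and nontriv: "edge_form (a, b) p v \<noteq> 0" and \<epsilon>: "\<epsilon> > 0"
  shows "\<exists>q. (\<forall>(u, w)\<in>E. norm (p u - p w) = norm (q u - q w)) \<and> (\<forall>z\<in>V. norm (p z - q z) < \<epsilon>) \<and>
    norm (p a - p b) \<noteq> norm (q a - q b)"
proof -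
  have fE: "finite E" using E V finite_subset by blast
  from dual_family[OF fE, of p] obtain I L where IE: "I \<subseteq> E"
    and dual: "\<forall>i\<in>I. \<forall>j\<in>I. edge_form i p (L j) = (if i = j then 1 else 0)"
    and span: "\<forall>e\<in>E. \<forall>w. edge_form e p w = (\<Sum>i\<in>I. edge_form e p (L i) * edge_form i p w)"
    by (elim exE conjE)
  have fI: "finite I" using IE fE finite_subset by blast
  have "\<forall>e\<in>E. \<exists>D. config_poly V D \<and> D p \<noteq> 0 \<and> (\<exists>D'.
    \<forall>m w. D m * edge_form e m w = (\<Sum>i\<in>I. D' i m * edge_form i m w))"
  proof
    fix e assume e: "e \<in> E"
    have "I \<subseteq> V \<times> V" "e \<in> V \<times> V" using IE E e by blast+
    from generic_dependence_persists[OF gen V fI this span[rule_format, OF e]]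
    show "\<exists>D. config_poly V D \<and> D p \<noteq> 0 \<and> (\<exists>D'.
        \<forall>m w. D m * edge_form e m w = (\<Sum>i\<in>I. D' i m * edge_form i m w))"
      by blast
  qed
  then obtain D where D: "\<forall>e\<in>E. config_poly V (D e) \<and> D e p \<noteq> 0 \<and> (\<exists>D'.
    \<forall>m w. D e m * edge_form e m w = (\<Sum>i\<in>I. D' i m * edge_form i m w))"
    by (rule bchoice[THEN exE])
  \<comment> \<open>For \<open>t > 0\<close> an edge \<open>i\<close> of the basis keeps its length
    if and only if \<open>\<gamma> i\<close> is minus one half of \<open>edge_form i y y\<close>.
    Expanding \<open>y\<close> in powers of \<open>t\<close> gives the constants \<open>al\<close>,
    \<open>be\<close> and \<open>ce\<close>.\<close>
  define al where "al i = - (edge_form i v v / 2)" for i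
  define be where "be i j = - edge_form i v (L j)" for i j
  define ce where "ce i q = - (edge_form i (L (fst q)) (L (snd q)) / 2)" for i q
  obtain M t0 where M: "M > 0" "t0 > 0" and fp: "\<forall>t. 0 < t \<longrightarrow> t < t0 \<longrightarrow> (\<exists>\<gamma>. (\<forall>i\<in>I. \<bar>\<gamma> i\<bar> \<le> M) \<and>
    (\<forall>i\<in>I. \<gamma> i = al i + t * (\<Sum>j\<in>I. be i j * \<gamma> j) +
       t\<^sup>2 * (\<Sum>q\<in>I \<times> I. ce i q * (\<gamma> (fst q) * \<gamma> (snd q)))))"
    using quadratic_fixpoint[OF fI, of al be ce] by (elim exE conjE)
  define Q where "Q t \<gamma> \<longleftrightarrow> (\<forall>i\<in>I. \<bar>\<gamma> i\<bar> \<le> M) \<and>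
    (\<forall>i\<in>I. \<gamma> i = al i + t * (\<Sum>j\<in>I. be i j * \<gamma> j) +
       t\<^sup>2 * (\<Sum>q\<in>I \<times> I. ce i q * (\<gamma> (fst q) * \<gamma> (snd q))))" for t \<gamma>
  define \<gamma> where "\<gamma> t = (SOME \<gamma>. Q t \<gamma>)" for t
  have Q\<gamma>: "Q t (\<gamma> t)" if "0 < t" "t < t0" for t
    unfolding \<gamma>_def by (rule someI_ex[OF fp[folded Q_def, rule_format, OF that]])
  have \<gamma>_le: "\<bar>\<gamma> t i\<bar> \<le> M" if "i \<in> I" "0 < t" "t < t0" for i t
    using Q\<gamma>[OF that(2,3)] that(1) unfolding Q_def by (elim conjE) (rule bspec)
  have \<gamma>_eq: "\<gamma> t i = al i + t * (\<Sum>j\<in>I. be i j * \<gamma> t j) +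
       t\<^sup>2 * (\<Sum>q\<in>I \<times> I. ce i q * (\<gamma> t (fst q) * \<gamma> t (snd q)))" if "i \<in> I" "0 < t" "t < t0" for i t
    using Q\<gamma>[OF that(2,3)] that(1) unfolding Q_def by (elim conjE) (rule bspec)
  define y where "y t = (\<lambda>z. v z + t *\<^sub>R (\<Sum>i\<in>I. \<gamma> t i *\<^sub>R L i z))" for t
  define m where "m t = (\<lambda>z. p z + (1 / 2) *\<^sub>R (t *\<^sub>R y t z))" for t
  have ev: "eventually (\<lambda>t. 0 < t \<and> t < t0) (at_right 0)"
    using M(2) by (auto simp: eventually_at_right)
  have form_y: "edge_form i (y t) (y t) = - 2 * \<gamma> t i" if i: "i \<in> I" and t: "0 < t" "t < t0" for i t
  proof -
    let ?l = "\<lambda>z. \<Sum>j\<in>I. \<gamma> t j *\<^sub>R L j z"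
    have S: "edge_form i ?l ?l =
        (\<Sum>q\<in>I \<times> I. edge_form i (L (fst q)) (L (snd q)) * (\<gamma> t (fst q) * \<gamma> t (snd q)))"
      unfolding edge_form_lincomb_left edge_form_lincomb_right sum_distrib_left sum.cartesian_product
      by (intro sum.cong refl) (simp add: case_prod_beta mult_ac)
    have T: "edge_form i v ?l = (\<Sum>j\<in>I. edge_form i v (L j) * \<gamma> t j)"
      unfolding edge_form_lincomb_right by (simp add: mult.commute)
    have "edge_form i (y t) (y t) = edge_form i v v + 2 * t * edge_form i v ?l + t\<^sup>2 * edge_form i ?l ?l"
      unfolding y_def edge_form_left edge_form_right edge_form_commute[of i ?l v]
      by (simp only: power2_eq_square distrib_left mult.assoc mult_2 distrib_right add.assoc)
    then have "edge_form i (y t) (y t) = edge_form i v v + 2 * t * (\<Sum>j\<in>I. edge_form i v (L j) * \<gamma> t j) +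
        t\<^sup>2 * (\<Sum>q\<in>I \<times> I. edge_form i (L (fst q)) (L (snd q)) * (\<gamma> t (fst q) * \<gamma> t (snd q)))"
      by (simp only: S T)
    moreover have "\<gamma> t i = al i + t * (\<Sum>j\<in>I. be i j * \<gamma> t j) +
       t\<^sup>2 * (\<Sum>q\<in>I \<times> I. ce i q * (\<gamma> t (fst q) * \<gamma> t (snd q)))"
      by (rule \<gamma>_eq[OF i t])
    moreover have "(\<Sum>j\<in>I. be i j * \<gamma> t j) = - (\<Sum>j\<in>I. edge_form i v (L j) * \<gamma> t j)"
      by (simp add: be_def sum_negf)
    moreover have "(\<Sum>q\<in>I \<times> I. ce i q * (\<gamma> t (fst q) * \<gamma> t (snd q))) =
        - (\<Sum>q\<in>I \<times> I. edge_form i (L (fst q)) (L (snd q)) * (\<gamma> t (fst q) * \<gamma> t (snd q))) / 2"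
      unfolding ce_def by (simp add: sum_negf sum_divide_distrib)
    ultimately show ?thesis by (simp add: al_def algebra_simps)
  qed
  have form_I: "edge_form i (m t) (\<lambda>z. t *\<^sub>R y t z) = 0" if i: "i \<in> I" and t: "0 < t" "t < t0" for i t
  proof -
    have "edge_form i p (\<lambda>z. \<Sum>j\<in>I. \<gamma> t j *\<^sub>R L j z) = (\<Sum>j\<in>I. if i = j then \<gamma> t j else 0)"
      unfolding edge_form_lincomb_right using dual i by (intro sum.cong) auto
    also have "\<dots> = \<gamma> t i" using i fI by simp
    finally have "edge_form i p (y t) = t * \<gamma> t i"
      using flex[of i] IE i unfolding y_def edge_form_right by auto
    then show ?thesis
      using form_y[OF i t] unfolding m_def edge_form_left edge_form_right by simp
  qed
  have y_lim: "((\<lambda>t. y t z) \<longlongrightarrow> v z) (at_right 0)" for z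
  proof -
    have "((\<lambda>t. t *\<^sub>R (\<Sum>i\<in>I. \<gamma> t i *\<^sub>R L i z)) \<longlongrightarrow> 0) (at_right 0)"
    proof (rule Lim_null_comparison)
      show "eventually (\<lambda>t. norm (t *\<^sub>R (\<Sum>i\<in>I. \<gamma> t i *\<^sub>R L i z)) \<le> t * (\<Sum>i\<in>I. M * norm (L i z))) (at_right 0)"
        using ev
      proof (eventually_elim)
        case (elim t)
        have "norm (\<Sum>i\<in>I. \<gamma> t i *\<^sub>R L i z) \<le> (\<Sum>i\<in>I. M * norm (L i z))"
          using \<gamma>_le[of _ t] elim by (intro sum_norm_le) (simp add: mult_right_mono)
        then show ?case using elim by (simp add: mult_left_mono)
      qed
      show "((\<lambda>t. t * (\<Sum>i\<in>I. M * norm (L i z))) \<longlongrightarrow> 0) (at_right 0)"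
        by (rule tendsto_eq_intros refl | simp)+
    qed
    from tendsto_add[OF tendsto_const[of "v z"] this] show ?thesis unfolding y_def by simp
  qed
  have id0: "((\<lambda>t. t) \<longlongrightarrow> (0 :: real)) (at_right 0)" by (rule tendsto_ident_at)
  have x_lim: "((\<lambda>t. t *\<^sub>R y t z) \<longlongrightarrow> 0) (at_right 0)" for z
    using tendsto_scaleR[OF id0 y_lim[of z]] by simp
  have m_lim: "((\<lambda>t. m t z) \<longlongrightarrow> p z) (at_right 0)" for z
    using tendsto_add[OF tendsto_const[of "p z"] tendsto_scaleR[OF tendsto_const[of "1 / 2"] x_lim[of z]]]
    unfolding m_def by simp
  \<comment> \<open>\<open>D e\<close> is a polynomial that is nonzero at \<open>p\<close>, so it
    can be cancelled at the nearby midpoints.\<close>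
  have "eventually (\<lambda>t. \<forall>e\<in>E. D e (m t) \<noteq> 0) (at_right 0)"
  proof (rule eventually_ball_finite[OF fE], rule ballI)
    fix e assume e: "e \<in> E"
    have "((\<lambda>t. D e (m t)) \<longlongrightarrow> D e p) (at_right 0)"
      using D e m_lim by (intro config_poly_tendsto[of V]) auto
    then show "eventually (\<lambda>t. D e (m t) \<noteq> 0) (at_right 0)"
      using D e by (intro tendsto_imp_eventually_ne) auto
  qed
  moreover have "eventually (\<lambda>t. \<forall>z\<in>V. norm (t *\<^sub>R y t z) < \<epsilon>) (at_right 0)"
    using V
  proof (rule eventually_ball_finite, intro ballI)
    fix z
    have "((\<lambda>t. norm (t *\<^sub>R y t z)) \<longlongrightarrow> 0) (at_right 0)" using x_lim by (rule tendsto_norm_zero)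
    then show "eventually (\<lambda>t. norm (t *\<^sub>R y t z) < \<epsilon>) (at_right 0)"
      using \<epsilon> by (rule order_tendstoD)
  qed
  moreover have "eventually (\<lambda>t. edge_form (a, b) (m t) (y t) \<noteq> 0) (at_right 0)"
  proof (rule tendsto_imp_eventually_ne)
    show "((\<lambda>t. edge_form (a, b) (m t) (y t)) \<longlongrightarrow> edge_form (a, b) p v) (at_right 0)"
      unfolding edge_form_def by (intro tendsto_inner tendsto_diff y_lim m_lim)
  qed (rule nontriv)
  ultimately have "eventually (\<lambda>t. (\<forall>e\<in>E. D e (m t) \<noteq> 0) \<and> (\<forall>z\<in>V. norm (t *\<^sub>R y t z) < \<epsilon>) \<and>
      edge_form (a, b) (m t) (y t) \<noteq> 0 \<and> 0 < t \<and> t < t0) (at_right 0)"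
    using ev by eventually_elim (intro conjI; assumption?; elim conjE; assumption)
  from eventually_happens'[OF trivial_limit_at_right_real this] obtain t where t: "\<forall>e\<in>E. D e (m t) \<noteq> 0" "\<forall>z\<in>V. norm (t *\<^sub>R y t z) < \<epsilon>"
      "edge_form (a, b) (m t) (y t) \<noteq> 0" "0 < t" "t < t0"
    by (elim exE conjE)
  define q where "q z = p z + t *\<^sub>R y t z" for z
  have E0: "edge_form e (m t) (\<lambda>z. t *\<^sub>R y t z) = 0" if e: "e \<in> E" for e
  proof -
    obtain D' where "\<forall>m w. D e m * edge_form e m w = (\<Sum>i\<in>I. D' i m * edge_form i m w)"
      using D e by blast
    then have "D e (m t) * edge_form e (m t) (\<lambda>z. t *\<^sub>R y t z) =
        (\<Sum>i\<in>I. D' i (m t) * edge_form i (m t) (\<lambda>z. t *\<^sub>R y t z))" by blast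
    also have "\<dots> = 0" using form_I t by (intro sum.neutral) auto
    finally show ?thesis using t(1) e by simp
  qed
  have iff: "norm (q u - q w) = norm (p u - p w) \<longleftrightarrow> edge_form (u, w) (m t) (\<lambda>z. t *\<^sub>R y t z) = 0" for u w
    unfolding q_def m_def using norm_diff_eq_iff_edge_form[of p u "\<lambda>z. t *\<^sub>R y t z" w] .
  show ?thesis
  proof (intro exI[of _ q] conjI ballI, clarify)
    fix u w assume "(u, w) \<in> E"
    from iff[THEN iffD2, OF E0[OF this]] show "norm (p u - p w) = norm (q u - q w)" by (rule sym)
  next
    fix z assume "z \<in> V"
    then show "norm (p z - q z) < \<epsilon>" using t(2) by (simp add: q_def)
  next
    have "norm (q a - q b) \<noteq> norm (p a - p b)"
      unfolding iff edge_form_right using t(3,4) by simp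
    then show "norm (p a - p b) \<noteq> norm (q a - q b)" by (rule not_sym)
  qed
qed

section \<open>Separators of rigid graphs\<close>

text \<open>The infinitesimal isometry with skew linear part
  \<open>x \<mapsto> (g \<bullet> x) h - (h \<bullet> x) g\<close>, a rotation about the common zero
  set of two affine functions. Flexes arise by gluing such fields.\<close>

definition rotation_field :: "real ^ 'n \<Rightarrow> real \<Rightarrow> real ^ 'n \<Rightarrow> real \<Rightarrow> real ^ 'n \<Rightarrow> real ^ 'n" where
  "rotation_field g c h e x = (g \<bullet> x + c) *\<^sub>R h - (h \<bullet> x + e) *\<^sub>R g"

text \<open>Only the values of the two affine functions at the three points enter, so two fields can
  be made compatible by prescribing values at vertices.\<close>

lemma inner_rotation_field:
  "(x - y) \<bullet> rotation_field g c h e z =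
    (g \<bullet> z + c) * ((h \<bullet> x + e) - (h \<bullet> y + e)) - (h \<bullet> z + e) * ((g \<bullet> x + c) - (g \<bullet> y + c))"
  by (simp add: rotation_field_def inner_diff_left inner_diff_right inner_commute algebra_simps)

lemma rotation_field_skew:
  "(x - y) \<bullet> (rotation_field g c h e x - rotation_field g c h e y) = 0"
  unfolding inner_diff_right inner_rotation_field by (simp add: algebra_simps)

lemma rotation_field_0: "g \<bullet> x + c = 0 \<Longrightarrow> h \<bullet> x + e = 0 \<Longrightarrow> rotation_field g c h e x = 0"
  by (simp add: rotation_field_def)

lemma card_split_three:
  assumes "finite S" "S \<subseteq> A \<union> B \<union> C" "A \<inter> B = {}" "A \<inter> C = {}" "B \<inter> C = {}"
  shows "card (S \<inter> A) + card (S \<inter> B) + card (S \<inter> C) = card S"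
proof -
  have "card (S \<inter> A \<union> S \<inter> B \<union> S \<inter> C) = card (S \<inter> A \<union> S \<inter> B) + card (S \<inter> C)"
    by (rule card_Un_disjoint) (use assms in blast)+
  moreover have "card (S \<inter> A \<union> S \<inter> B) = card (S \<inter> A) + card (S \<inter> B)"
    by (rule card_Un_disjoint) (use assms in blast)+
  moreover have "S \<inter> A \<union> S \<inter> B \<union> S \<inter> C = S" using assms(2) by blast
  ultimately show ?thesis by (simp only:)
qed

section \<open>Separations and components after vertex deletion\<close>

context pair_graph
begin

abbreviation linked :: "'a set \<Rightarrow> 'a \<Rightarrow> 'a \<Rightarrow> bool" where
  "linked S u v \<equiv> (u, v) \<in> (avoiding (parcs G) S)\<^sup>*"

lemma linked_sym: "linked S u v \<Longrightarrow> linked S v u"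
proof -
  assume "linked S u v"
  moreover have "sym (avoiding (parcs G) S)"
    by (auto simp: sym_def avoiding_def intro: arcs_symmetric)
  ultimately show ?thesis by (metis sym_rtrancl symD)
qed

lemma linked_closed: "linked S u v \<Longrightarrow> u \<in> pverts G - S \<Longrightarrow> v \<in> pverts G - S"
  by (induction rule: rtrancl_induct) (auto simp: avoiding_def dest: in_arcsD2)

lemma linked_step: "linked S u v \<Longrightarrow> (v, w) \<in> parcs G \<Longrightarrow> v \<notin> S \<Longrightarrow> w \<notin> S \<Longrightarrow> linked S u w"
  by (auto simp: avoiding_def intro: rtrancl_into_rtrancl)

lemma linked_subset_component:
  assumes "linked S u v" "\<And>z. linked S u z \<Longrightarrow> z \<notin> T"
  shows "linked T u v"
  using assms(1)
proof (induction rule: rtrancl_induct)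
  case (step y z)
  then have "y \<notin> T" "z \<notin> T" using assms(2) rtrancl_into_rtrancl by metis+
  then show ?case using step by (auto simp: avoiding_def intro: rtrancl_into_rtrancl)
qed simp

text \<open>The sides may be unions of several components, and they may be empty; nonemptiness is
  demanded where a separation is used.\<close>

definition separation :: "'a set \<Rightarrow> 'a set \<Rightarrow> 'a set \<Rightarrow> bool" where
  "separation S X X' \<longleftrightarrow> X \<union> S \<union> X' = pverts G \<and> X \<inter> S = {} \<and> X' \<inter> S = {} \<and> X \<inter> X' = {} \<and>
    (\<forall>a\<in>X. \<forall>b\<in>X'. (a, b) \<notin> parcs G \<and> (b, a) \<notin> parcs G)"

lemma separation_swap: "separation S X X' \<Longrightarrow> separation S X' X"
  by (auto simp: separation_def)

lemma separation_sets:
  assumes "separation S X X'"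
  shows "S \<subseteq> pverts G" "X \<subseteq> pverts G" "X' \<subseteq> pverts G" "pverts G \<subseteq> X \<union> S \<union> X'"
    "X \<inter> S = {}" "X' \<inter> S = {}" "X \<inter> X' = {}"
  using assms unfolding separation_def by blast+

lemma separation_component:
  assumes "S \<subseteq> pverts G" "u \<in> pverts G - S"
  shows "separation S {z. linked S u z} (pverts G - S - {z. linked S u z})"
proof -
  have "{z. linked S u z} \<subseteq> pverts G - S" using linked_closed assms by blast
  moreover have "(a, b) \<notin> parcs G" if "linked S u a" "b \<in> pverts G - S" "\<not> linked S u b" for a b
    using linked_step[OF that(1), of b] linked_closed[OF that(1) assms(2)] that(2,3) by blast
  ultimately show ?thesis
    using assms(1) unfolding separation_def by (blast intro: arcs_symmetric)
qed

lemma separation_edge: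
  assumes "separation S X X'" "(a, b) \<in> parcs G"
  shows "a \<in> X \<union> S \<and> b \<in> X \<union> S \<or> a \<in> X' \<union> S \<and> b \<in> X' \<union> S"
  using assms in_arcsD1[of a b] in_arcsD2[of a b] unfolding separation_def by blast

end

section \<open>Flexes that exclude small and crossing separators\<close>

locale generic_rigid = pair_graph G for G :: "'a pair_pre_digraph" +
  fixes p :: "'a \<Rightarrow> real ^ 'n"
  assumes gen: "generic G p" and rigid: "rigid_fw G p" and card_V: "CARD('n) + 1 \<le> card (pverts G)"
begin

lemma gen_on: "generic_on (pverts G) p"
  using gen by (simp add: generic_def generic_on_def)

lemmas interpolation = generic_interpolation[OF gen_on pair_finite_verts card_V]

lemma affine_eq_0:
  assumes "U \<subseteq> pverts G" "CARD('n) + 1 \<le> card U" "\<forall>u\<in>U. g \<bullet> p u + c = 0"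
  shows "g = 0 \<and> c = 0"
  using generic_affine_eq_0[OF gen_on finite_subset[OF assms(1) pair_finite_verts] assms] .

lemma interpolation_point:
  assumes S: "S \<subseteq> pverts G" "card S \<le> CARD('n)" and a: "a \<in> pverts G" "a \<notin> S"
  shows "\<exists>g c. (\<forall>z\<in>S. g \<bullet> p z + c = 0) \<and> g \<bullet> p a + c = 1"
proof -
  have "finite S" using S(1) pair_finite_verts by (rule finite_subset)
  then have U: "insert a S \<subseteq> pverts G" "card (insert a S) \<le> CARD('n) + 1"
    using S a by (simp_all add: card_insert_if)
  obtain g c where g: "\<forall>z\<in>insert a S. g \<bullet> p z + c = (if z = a then 1 else 0)"
    using interpolation[OF U, of "\<lambda>z. if z = a then 1 else 0"] by (elim exE)
  have "\<forall>z\<in>S. g \<bullet> p z + c = 0"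
  proof
    fix z assume "z \<in> S"
    with bspec[OF g insertI2[OF this]] a(2) show "g \<bullet> p z + c = 0" by (cases "z = a") simp_all
  qed
  moreover have "g \<bullet> p a + c = 1" using bspec[OF g insertI1] by simp
  ultimately show ?thesis by (intro exI conjI)
qed

text \<open>Rigidity becomes infinitesimal rigidity: if velocities respecting all edges changed some
  distance to first order, integrating them would give arbitrarily close equivalent frameworks that
  are not congruent.\<close>

lemma no_flex:
  assumes "\<And>a b. (a, b) \<in> parcs G \<Longrightarrow> (p a - p b) \<bullet> (v a - v b) = 0"
    and "a \<in> pverts G" "b \<in> pverts G"
  shows "(p a - p b) \<bullet> (v a - v b) = 0"
proof (rule ccontr)
  assume "(p a - p b) \<bullet> (v a - v b) \<noteq> 0"
  then have nt: "edge_form (a, b) p v \<noteq> 0" by (simp add: edge_form_def)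
  have fl: "edge_form e p v = 0" if "e \<in> parcs G" for e
    using assms(1)[of "fst e" "snd e"] that by (simp add: edge_form_def)
  have sub: "parcs G \<subseteq> pverts G \<times> pverts G" using in_arcsD1 in_arcsD2 by auto
  obtain \<epsilon> where \<epsilon>: "\<epsilon> > 0" "\<forall>q. equivalent_fw G p q \<and> (\<forall>v\<in>pverts G. norm (p v - q v) < \<epsilon>) \<longrightarrow> congruent_fw G p q"
    using rigid unfolding rigid_fw_def by blast
  have "\<exists>q. (\<forall>(u, w)\<in>parcs G. norm (p u - p w) = norm (q u - q w)) \<and>
      (\<forall>z\<in>pverts G. norm (p z - q z) < \<epsilon>) \<and> norm (p a - p b) \<noteq> norm (q a - q b)"
    by (rule generic_flex_integrates[OF gen_on pair_finite_verts sub fl nt \<epsilon>(1)])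
  then obtain q where "\<forall>(u, w)\<in>parcs G. norm (p u - p w) = norm (q u - q w)"
      "\<forall>z\<in>pverts G. norm (p z - q z) < \<epsilon>" and ne: "norm (p a - p b) \<noteq> norm (q a - q b)"
    by (elim exE conjE)
  then have "congruent_fw G p q" using \<epsilon>(2) unfolding equivalent_fw_def by blast
  then show False using ne assms(2,3) unfolding congruent_fw_def by blast
qed

text \<open>The vertices \<open>u\<close>, \<open>w\<close> and those of \<open>S\<close> are at
  most d + 1 in number, so two affine functions vanishing on \<open>S\<close> can be prescribed at
  \<open>u\<close> and \<open>w\<close> independently. Rotating the component of \<open>w\<close>
  about their common zero set is a flex that fixes \<open>S\<close>.\<close>

lemma connectivity:
  assumes S: "S \<subseteq> pverts G" "card S < CARD('n)" and u: "u \<in> pverts G - S" and w: "w \<in> pverts G - S"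
  shows "linked S u w"
proof (rule ccontr)
  assume not: "\<not> linked S u w"
  then have uw: "u \<noteq> w" by auto
  let ?U = "insert u (insert w S)"
  have fS: "finite S" using S(1) pair_finite_verts finite_subset by blast
  have "card ?U \<le> card S + 2" using fS by (simp add: card_insert_if)
  then have U: "?U \<subseteq> pverts G" "card ?U \<le> CARD('n) + 1"
    using S u w by (blast, linarith)
  obtain g c where g: "\<forall>z\<in>?U. g \<bullet> p z + c = (if z = w then 1 else 0)"
    using interpolation[OF U, of "\<lambda>z. if z = w then 1 else 0"] by (elim exE)
  obtain h e where h: "\<forall>z\<in>?U. h \<bullet> p z + e = (if z = u then 1 else 0)"
    using interpolation[OF U, of "\<lambda>z. if z = u then 1 else 0"] by (elim exE)
  define v where "v z = (if linked S w z then rotation_field g c h e (p z) else 0)" for z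
  have S0: "rotation_field g c h e (p z) = 0" if "z \<in> S" for z
    using g h that u w by (intro rotation_field_0) auto
  have half: "(p a - p b) \<bullet> (v a - v b) = 0" if "(a, b) \<in> parcs G" "linked S w a" for a b
  proof (cases "linked S w b")
    case True
    then show ?thesis using that by (simp add: v_def rotation_field_skew)
  next
    case False
    then have "b \<in> S" using linked_step[OF that(2,1)] linked_closed[OF that(2) w] by blast
    then have "v a - v b = rotation_field g c h e (p a) - rotation_field g c h e (p b)"
      using that False S0 by (simp add: v_def)
    then show ?thesis by (simp only: rotation_field_skew)
  qed
  have flex: "(p a - p b) \<bullet> (v a - v b) = 0" if ab: "(a, b) \<in> parcs G" for a b
  proof -
    consider "linked S w a" | "linked S w b" | "\<not> linked S w a" "\<not> linked S w b" by blast
    then show ?thesis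
    proof cases
      case 1
      with ab show ?thesis by (rule half)
    next
      case 2
      have "(p b - p a) \<bullet> (v b - v a) = 0" using arcs_symmetric[OF ab] 2 by (rule half)
      then show ?thesis by (simp add: inner_diff_left inner_diff_right)
    next
      case 3
      then show ?thesis by (simp add: v_def)
    qed
  qed
  have "u \<in> pverts G" "w \<in> pverts G" using u w by blast+
  with flex have "(p u - p w) \<bullet> (v u - v w) = 0" by (rule no_flex)
  moreover have "v u = 0" using not linked_sym by (auto simp: v_def)
  \<comment> \<open>At \<open>w\<close> the first function is 1 and the second is 0, so the velocity
    is \<open>h\<close>. The second function differs by 1 between \<open>u\<close> and
    \<open>w\<close>, hence the distance changes to first order.\<close>
  moreover have "v w = h" using g h uw by (simp add: v_def rotation_field_def)
  moreover have "h \<bullet> p u + e = 1" "h \<bullet> p w + e = 0" using h uw by auto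
  ultimately show False by (simp add: inner_diff_left inner_diff_right inner_commute)
qed

text \<open>Vertices of \<open>Y\<close> only see each other and \<open>T\<close>. One side of \<open>S\<close> is rotated about the rest of \<open>S\<close>,
  and \<open>Y\<close> follows by an infinitesimal isometry adapted to the relative motion of the two parts of \<open>T\<close>.\<close>

lemma no_thin_crossing:
  assumes S: "separation S X X'" "card S = CARD('n)" and T: "separation T Y Y'" "card T = CARD('n)"
    and thin: "Y \<subseteq> S" "Y \<noteq> {}" and ne: "S \<inter> Y' \<noteq> {}" "T \<inter> X \<noteq> {}" "T \<inter> X' \<noteq> {}"
  shows False
proof -
  have V: "S \<subseteq> pverts G" "T \<subseteq> pverts G" "Y \<subseteq> pverts G"
    using separation_sets[OF S(1)] separation_sets[OF T(1)] by blast+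
  then have fin: "finite S" "finite T" using pair_finite_verts finite_subset by blast+
  obtain x0 where x0: "x0 \<in> Y" using thin by blast
  obtain t1 where t1: "t1 \<in> T" "t1 \<in> X" using ne by blast
  obtain t2 where t2: "t2 \<in> T" "t2 \<in> X'" using ne by blast
  obtain s2 where s2: "s2 \<in> S" "s2 \<in> Y'" using ne by blast
  note SS = separation_sets[OF S(1)] and TT = separation_sets[OF T(1)]
  have d: "t1 \<notin> S" "t2 \<notin> S" "x0 \<notin> T" "s2 \<notin> T" "s2 \<notin> Y" "t1 \<in> pverts G" "t2 \<in> pverts G" "x0 \<in> pverts G" "s2 \<in> pverts G"
    by (use SS(5) t1(2) in blast, use SS(6) t2(2) in blast, use TT(5) x0 in blast,
        use TT(6) s2(2) in blast, use TT(7) s2(2) in blast, use SS(2) t1(2) in blast,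
        use SS(3) t2(2) in blast, use TT(2) x0 in blast, use TT(3) s2(2) in blast)
  have cS: "card S \<le> CARD('n)" "card S \<le> CARD('n) + 1" and cT: "card T \<le> CARD('n)" "card T \<le> CARD('n) + 1"
    using S(2) T(2) by simp_all
  obtain gs cs where \<sigma>S: "\<forall>z\<in>S. gs \<bullet> p z + cs = 0" and \<sigma>1: "gs \<bullet> p t1 + cs = 1"
    using interpolation_point[OF V(1) cS(1) d(6,1)] by (elim exE conjE)
  note \<sigma>S = \<sigma>S[rule_format]
  obtain gt ct where \<tau>T: "\<forall>z\<in>T. gt \<bullet> p z + ct = 0" and \<tau>: "gt \<bullet> p x0 + ct = 1"
    using interpolation_point[OF V(2) cT(1) d(8,3)] by (elim exE conjE)
  note \<tau>T = \<tau>T[rule_format]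
  \<comment> \<open>Write sigma, tau, f, g for the affine functions with gradients
    \<open>gs\<close>, \<open>gt\<close>, \<open>gf\<close>, \<open>gg\<close>. Between
    \<open>a\<close> in \<open>Y\<close> and \<open>b\<close> in \<open>T \<inter> X\<close> the two
    fields contribute \<open>- tau a * g b\<close> and \<open>- sigma b * f a\<close>; f = tau on
    \<open>Y\<close> and g = sigma on \<open>T \<inter> X\<close> make them equal. With the value 0
    at the remaining vertices of \<open>S\<close> and \<open>T\<close> the fields vanish there,
    matching the vertices at rest.\<close>
  from interpolation[OF V(1) cS(2), of "\<lambda>z. if z \<in> Y then gt \<bullet> p z + ct else 0"]
  obtain gf cf where f: "\<forall>z\<in>S. gf \<bullet> p z + cf = (if z \<in> Y then gt \<bullet> p z + ct else 0)"
    by (elim exE)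
  from interpolation[OF V(2) cT(2), of "\<lambda>z. if z \<in> X then gs \<bullet> p z + cs else 0"]
  obtain gg cg where g: "\<forall>z\<in>T. gg \<bullet> p z + cg = (if z \<in> X then gs \<bullet> p z + cs else 0)"
    by (elim exE)
  define v where "v z = (if z \<in> Y then rotation_field gt ct gg cg (p z)
    else if z \<in> X then rotation_field gf cf gs cs (p z) else 0)" for z
  have YX: "z \<notin> X" if "z \<in> Y" for z using thin(1) SS(5) that by blast
  have nY: "b \<in> T" if "(a, b) \<in> parcs G" "a \<in> Y" "b \<notin> Y" for a b
    using separation_edge[OF T(1) that(1)] that(2,3) TT(5,7) by blast
  have nX: "b \<in> S" if "(a, b) \<in> parcs G" "a \<in> X" "b \<notin> X" for a b
    using separation_edge[OF S(1) that(1)] that(2,3) SS(5,7) by blast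
  have eY: "(p a - p b) \<bullet> (v a - v b) = 0" if ab: "(a, b) \<in> parcs G" "a \<in> Y" for a b
  proof -
    have aS: "a \<in> S" using thin ab by blast
    have fa: "gs \<bullet> p a + cs = 0" "gf \<bullet> p a + cf = gt \<bullet> p a + ct" using \<sigma>S[OF aS] bspec[OF f aS] ab(2) by simp_all
    consider "b \<in> Y" | "b \<notin> Y" "b \<in> T" "b \<in> X" | "b \<notin> Y" "b \<in> T" "b \<notin> X"
      using nY[OF ab] by blast
    then show ?thesis
    proof cases
      case 1
      then show ?thesis using ab by (simp add: v_def rotation_field_skew)
    next
      case 2
      have fb: "gg \<bullet> p b + cg = gs \<bullet> p b + cs" "gt \<bullet> p b + ct = 0"
        using bspec[OF g 2(2)] \<tau>T[OF 2(2)] 2(3) by simp_all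
      have "v a - v b = rotation_field gt ct gg cg (p a) - rotation_field gf cf gs cs (p b)"
        using 2 ab by (simp add: v_def)
      then have "(p a - p b) \<bullet> (v a - v b) = (p a - p b) \<bullet> rotation_field gt ct gg cg (p a) -
          (p a - p b) \<bullet> rotation_field gf cf gs cs (p b)"
        by (simp only: inner_diff_right)
      also have "\<dots> = 0"
        unfolding inner_rotation_field fa fb by (simp add: algebra_simps)
      finally show ?thesis .
    next
      case 3
      have "gg \<bullet> p b + cg = 0" "gt \<bullet> p b + ct = 0"
        using bspec[OF g 3(2)] \<tau>T[OF 3(2)] 3(3) by simp_all
      moreover have "v a - v b = rotation_field gt ct gg cg (p a)"
        using 3 ab by (simp add: v_def)
      ultimately show ?thesis by (simp add: inner_rotation_field)
    qed
  qed
  have eX: "(p a - p b) \<bullet> (v a - v b) = 0" if ab: "(a, b) \<in> parcs G" "a \<in> X" "b \<notin> Y" for a b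
  proof (cases "b \<in> X")
    case True
    have na: "a \<notin> Y" using YX ab(2) by blast
    with True show ?thesis using ab(2,3) na by (simp add: v_def rotation_field_skew)
  next
    case False
    then have bS: "b \<in> S" using nX[OF ab(1,2)] by blast
    have "gf \<bullet> p b + cf = 0" "gs \<bullet> p b + cs = 0"
      using bspec[OF f bS] \<sigma>S[OF bS] ab(3) by simp_all
    moreover have "v a - v b = rotation_field gf cf gs cs (p a)"
      using ab(2,3) YX[of a] False by (auto simp: v_def)
    ultimately show ?thesis by (simp add: inner_rotation_field)
  qed
  have sw: "(p a - p b) \<bullet> (v a - v b) = (p b - p a) \<bullet> (v b - v a)" for a b
    by (simp add: inner_diff_left inner_diff_right)
  have flex: "(p a - p b) \<bullet> (v a - v b) = 0" if ab: "(a, b) \<in> parcs G" for a b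
  proof -
    have ba: "(b, a) \<in> parcs G" using ab by (rule arcs_symmetric)
    consider "a \<in> Y" | "b \<in> Y" | "a \<notin> Y" "b \<notin> Y" "a \<in> X" | "a \<notin> Y" "b \<notin> Y" "b \<in> X"
      | "a \<notin> Y" "b \<notin> Y" "a \<notin> X" "b \<notin> X" by blast
    then show ?thesis
    proof cases
      case 1 show ?thesis by (rule eY[OF ab 1])
    next
      case 2 show ?thesis unfolding sw[of a b] by (rule eY[OF ba 2])
    next
      case 3 show ?thesis by (rule eX[OF ab 3(3,2)])
    next
      case 4 show ?thesis unfolding sw[of a b] by (rule eX[OF ba 4(3,1)])
    next
      case 5 then show ?thesis by (simp add: v_def)
    qed
  qed
  \<comment> \<open>Here \<open>z\<close> is at rest and \<open>y\<close> moves with the field of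
    \<open>X\<close>. Rigidity keeps their distance, which forces f and sigma to be proportional on
    the two parts of \<open>T\<close> with a common ratio.\<close>
  have rel: "(gs \<bullet> p y + cs) * (gf \<bullet> p z + cf) = (gf \<bullet> p y + cf) * (gs \<bullet> p z + cs)"
    if y: "y \<in> T" "y \<in> X" and z: "z \<in> T" "z \<in> X'" for y z
  proof -
    have ny: "y \<notin> Y" "z \<notin> Y" "z \<notin> X"
      by (use TT(5) y(1) in blast, use TT(5) z(1) in blast, use SS(7) z(2) in blast)
    have "y \<in> pverts G" "z \<in> pverts G" using V y z by blast+
    with flex have "(p y - p z) \<bullet> (v y - v z) = 0" by (rule no_flex)
    moreover have "v y - v z = rotation_field gf cf gs cs (p y)" using ny y by (simp add: v_def)
    ultimately have "(p y - p z) \<bullet> rotation_field gf cf gs cs (p y) = 0" by (simp only:)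
    then show ?thesis unfolding inner_rotation_field by (simp add: algebra_simps)
  qed
  have \<sigma>2: "gs \<bullet> p t2 + cs \<noteq> 0"
  proof
    assume "gs \<bullet> p t2 + cs = 0"
    then have 0: "\<forall>z\<in>insert t2 S. gs \<bullet> p z + cs = 0" using \<sigma>S by blast
    have "insert t2 S \<subseteq> pverts G" using V d by blast
    moreover have "CARD('n) + 1 \<le> card (insert t2 S)" using fin S(2) d(2) by simp
    ultimately have "gs = 0 \<and> cs = 0" using 0 by (rule affine_eq_0)
    then show False using \<sigma>1 by simp
  qed
  define k where "k = gf \<bullet> p t1 + cf"
  have k2: "gf \<bullet> p z + cf = k * (gs \<bullet> p z + cs)" if "z \<in> T" "z \<in> X'" for z
    using rel[OF t1 that] \<sigma>1 by (simp add: k_def)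
  have k1: "gf \<bullet> p y + cf = k * (gs \<bullet> p y + cs)" if "y \<in> T" "y \<in> X" for y
  proof -
    have "(gs \<bullet> p t2 + cs) * (gf \<bullet> p y + cf) = (gs \<bullet> p t2 + cs) * (k * (gs \<bullet> p y + cs))"
      using rel[OF that t2] unfolding k2[OF t2] by (simp only: mult_ac)
    then show ?thesis by (rule mult_left_cancel[OF \<sigma>2, THEN iffD1])
  qed
  have k3: "gf \<bullet> p z + cf = k * (gs \<bullet> p z + cs)" if "z \<in> S" "z \<notin> Y" for z
    using bspec[OF f that(1)] \<sigma>S[OF that(1)] that(2) by simp
  have f_eq: "gf \<bullet> p z + cf = k * (gs \<bullet> p z + cs)" if z: "z \<in> insert s2 T" for z
  proof -
    have "z \<in> pverts G" using z V(2) d(9) by blast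
    then have "z \<in> X \<or> z \<in> X' \<or> z \<in> S" using SS(4) by blast
    moreover have "z \<notin> Y" using z d(5) TT(5) by blast
    moreover have "z \<in> T \<or> z \<in> S" using z s2(1) by blast
    ultimately consider "z \<in> T" "z \<in> X" | "z \<in> T" "z \<in> X'" | "z \<in> S" "z \<notin> Y" by blast
    then show ?thesis
    proof cases
      case 1 then show ?thesis by (rule k1)
    next
      case 2 then show ?thesis by (rule k2)
    next
      case 3 then show ?thesis by (rule k3)
    qed
  qed
  have 0: "\<forall>z\<in>insert s2 T. (gf - k *\<^sub>R gs) \<bullet> p z + (cf - k * cs) = 0"
  proof
    fix z assume "z \<in> insert s2 T"
    from f_eq[OF this] show "(gf - k *\<^sub>R gs) \<bullet> p z + (cf - k * cs) = 0"
      by (simp add: inner_diff_left algebra_simps)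
  qed
  \<comment> \<open>f and \<open>k\<close> sigma agree at d + 1 generic vertices, hence everywhere.
    At \<open>x0\<close>, which lies in \<open>Y\<close> and therefore in \<open>S\<close>, sigma is
    0 whereas f is 1.\<close>
  have "insert s2 T \<subseteq> pverts G" using V d by blast
  moreover have "CARD('n) + 1 \<le> card (insert s2 T)" using fin T(2) d(4) by simp
  ultimately have "gf - k *\<^sub>R gs = 0 \<and> cf - k * cs = 0" using 0 by (rule affine_eq_0)
  then have "gf = k *\<^sub>R gs" "cf = k * cs" by simp_all
  then have "gf \<bullet> p x0 + cf = k * (gs \<bullet> p x0 + cs)" by (simp add: algebra_simps)
  moreover have x0S: "x0 \<in> S" using x0 thin by blast
  ultimately have "gf \<bullet> p x0 + cf = 0" using \<sigma>S[OF x0S] by simp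
  moreover have "gf \<bullet> p x0 + cf = 1" using bspec[OF f x0S] \<tau> x0 by simp
  ultimately show False by simp
qed

text \<open>Here the four pieces move by infinitesimal isometries built from the affine functions \<open>g\<close> and \<open>h\<close>
  whose zero sets are the hyperplanes through the boundaries of the two opposite corners.\<close>

lemma no_balanced_crossing:
  assumes S: "separation S X X'" and T: "separation T Y Y'"
    and K: "card ((S \<inter> Y) \<union> (T \<inter> X) \<union> (S \<inter> T)) \<le> CARD('n)"
    and K': "card ((S \<inter> Y') \<union> (T \<inter> X') \<union> (S \<inter> T)) \<le> CARD('n)"
    and ne: "S \<inter> Y \<noteq> {}" "S \<inter> Y' \<noteq> {}"
  shows False
proof -
  let ?K = "(S \<inter> Y) \<union> (T \<inter> X) \<union> (S \<inter> T)" and ?K' = "(S \<inter> Y') \<union> (T \<inter> X') \<union> (S \<inter> T)"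
  note SS = separation_sets[OF S] and TT = separation_sets[OF T]
  have V: "?K \<subseteq> pverts G" "?K' \<subseteq> pverts G" using SS(1) TT(1) by blast+
  then have fin: "finite ?K" "finite ?K'" using pair_finite_verts finite_subset by blast+
  obtain x1 x2 where x1: "x1 \<in> S" "x1 \<in> Y" and x2: "x2 \<in> S" "x2 \<in> Y'" using ne by blast
  have n1: "x1 \<notin> T" "x1 \<notin> Y'" using x1(2) TT(5,7) by blast+
  have n2: "x2 \<notin> T" "x2 \<notin> Y" using x2(2) TT(6,7) by blast+
  have d: "x2 \<notin> ?K" "x1 \<notin> ?K'" "x1 \<in> pverts G" "x2 \<in> pverts G"
    by (use n2 in blast, use n1 in blast, use x1(1) SS(1) in blast, use x2(1) SS(1) in blast)
  obtain g c where gK: "\<forall>z\<in>?K. g \<bullet> p z + c = 0" and gx2: "g \<bullet> p x2 + c = 1"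
    using interpolation_point[OF V(1) K d(4,1)] by (elim exE conjE)
  note gK = gK[rule_format]
  obtain h e where hK: "\<forall>z\<in>?K'. h \<bullet> p z + e = 0" and hx1: "h \<bullet> p x1 + e = 1"
    using interpolation_point[OF V(2) K' d(3,2)] by (elim exE conjE)
  note hK = hK[rule_format]
  have "card ?K \<le> CARD('n) + 1" "card ?K' \<le> CARD('n) + 1" using K K' by linarith+
  note ip = interpolation[OF V(1) this(1)] interpolation[OF V(2) this(2)]
  \<comment> \<open>The values match the field of the corner of \<open>X\<close> and
    \<open>Y\<close> with the adjacent fields: at \<open>z\<close> in \<open>S \<inter> Y\<close>,
    where \<open>g\<close> vanishes, both equal the value of \<open>h\<close> at \<open>z\<close>
    times the vector \<open>g\<close>, and in \<open>T \<inter> X\<close> its negative. Hence the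
    two signs; \<open>h1\<close> does the same at the opposite corner.\<close>
  from ip(1)[of "\<lambda>z. if z \<in> T then if z \<in> S then 0 else - (h \<bullet> p z + e) else h \<bullet> p z + e"]
  obtain g1 c1 where g1: "\<forall>z\<in>?K. g1 \<bullet> p z + c1 =
      (if z \<in> T then if z \<in> S then 0 else - (h \<bullet> p z + e) else h \<bullet> p z + e)" by (elim exE)
  from ip(2)[of "\<lambda>z. if z \<in> T then if z \<in> S then 0 else - (g \<bullet> p z + c) else g \<bullet> p z + c"]
  obtain h1 e1 where h1: "\<forall>z\<in>?K'. h1 \<bullet> p z + e1 =
      (if z \<in> T then if z \<in> S then 0 else - (g \<bullet> p z + c) else g \<bullet> p z + c)" by (elim exE)
  \<comment> \<open>The closed corners overlap along \<open>S\<close> and \<open>T\<close>. The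
    order of the cases in \<open>v\<close> is only a choice: \<open>v1\<close> to \<open>v4\<close>
    show that each formula holds on its whole closed corner, and every edge lies inside one closed
    corner.\<close>
  let ?B = "\<lambda>X Y. (X \<union> S) \<inter> (Y \<union> T)"
  define v where "v z = (if z \<in> ?B X Y then rotation_field g1 c1 g c (p z)
    else if z \<in> ?B X' Y' then rotation_field h1 e1 h e (p z)
    else if z \<in> ?B X Y' then rotation_field g c h e (p z)
    else rotation_field h e g c (p z))" for z
  have ST: "g \<bullet> p z + c = 0" "h \<bullet> p z + e = 0" "g1 \<bullet> p z + c1 = 0" "h1 \<bullet> p z + e1 = 0" if "z \<in> S" "z \<in> T" for z
  proof -
    have "z \<in> ?K" "z \<in> ?K'" using that by blast+
    then show "g \<bullet> p z + c = 0" "h \<bullet> p z + e = 0" "g1 \<bullet> p z + c1 = 0" "h1 \<bullet> p z + e1 = 0"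
      using gK[of z] hK[of z] bspec[OF g1, of z] bspec[OF h1, of z] that by simp_all
  qed
  have SY: "g \<bullet> p z + c = 0" "g1 \<bullet> p z + c1 = h \<bullet> p z + e" if "z \<in> S" "z \<in> Y" for z
  proof -
    have "z \<in> ?K" "z \<notin> T" using that TT(5,6) by blast+
    then show "g \<bullet> p z + c = 0" "g1 \<bullet> p z + c1 = h \<bullet> p z + e"
      using gK[of z] bspec[OF g1, of z] that by simp_all
  qed
  have TX: "g \<bullet> p z + c = 0" "g1 \<bullet> p z + c1 = - (h \<bullet> p z + e)" if "z \<in> T" "z \<in> X" for z
  proof -
    have "z \<in> ?K" "z \<notin> S" using that SS(5,6) by blast+
    then show "g \<bullet> p z + c = 0" "g1 \<bullet> p z + c1 = - (h \<bullet> p z + e)"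
      using gK[of z] bspec[OF g1, of z] that by simp_all
  qed
  have SY': "h \<bullet> p z + e = 0" "h1 \<bullet> p z + e1 = g \<bullet> p z + c" if "z \<in> S" "z \<in> Y'" for z
  proof -
    have "z \<in> ?K'" "z \<notin> T" using that TT(5,6) by blast+
    then show "h \<bullet> p z + e = 0" "h1 \<bullet> p z + e1 = g \<bullet> p z + c"
      using hK[of z] bspec[OF h1, of z] that by simp_all
  qed
  have TX': "h \<bullet> p z + e = 0" "h1 \<bullet> p z + e1 = - (g \<bullet> p z + c)" if "z \<in> T" "z \<in> X'" for z
  proof -
    have "z \<in> ?K'" "z \<notin> S" using that SS(5,6) by blast+
    then show "h \<bullet> p z + e = 0" "h1 \<bullet> p z + e1 = - (g \<bullet> p z + c)"
      using hK[of z] bspec[OF h1, of z] that by simp_all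
  qed
  have corner: "z \<notin> X' \<union> S" if "z \<in> X" for z using that SS(5,7) by blast
  have corner': "z \<notin> X \<union> S" if "z \<in> X'" for z using that SS(6,7) by blast
  have side: "z \<notin> Y \<union> T" if "z \<in> Y'" for z using that TT(6,7) by blast
  have side': "z \<notin> Y' \<union> T" if "z \<in> Y" for z using that TT(5,7) by blast
  have v1: "v z = rotation_field g1 c1 g c (p z)" if "z \<in> ?B X Y" for z
    unfolding v_def using that by (rule if_P)
  have v2: "v z = rotation_field h1 e1 h e (p z)" if z: "z \<in> ?B X' Y'" for z
  proof (cases "z \<in> ?B X Y")
    case True
    then have "z \<in> S" "z \<in> T" using z corner[of z] side'[of z] by blast+
    then show ?thesis using v1[OF True] ST by (simp add: rotation_field_0)
  next
    case False
    show ?thesis unfolding v_def using False z by (simp only: if_True if_False)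
  qed
  have v3: "v z = rotation_field g c h e (p z)" if z: "z \<in> ?B X Y'" for z
  proof -
    consider "z \<in> S" "z \<in> T" | "z \<in> X" "z \<in> T" "z \<in> ?B X Y" | "z \<in> S" "z \<in> Y'" "z \<in> ?B X' Y'"
      | "z \<in> X" "z \<in> Y'" using z by blast
    then show ?thesis
    proof cases
      case 1
      then have "z \<in> ?B X Y" by blast
      then show ?thesis using v1 ST 1 by (simp add: rotation_field_0)
    next
      case 2
      show ?thesis unfolding v1[OF 2(3)] rotation_field_def TX[OF 2(2,1)]
        by (simp only: scaleR_minus_left scaleR_zero_left diff_0 diff_0_right)
    next
      case 3
      show ?thesis using v2[OF 3(3)] SY'[OF 3(1,2)] by (simp add: rotation_field_def)
    next
      case 4
      have "z \<notin> ?B X Y" "z \<notin> ?B X' Y'" using corner[OF 4(1)] side[OF 4(2)] by blast+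
      then show ?thesis unfolding v_def using z by (simp only: if_True if_False)
    qed
  qed
  have v4: "v z = rotation_field h e g c (p z)" if z: "z \<in> ?B X' Y" for z
  proof -
    consider "z \<in> S" "z \<in> T" | "z \<in> X'" "z \<in> T" "z \<in> ?B X' Y'" | "z \<in> S" "z \<in> Y" "z \<in> ?B X Y"
      | "z \<in> X'" "z \<in> Y" using z by blast
    then show ?thesis
    proof cases
      case 1
      then have "z \<in> ?B X Y" by blast
      then show ?thesis using v1 ST 1 by (simp add: rotation_field_0)
    next
      case 2
      show ?thesis unfolding v2[OF 2(3)] rotation_field_def TX'[OF 2(2,1)]
        by (simp only: scaleR_minus_left scaleR_zero_left diff_0 diff_0_right)
    next
      case 3
      show ?thesis using v1[OF 3(3)] SY[OF 3(1,2)] by (simp add: rotation_field_def)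
    next
      case 4
      have "z \<notin> ?B X Y" "z \<notin> ?B X' Y'" "z \<notin> ?B X Y'" using corner'[OF 4(1)] side'[OF 4(2)] by blast+
      then show ?thesis unfolding v_def by (simp only: if_False)
    qed
  qed
  have flex: "(p a - p b) \<bullet> (v a - v b) = 0" if ab: "(a, b) \<in> parcs G" for a b
  proof -
    consider "a \<in> ?B X Y" "b \<in> ?B X Y" | "a \<in> ?B X' Y'" "b \<in> ?B X' Y'"
      | "a \<in> ?B X Y'" "b \<in> ?B X Y'" | "a \<in> ?B X' Y" "b \<in> ?B X' Y"
      using separation_edge[OF S ab] separation_edge[OF T ab] by blast
    then show ?thesis
    proof cases
      case 1 show ?thesis unfolding v1[OF 1(1)] v1[OF 1(2)] by (rule rotation_field_skew)
    next
      case 2 show ?thesis unfolding v2[OF 2(1)] v2[OF 2(2)] by (rule rotation_field_skew)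
    next
      case 3 show ?thesis unfolding v3[OF 3(1)] v3[OF 3(2)] by (rule rotation_field_skew)
    next
      case 4 show ?thesis unfolding v4[OF 4(1)] v4[OF 4(2)] by (rule rotation_field_skew)
    qed
  qed
  \<comment> \<open>The velocities are \<open>g\<close> at \<open>x1\<close> and \<open>h\<close> at
    \<open>x2\<close>. The function with gradient \<open>g\<close> is 0 at \<open>x1\<close> and 1
    at \<open>x2\<close>, the other one the reverse, so both contribute with the same sign.\<close>
  have "(p x1 - p x2) \<bullet> (v x1 - v x2) = 0" using flex d(3,4) by (rule no_flex)
  moreover have "v x1 = g"
  proof -
    have "x1 \<in> ?B X Y" using x1 by blast
    then show ?thesis using v1 SY[OF x1] hx1 by (simp add: rotation_field_def)
  qed
  moreover have "v x2 = h"
  proof -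
    have "x2 \<in> ?B X' Y'" using x2 by blast
    then show ?thesis using v2 SY'[OF x2] gx2 by (simp add: rotation_field_def)
  qed
  moreover have "(p x1 - p x2) \<bullet> (g - h) = - 2"
  proof -
    have "(p x1 - p x2) \<bullet> (g - h) = ((g \<bullet> p x1 + c) - (g \<bullet> p x2 + c)) - ((h \<bullet> p x1 + e) - (h \<bullet> p x2 + e))"
      by (simp add: inner_diff_left inner_diff_right inner_commute)
    then show ?thesis using SY[OF x1] SY'[OF x2] gx2 hx1 by simp
  qed
  ultimately show False by simp
qed

section \<open>Corners of two separators\<close>

lemma separator_adjacent:
  assumes S: "S \<subseteq> pverts G" "card S = CARD('n)" and u: "u \<in> pverts G - S" and w: "w \<in> pverts G - S"
    and sep: "\<not> linked S u w" and s: "s \<in> S"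
  shows "\<exists>x. linked S u x \<and> (x, s) \<in> parcs G"
proof (rule ccontr)
  assume no: "\<nexists>x. linked S u x \<and> (x, s) \<in> parcs G"
  have "finite S" using S(1) pair_finite_verts finite_subset by blast
  then have "card (S - {s}) < CARD('n)" using S(2) s by (metis card_Diff1_less)
  \<comment> \<open>Deleting only d - 1 vertices leaves \<open>u\<close> and \<open>w\<close>
    linked; without an arc to \<open>s\<close> the walk could never leave the component of
    \<open>u\<close>.\<close>
  then have "linked (S - {s}) u w" using S u w by (intro connectivity) auto
  then have "linked S u w"
  proof (induction rule: rtrancl_induct)
    case (step y z)
    then have "(y, z) \<in> parcs G" "y \<notin> S - {s}" "z \<notin> S - {s}" by (auto simp: avoiding_def)
    moreover have "y \<notin> S" using linked_closed[OF step.IH u] by blast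
    moreover have "z \<noteq> s" using no step.IH calculation(1) by blast
    ultimately show ?case using linked_step[OF step.IH] by blast
  qed simp
  then show False using sep by blast
qed

text \<open>A component of \<open>G - S\<close> that misses \<open>T\<close> stays connected when
  \<open>T\<close> is deleted, and every vertex of \<open>S\<close> has a neighbour in it; so it
  would link \<open>s\<close> to \<open>s'\<close>. This is the symmetry of crossing.\<close>

lemma separator_meets:
  assumes S: "S \<subseteq> pverts G" "card S = CARD('n)" and u: "u \<in> pverts G - S" and w: "w \<in> pverts G - S"
    and sep: "\<not> linked S u w" and s: "s \<in> S - T" "s' \<in> S - T" "\<not> linked T s s'"
  shows "\<exists>t\<in>T. linked S u t"
proof (rule ccontr)
  assume no: "\<not> (\<exists>t\<in>T. linked S u t)"
  obtain x x' where x: "linked S u x" "(x, s) \<in> parcs G" and x': "linked S u x'" "(x', s') \<in> parcs G"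
    using separator_adjacent[OF S u w sep] s by blast
  have "linked T u x" "linked T u x'" using no x x' by (auto intro: linked_subset_component)
  then have "linked T u s" "linked T u s'"
    using linked_step[of u x T s] linked_step[of u x' T s'] x x' no s by blast+
  then have "linked T s s'" by (metis linked_sym rtrancl_trans)
  then show False using s by blast
qed

text \<open>The boundary of a nonempty corner separates it from a vertex of \<open>S\<close> on the
  far side of \<open>T\<close>, so \<open>connectivity\<close> bounds its size from below.\<close>

lemma corner_boundary:
  assumes S: "separation S X X'" and T: "separation T Y Y'" and z: "z \<in> X" "z \<in> Y" and s: "s \<in> S" "s \<in> Y'"
  shows "CARD('n) \<le> card ((S \<inter> Y) \<union> (T \<inter> X) \<union> (S \<inter> T))" (is "_ \<le> card ?K")
proof (rule ccontr)
  assume lt: "\<not> ?thesis"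
  note SS = separation_sets[OF S] and TT = separation_sets[OF T]
  have K: "?K \<subseteq> pverts G" using SS(1) TT(1) by blast
  have z': "z \<notin> S" "z \<notin> T" "z \<in> pverts G" by (use z SS(5) in blast, use z TT(5) in blast, use z SS(2) in blast)
  have s': "s \<notin> T" "s \<notin> Y" "s \<in> pverts G" by (use s TT(6) in blast, use s TT(7) in blast, use s SS(1) in blast)
  have "linked ?K z s" by (rule connectivity[OF K]) (use lt z' s' in auto)
  then have "s \<in> X \<inter> Y"
  proof (induction rule: rtrancl_induct)
    case (step a b)
    then have ab: "(a, b) \<in> parcs G" "b \<notin> ?K" by (auto simp: avoiding_def)
    have a: "a \<notin> X' \<union> S" "a \<notin> Y' \<union> T"
      by (use step.IH SS(5,7) in blast, use step.IH TT(5,7) in blast)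
    have "b \<in> X \<union> S" using separation_edge[OF S ab(1)] a(1) by blast
    moreover have "b \<in> Y \<union> T" using separation_edge[OF T ab(1)] a(2) by blast
    ultimately show ?case using ab(2) by blast
  qed (use z in blast)
  then show False using s'(2) by blast
qed

lemma no_crossing_separations:
  assumes S: "separation S X X'" "card S = CARD('n)" and T: "separation T Y Y'" "card T = CARD('n)"
    and ne: "S \<inter> Y \<noteq> {}" "S \<inter> Y' \<noteq> {}" "T \<inter> X \<noteq> {}" "T \<inter> X' \<noteq> {}" "X \<noteq> {}" "X' \<noteq> {}" "Y \<noteq> {}" "Y' \<noteq> {}"
  shows False
proof -
  note S' = separation_swap[OF S(1)] and T' = separation_swap[OF T(1)]
  note SS = separation_sets[OF S(1)] and TT = separation_sets[OF T(1)]
  have fin: "finite S" "finite T"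
    using finite_subset[OF SS(1) pair_finite_verts] finite_subset[OF TT(1) pair_finite_verts] .
  have "S \<subseteq> Y \<union> Y' \<union> T" using SS(1) TT(4) by blast
  then have cS: "card (S \<inter> Y) + card (S \<inter> Y') + card (S \<inter> T) = CARD('n)"
    using card_split_three[OF fin(1) _ TT(7,5,6)] S(2) by simp
  have "T \<subseteq> X \<union> X' \<union> S" using TT(1) SS(4) by blast
  then have cT: "card (T \<inter> X) + card (T \<inter> X') + card (S \<inter> T) = CARD('n)"
    using card_split_three[OF fin(2) _ SS(7,5,6)] T(2) by (simp add: Int_commute)
  have cK: "card ((S \<inter> B) \<union> (T \<inter> A) \<union> (S \<inter> T)) = card (S \<inter> B) + card (T \<inter> A) + card (S \<inter> T)"
    if "A \<inter> S = {}" "B \<inter> T = {}" for A B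
  proof -
    have "card ((S \<inter> B) \<union> (T \<inter> A)) = card (S \<inter> B) + card (T \<inter> A)"
      by (rule card_Un_disjoint) (use fin that in blast)+
    moreover have "card ((S \<inter> B) \<union> (T \<inter> A) \<union> (S \<inter> T)) = card ((S \<inter> B) \<union> (T \<inter> A)) + card (S \<inter> T)"
      by (rule card_Un_disjoint) (use fin that in blast)+
    ultimately show ?thesis by simp
  qed
  obtain s s' where s: "s \<in> S" "s \<in> Y" and s': "s' \<in> S" "s' \<in> Y'" using ne(1,2) by blast
  \<comment> \<open>If no two opposite corners are both nonempty, two adjacent ones are empty and a
    side lies within the other separator. Otherwise the boundaries of the opposite corners have
    sizes summing to 2d and at least d each, so both are exactly d.\<close>
  consider "X \<inter> Y \<noteq> {}" "X' \<inter> Y' \<noteq> {}" | "X \<inter> Y' \<noteq> {}" "X' \<inter> Y \<noteq> {}"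
    | "X \<inter> Y = {}" "X \<inter> Y' = {}" | "X \<inter> Y = {}" "X' \<inter> Y = {}"
    | "X' \<inter> Y' = {}" "X \<inter> Y' = {}" | "X' \<inter> Y' = {}" "X' \<inter> Y = {}" by blast
  then show False
  proof cases
    case 1
    then obtain z z' where z: "z \<in> X" "z \<in> Y" and z': "z' \<in> X'" "z' \<in> Y'" by blast
    note K = corner_boundary[OF S(1) T(1) z s'] corner_boundary[OF S' T' z' s]
    have "card ((S \<inter> Y) \<union> (T \<inter> X) \<union> (S \<inter> T)) \<le> CARD('n)"
      "card ((S \<inter> Y') \<union> (T \<inter> X') \<union> (S \<inter> T)) \<le> CARD('n)"
      using K cS cT unfolding cK[OF SS(5) TT(5)] cK[OF SS(6) TT(6)] by linarith+
    then show False using ne(1,2) by (rule no_balanced_crossing[OF S(1) T(1)])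
  next
    case 2
    then obtain z z' where z: "z \<in> X" "z \<in> Y'" and z': "z' \<in> X'" "z' \<in> Y" by blast
    note K = corner_boundary[OF S(1) T' z s] corner_boundary[OF S' T(1) z' s']
    have "card ((S \<inter> Y') \<union> (T \<inter> X) \<union> (S \<inter> T)) \<le> CARD('n)"
      "card ((S \<inter> Y) \<union> (T \<inter> X') \<union> (S \<inter> T)) \<le> CARD('n)"
      using K cS cT unfolding cK[OF SS(5) TT(6)] cK[OF SS(6) TT(5)] by linarith+
    then show False using ne(2,1) by (rule no_balanced_crossing[OF S(1) T'])
  next
    case 3
    then have "X \<subseteq> T" using SS(2) TT(4) by blast
    then show False using ne(5,4,1,2) by (rule no_thin_crossing[OF T S])
  next
    case 4
    then have "Y \<subseteq> S" using TT(2) SS(4) by blast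
    then show False using ne(7,2,3,4) by (rule no_thin_crossing[OF S T])
  next
    case 5
    then have "Y' \<subseteq> S" using TT(3) SS(4) by blast
    then show False using ne(8,1,3,4) by (rule no_thin_crossing[OF S T' T(2)])
  next
    case 6
    then have "X' \<subseteq> T" using SS(3) TT(4) by blast
    then show False using ne(6,3,1,2) by (rule no_thin_crossing[OF T S' S(2)])
  qed
qed

text \<open>The sides are the components of \<open>u\<close> and of \<open>s\<close> against the
  rest. By \<open>separator_meets\<close> the set \<open>T\<close> has vertices on both sides of
  \<open>S\<close>, which together with \<open>s\<close> and \<open>s'\<close> gives all the
  nonemptiness conditions.\<close>

theorem separators_do_not_cross:
  assumes S: "S \<subseteq> pverts G" "card S = CARD('n)" and u: "u \<in> pverts G - S" and w: "w \<in> pverts G - S"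
    and sep: "\<not> linked S u w" and T: "T \<subseteq> pverts G" "card T = CARD('n)"
    and s: "s \<in> S - T" "s' \<in> S - T"
  shows "linked T s s'"
proof (rule ccontr)
  assume not: "\<not> linked T s s'"
  have sep': "\<not> linked S w u" using sep linked_sym by blast
  obtain t where t: "t \<in> T" "linked S u t" using separator_meets[OF S u w sep s not] by blast
  obtain t' where t': "t' \<in> T" "linked S w t'" using separator_meets[OF S w u sep' s not] by blast
  let ?X = "{z. linked S u z}" and ?Y = "{z. linked T s z}"
  have "\<not> linked S u t'" using rtrancl_trans[OF _ linked_sym[OF t'(2)]] sep by blast
  moreover have t'V: "t' \<in> pverts G - S" using linked_closed[OF t'(2) w] .
  ultimately have X': "t' \<in> pverts G - S - ?X" by blast
  have sT: "s \<in> pverts G - T" "s' \<in> pverts G - T" using s S(1) by blast+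
  then have Y': "s' \<in> pverts G - T - ?Y" using not by blast
  have X: "u \<in> ?X" "t \<in> ?X" using t by simp_all
  have Y: "s \<in> ?Y" by simp
  show False
    by (rule no_crossing_separations[OF separation_component[OF S(1) u] S(2)
          separation_component[OF T(1) sT(1)] T(2)])
      (use X X' Y Y' s t t' in blast)+
qed

end

section \<open>Isometries and reflections\<close>

definition hyperplane_reflection :: "'e::euclidean_space \<Rightarrow> real \<Rightarrow> 'e \<Rightarrow> 'e" where
  "hyperplane_reflection g c x = x - (2 * (g \<bullet> x + c) / (g \<bullet> g)) *\<^sub>R g"

lemma hyperplane_reflection_fixes: "g \<bullet> x + c = 0 \<Longrightarrow> hyperplane_reflection g c x = x"
  by (simp add: hyperplane_reflection_def)

text \<open>The change is a multiple of the product of the two signed heights over the hyperplane,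
  so reflecting one point of a pair alters the distance precisely when neither point lies on the
  hyperplane.\<close>

lemma norm_diff_hyperplane_reflection:
  assumes "g \<noteq> 0"
  shows "(norm (x - hyperplane_reflection g c y))\<^sup>2 =
    (norm (x - y))\<^sup>2 + 4 * (g \<bullet> x + c) * (g \<bullet> y + c) / (g \<bullet> g)"
proof -
  define k where "k = 2 * (g \<bullet> y + c) / (g \<bullet> g)"
  have gg: "g \<bullet> g \<noteq> 0" using assms by simp
  then have k: "k * (g \<bullet> g) = 2 * (g \<bullet> y + c)" by (simp add: k_def)
  have sq: "(norm (X + k *\<^sub>R g))\<^sup>2 = (norm X)\<^sup>2 + 2 * k * (g \<bullet> X) + k * (k * (g \<bullet> g))" for X
    by (simp add: power2_norm_eq_inner inner_add_left inner_add_right inner_commute algebra_simps)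
  have "x - hyperplane_reflection g c y = (x - y) + k *\<^sub>R g"
    by (simp add: hyperplane_reflection_def k_def)
  then have "(norm (x - hyperplane_reflection g c y))\<^sup>2 =
      (norm (x - y))\<^sup>2 + (2 * k * (g \<bullet> (x - y)) + k * (k * (g \<bullet> g)))"
    by (simp only: sq add.assoc)
  also have "2 * k * (g \<bullet> (x - y)) + k * (k * (g \<bullet> g)) = 2 * k * (g \<bullet> x + c)"
    unfolding k by (simp add: inner_diff_right algebra_simps)
  also have "2 * k * (g \<bullet> x + c) = 4 * (g \<bullet> x + c) * (g \<bullet> y + c) / (g \<bullet> g)"
  proof -
    have "2 * (2 * B / D) * A = 4 * A * B / D" for A B D :: real by simp
    then show ?thesis unfolding k_def .
  qed
  finally show ?thesis .
qed

lemma hyperplane_reflection_value: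
  assumes "g \<noteq> 0"
  shows "g \<bullet> hyperplane_reflection g c x + c = - (g \<bullet> x + c)"
  using assms by (simp add: hyperplane_reflection_def inner_diff_right field_simps)

lemma hyperplane_reflection_isometry:
  assumes "g \<noteq> 0"
  shows "norm (hyperplane_reflection g c x - hyperplane_reflection g c y) = norm (x - y)"
proof -
  let ?r = "hyperplane_reflection g c"
  have "(norm (?r x - ?r y))\<^sup>2 = (norm (?r x - y))\<^sup>2 + 4 * (g \<bullet> ?r x + c) * (g \<bullet> y + c) / (g \<bullet> g)"
    by (rule norm_diff_hyperplane_reflection[OF assms])
  also have "(norm (?r x - y))\<^sup>2 = (norm (y - x))\<^sup>2 + 4 * (g \<bullet> y + c) * (g \<bullet> x + c) / (g \<bullet> g)"
    using norm_diff_hyperplane_reflection[OF assms, of y c x] by (simp only: norm_minus_commute)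
  also have "\<dots> + 4 * (g \<bullet> ?r x + c) * (g \<bullet> y + c) / (g \<bullet> g) = (norm (y - x))\<^sup>2"
  proof -
    have "m + 4 * B * A / D + 4 * (- A) * B / D = m" for m A B D :: real by (simp add: mult.commute)
    then show ?thesis unfolding hyperplane_reflection_value[OF assms] .
  qed
  finally have "(norm (?r x - ?r y))\<^sup>2 = (norm (y - x))\<^sup>2" .
  then show ?thesis by (simp add: norm_minus_commute power2_eq_iff_nonneg)
qed

lemma reflect_in_hyperplane:
  assumes "g \<noteq> 0"
  shows "reflect_in {x. g \<bullet> x = - c} x = hyperplane_reflection g c x"
proof -
  let ?y = "x - ((g \<bullet> x + c) / (g \<bullet> g)) *\<^sub>R g"
  have "?y = closest_point {x. g \<bullet> x = - c} x"
  proof (rule closest_point_unique[OF convex_hyperplane closed_hyperplane])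
    show "?y \<in> {x. g \<bullet> x = - c}" using assms by (simp add: inner_diff_right)
    show "\<forall>z\<in>{x. g \<bullet> x = - c}. dist x ?y \<le> dist x z"
    proof
      fix z assume z: "z \<in> {x. g \<bullet> x = - c}"
      have "\<bar>g \<bullet> x + c\<bar> = \<bar>g \<bullet> (x - z)\<bar>" using z by (simp add: inner_diff_right)
      also have "\<dots> \<le> norm g * norm (x - z)" by (rule Cauchy_Schwarz_ineq2)
      finally have "\<bar>g \<bullet> x + c\<bar> / norm g \<le> norm (x - z)" using assms by (simp add: field_simps)
      moreover have "dist x ?y = \<bar>g \<bullet> x + c\<bar> / norm g"
      proof -
        have "dist x ?y = \<bar>g \<bullet> x + c\<bar> / (norm g)\<^sup>2 * norm g"
          unfolding power2_norm_eq_inner dist_norm by (simp add: abs_divide)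
        moreover have "A / n\<^sup>2 * n = A / n" if "n \<noteq> 0" for A n :: real
          unfolding power2_eq_square times_divide_eq_left
          using that by (rule nonzero_mult_divide_mult_cancel_right)
        ultimately show ?thesis using assms by (simp only: norm_eq_zero not_False_eq_True simp_thms)
      qed
      ultimately show "dist x ?y \<le> dist x z" by (simp add: dist_norm)
    qed
  qed
  then have "reflect_in {x. g \<bullet> x = - c} x = 2 *\<^sub>R ?y - x" by (simp add: reflect_in_def)
  also have "\<dots> = hyperplane_reflection g c x"
  proof -
    have "2 *\<^sub>R (x - k *\<^sub>R g) - x = x - (2 * k) *\<^sub>R g" for k
      by (simp add: scaleR_diff_right scaleR_2)
    then show ?thesis by (simp only: hyperplane_reflection_def times_divide_eq_right)
  qed
  finally show ?thesis .
qed

section \<open>Points and isometries determined by distances\<close>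

lemma norm_diff_square: "(norm (a - z))\<^sup>2 = a \<bullet> a - 2 * (a \<bullet> z) + z \<bullet> z"
  by (simp add: power2_norm_eq_inner inner_diff_left inner_diff_right inner_commute)

text \<open>Being equidistant from \<open>x\<close> and \<open>y\<close> is an affine condition, so
  it passes from \<open>A\<close> to the whole hyperplane. Hence \<open>x - y\<close> is normal to
  it, and comparing distances to the foot \<open>z0\<close> leaves two positions.\<close>

lemma equidistant_from_hyperplane:
  fixes A :: "'e::euclidean_space set"
  assumes hull: "affine hull A = {x. g \<bullet> x = - c}" and g: "g \<noteq> 0"
    and eq: "\<And>s. s \<in> A \<Longrightarrow> norm (y - s) = norm (x - s)"
  shows "y = x \<or> y = hyperplane_reflection g c x"
proof -
  define k where "k = (x \<bullet> x - y \<bullet> y) / 2"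
  have iff: "norm (y - z) = norm (x - z) \<longleftrightarrow> (x - y) \<bullet> z = k" for z
  proof -
    have "norm (y - z) = norm (x - z) \<longleftrightarrow> (norm (y - z))\<^sup>2 = (norm (x - z))\<^sup>2"
      by (simp add: power2_eq_iff_nonneg)
    also have "\<dots> \<longleftrightarrow> (x - y) \<bullet> z = k"
    proof -
      have "b - 2 * c + d = a - 2 * e + d \<longleftrightarrow> e - c = (a - b) / 2" for a b c d e :: real by auto
      then show ?thesis unfolding norm_diff_square k_def inner_diff_left .
    qed
    finally show ?thesis .
  qed
  have "affine hull A \<subseteq> {z. (x - y) \<bullet> z = k}"
  proof (rule hull_minimal)
    show "A \<subseteq> {z. (x - y) \<bullet> z = k}" using eq unfolding iff by blast
  qed (rule affine_hyperplane)
  then have H: "(x - y) \<bullet> z = k" if "g \<bullet> z = - c" for z using hull that by auto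
  define z0 where "z0 = x - ((g \<bullet> x + c) / (g \<bullet> g)) *\<^sub>R g"
  have gg: "g \<bullet> g \<noteq> 0" using g by simp
  have z0: "g \<bullet> z0 = - c" using gg by (simp add: z0_def inner_diff_right)
  define \<alpha> where "\<alpha> = ((x - y) \<bullet> g) / (g \<bullet> g)"
  define w where "w = (x - y) - \<alpha> *\<^sub>R g"
  have gw: "g \<bullet> w = 0" using gg by (simp add: w_def \<alpha>_def inner_diff_right inner_commute)
  have "(x - y) \<bullet> (z0 + w) = k" using z0 gw by (intro H) (simp add: inner_add_right)
  then have "(x - y) \<bullet> w = 0" using H[OF z0] by (simp add: inner_add_right)
  moreover have "w \<bullet> w = (x - y) \<bullet> w - \<alpha> * (g \<bullet> w)" by (simp add: w_def inner_diff_left)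
  ultimately have "w = 0" using gw by simp
  then have y: "y = x - \<alpha> *\<^sub>R g" by (simp add: w_def algebra_simps)
  define \<beta> where "\<beta> = (g \<bullet> x + c) / (g \<bullet> g)"
  have "norm (y - z0) = norm (x - z0)" using H[OF z0] iff by blast
  then have "\<bar>\<beta> - \<alpha>\<bar> * norm g = \<bar>\<beta>\<bar> * norm g"
  proof -
    have "y - z0 = (\<beta> - \<alpha>) *\<^sub>R g" "x - z0 = \<beta> *\<^sub>R g"
      by (simp_all add: y z0_def \<beta>_def scaleR_diff_left)
    then show ?thesis using \<open>norm (y - z0) = norm (x - z0)\<close> by simp
  qed
  then have "\<bar>\<beta> - \<alpha>\<bar> = \<bar>\<beta>\<bar>" using g by simp
  then have "\<alpha> = 0 \<or> \<alpha> = 2 * \<beta>" by (auto simp: abs_if split: if_splits)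
  then show ?thesis using y by (auto simp: hyperplane_reflection_def \<beta>_def)
qed

text \<open>Points are matched one at a time, each by a reflection in the bisector of its present
  and its intended position; the points already matched are equidistant from both and stay
  fixed.\<close>

lemma isometry_extension:
  fixes p q :: "'a \<Rightarrow> 'e::euclidean_space"
  assumes "finite S" "\<And>s t. s \<in> S \<Longrightarrow> t \<in> S \<Longrightarrow> norm (q s - q t) = norm (p s - p t)"
  shows "\<exists>\<phi>. (\<forall>x y. norm (\<phi> x - \<phi> y) = norm (x - y)) \<and> (\<forall>s\<in>S. \<phi> (q s) = p s)"
  using assms
proof (induction S rule: finite_induct)
  case empty
  show ?case by (intro exI[of _ "\<lambda>x. x"]) simp
next
  case (insert s S)
  then obtain \<phi> where \<phi>: "\<forall>x y. norm (\<phi> x - \<phi> y) = norm (x - y)" "\<forall>s\<in>S. \<phi> (q s) = p s"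
    by blast
  show ?case
  proof (cases "\<phi> (q s) = p s")
    case True
    then show ?thesis using \<phi> by (intro exI[of _ \<phi>]) auto
  next
    case False
    define x where "x = \<phi> (q s)"
    define g where "g = x - p s"
    \<comment> \<open>\<open>g \<bullet> z + c = 0\<close> is the equation of the bisector of
      \<open>x\<close> and \<open>p s\<close>.\<close>
    define c where "c = (p s \<bullet> p s - x \<bullet> x) / 2"
    have g: "g \<noteq> 0" using False by (simp add: g_def x_def)
    have zero: "g \<bullet> p t + c = 0" if t: "t \<in> S" for t
    proof -
      have "norm (x - p t) = norm (\<phi> (q s) - \<phi> (q t))" using \<phi>(2) t by (simp add: x_def)
      also have "\<dots> = norm (p s - p t)" using \<phi>(1) insert.prems[of s t] t by simp
      finally have "(norm (x - p t))\<^sup>2 = (norm (p s - p t))\<^sup>2" by (simp only:)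
      moreover have "a - 2 * e + d = b - 2 * f + d \<Longrightarrow> e - f + (b - a) / 2 = 0" for a b d e f :: real
        by (simp add: field_simps)
      ultimately show ?thesis unfolding norm_diff_square g_def c_def inner_diff_left by blast
    qed
    have swap: "hyperplane_reflection g c x = p s"
    proof -
      have "2 * (g \<bullet> x + c) = g \<bullet> g"
        unfolding g_def c_def inner_diff_left inner_diff_right
        using inner_commute[of x "p s"] by (simp add: field_simps)
      then show ?thesis using g by (simp add: hyperplane_reflection_def g_def)
    qed
    let ?\<psi> = "\<lambda>y. hyperplane_reflection g c (\<phi> y)"
    have "norm (?\<psi> y - ?\<psi> z) = norm (y - z)" for y z
      using hyperplane_reflection_isometry[OF g] \<phi>(1) by simp
    moreover have "?\<psi> (q t) = p t" if "t \<in> insert s S" for t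
      using that swap \<phi>(2) zero hyperplane_reflection_fixes[of g _ c] by (auto simp: x_def)
    ultimately show ?thesis by (intro exI[of _ ?\<psi>] conjI allI ballI)
  qed
qed

lemma aff_dim_isometry_image:
  fixes f :: "'e::euclidean_space \<Rightarrow> 'e"
  assumes "\<And>x y. norm (f x - f y) = norm (x - y)"
  shows "aff_dim (f ` A) = aff_dim A"
proof -
  define h where "h x = f x - f 0" for x
  have iso: "\<forall>x y. dist (h x) (h y) = dist x y" using assms by (simp add: h_def dist_norm)
  then have lin: "linear h" by (intro isometry_linear) (simp_all add: h_def)
  have "inj h"
  proof (rule injI)
    fix x y assume "h x = h y"
    then have "dist (h x) (h y) = 0" by simp
    then show "x = y" unfolding iso[rule_format] by simp
  qed
  have "f ` A = (+) (f 0) ` (h ` A)" by (auto simp: h_def image_image)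
  then show ?thesis
    using aff_dim_injective_linear_image[OF lin \<open>inj h\<close>, of A] by (simp only: aff_dim_translation_eq)
qed

text \<open>Affine functions that are 1 at one vertex of \<open>S\<close> and 0 at the others rule
  out an affine dependence.\<close>

lemma aff_dim_generic:
  fixes p :: "'a \<Rightarrow> real ^ 'n"
  assumes gen: "generic_on V p" and V: "finite V" "CARD('n) + 1 \<le> card V"
    and S: "S \<subseteq> V" "card S = CARD('n)"
  shows "aff_dim (p ` S) = int CARD('n) - 1"
proof -
  have fin: "finite S" using S(1) V(1) finite_subset by blast
  have delta: "\<exists>g c. \<forall>u\<in>S. g \<bullet> p u + c = (if u = s then 1 else 0)" for s
    using generic_interpolation[OF gen V S(1), of "\<lambda>u. if u = s then 1 else 0"] S(2) by simp
  have inj: "inj_on p S"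
  proof (rule inj_onI)
    fix s t assume st: "s \<in> S" "t \<in> S" "p s = p t"
    obtain g c where g: "\<forall>u\<in>S. g \<bullet> p u + c = (if u = s then 1 else 0)" using delta by blast
    have "g \<bullet> p t + c = 1" using bspec[OF g st(1)] st(3) by (simp only: if_True refl)
    then show "s = t" using bspec[OF g st(2)] by (cases "t = s") simp_all
  qed
  have "\<not> affine_dependent (p ` S)"
  proof
    assume "affine_dependent (p ` S)"
    then obtain U v where U: "sum U (p ` S) = 0" "v \<in> p ` S" "U v \<noteq> 0" "(\<Sum>v\<in>p ` S. U v *\<^sub>R v) = 0"
      using affine_dependent_explicit_finite[of "p ` S"] fin by auto
    obtain s where s: "s \<in> S" "v = p s" using U(2) by blast
    obtain g c where g: "\<forall>u\<in>S. g \<bullet> p u + c = (if u = s then 1 else 0)" using delta by blast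
    have 1: "(\<Sum>u\<in>S. U (p u)) = 0" "(\<Sum>u\<in>S. U (p u) *\<^sub>R p u) = 0"
      using U(1,4) unfolding sum.reindex[OF inj] o_def .
    have "(\<Sum>u\<in>S. U (p u) * (g \<bullet> p u + c)) = g \<bullet> (\<Sum>u\<in>S. U (p u) *\<^sub>R p u) + (\<Sum>u\<in>S. U (p u)) * c"
      by (simp add: inner_sum_right distrib_left sum.distrib sum_distrib_right)
    also have "\<dots> = 0" using 1 by simp
    also have "(\<Sum>u\<in>S. U (p u) * (g \<bullet> p u + c)) = (\<Sum>u\<in>S. if u = s then U (p u) else 0)"
      using g by (intro sum.cong) auto
    also have "\<dots> = U v" using s fin by simp
    finally show False using U(3) by simp
  qed
  then have "of_nat (card (p ` S)) = aff_dim (p ` S) + 1" by (rule aff_dim_affine_independent)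
  then show ?thesis using inj S(2) by (simp add: card_image)
qed

lemma aff_dim_hyperplane_form:
  fixes A :: "(real ^ 'n) set"
  assumes "aff_dim A = int CARD('n) - 1"
  obtains g c where "g \<noteq> 0" "affine hull A = {x. g \<bullet> x = - c}"
proof -
  have "aff_dim A = int (DIM(real ^ 'n) - 1)"
    using assms zero_less_card_finite[where 'a = 'n] by (simp add: of_nat_diff)
  from aff_dim_eq_hyperplane[THEN iffD1, OF this]
  obtain a b where "a \<noteq> 0" "affine hull A = {x. a \<bullet> x = b}" by (elim exE conjE)
  then show thesis using that[of a "- b"] by simp
qed

section \<open>Realizations equivalent to a generic one\<close>

context generic_rigid
begin

text \<open>These are the d-separators; by \<open>connectivity\<close> no smaller set
  separates.\<close>

definition tight_separators :: "'a set set" where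
  "tight_separators = {S. S \<subseteq> pverts G \<and> card S = CARD('n) \<and>
     (\<exists>u\<in>pverts G - S. \<exists>w\<in>pverts G - S. \<not> linked S u w)}"

definition unsplit :: "'a set set \<Rightarrow> 'a \<Rightarrow> 'a \<Rightarrow> bool" where
  "unsplit \<S> u v \<longleftrightarrow> (\<forall>S\<in>\<S>. u \<in> S \<or> v \<in> S \<or> linked S u v)"

lemma unsplit_sym: "unsplit \<S> u v \<Longrightarrow> unsplit \<S> v u"
  unfolding unsplit_def using linked_sym by blast

lemma tight_separatorsD:
  assumes "S \<in> tight_separators"
  shows "S \<subseteq> pverts G" "card S = CARD('n)" "finite S"
  using assms pair_finite_verts finite_subset[of S "pverts G"] by (simp_all add: tight_separators_def)

text \<open>Noncrossing in the form used below: a framework with the right distances on unsplit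
  pairs has them inside every d-separator.\<close>

lemma unsplit_tight_separator:
  assumes "\<S> \<subseteq> tight_separators" "S \<in> tight_separators" "s \<in> S" "s' \<in> S"
  shows "unsplit \<S> s s'"
  unfolding unsplit_def
proof (intro ballI)
  fix T assume "T \<in> \<S>"
  then have T: "T \<in> tight_separators" using assms(1) by blast
  obtain u w where u: "u \<in> pverts G - S" and w: "w \<in> pverts G - S" and uw: "\<not> linked S u w"
    using assms(2) unfolding tight_separators_def by blast
  show "s \<in> T \<or> s' \<in> T \<or> linked T s s'"
    using separators_do_not_cross[OF tight_separatorsD(1,2)[OF assms(2)] u w uw tight_separatorsD(1,2)[OF T], of s s']
      assms(3,4) by blast
qed

text \<open>Suppose \<open>T\<close> splits \<open>u\<close> from \<open>s\<close>. The vertices of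
  \<open>S\<close> outside \<open>T\<close> lie in one component with \<open>s\<close>, so the
  component of \<open>u\<close> in \<open>G - T\<close> misses \<open>S\<close>. It contains
  \<open>v\<close> or, if \<open>v\<close> is in \<open>T\<close>, a neighbour of \<open>v\<close>;
  either way \<open>u\<close> and \<open>v\<close> are linked outside \<open>S\<close>.\<close>

lemma split_only_by:
  assumes \<S>: "\<S> \<subseteq> tight_separators" and S: "S \<in> tight_separators" "S \<notin> \<S>"
    and u: "u \<in> pverts G - S" and v: "v \<in> pverts G - S" and sep: "\<not> linked S u v"
    and uns: "unsplit \<S> u v" and s: "s \<in> S"
  shows "unsplit (insert S \<S>) u s"
  unfolding unsplit_def
proof (intro ballI, rule ccontr)
  fix T assume T: "T \<in> insert S \<S>" and not: "\<not> (u \<in> T \<or> s \<in> T \<or> linked T u s)"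
  have TS: "T \<noteq> S" using not s by blast
  then have T': "T \<in> \<S>" "T \<in> tight_separators" using T \<S> by blast+
  have avoid: "z \<notin> S" if z: "linked T u z" for z
  proof
    assume "z \<in> S"
    then have "unsplit \<S> z s" using unsplit_tight_separator[OF \<S> S(1)] s by blast
    moreover have "z \<notin> T" using linked_closed[OF z] u not by blast
    ultimately have "linked T z s" using T'(1) not unfolding unsplit_def by blast
    with z have "linked T u s" by (rule rtrancl_trans)
    then show False using not by blast
  qed
  have into: "linked S u z" if "linked T u z" for z
    using that avoid by (rule linked_subset_component)
  show False
  proof (cases "v \<in> T")
    case True
    have "s \<in> pverts G - T" using s not tight_separatorsD(1)[OF S(1)] by blast
    moreover have "u \<in> pverts G - T" using u not by blast
    moreover have "\<not> linked T u s" using not by blast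
    ultimately obtain x where x: "linked T u x" "(x, v) \<in> parcs G"
      using separator_adjacent[OF tight_separatorsD(1,2)[OF T'(2)] _ _ _ True] by blast
    have "linked S u v" using linked_step[OF into[OF x(1)] x(2) avoid[OF x(1)]] v by blast
    then show False using sep by blast
  next
    case False
    then have "linked T u v" using uns T'(1) not unfolding unsplit_def by blast
    then show False using into sep by blast
  qed
qed

text \<open>A partial reflection moves the complement of its fragment. To move exactly a union
  \<open>M\<close> of components, the fragment has to be the rest of \<open>G - S\<close>.\<close>

lemma fragment_of_component_union:
  assumes S: "S \<in> tight_separators" and M: "M \<subseteq> pverts G - S" "M \<noteq> {}" "pverts G - S - M \<noteq> {}"
    and closed: "\<And>a b. a \<in> M \<Longrightarrow> linked S a b \<Longrightarrow> b \<in> M"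
  shows "nbhd G (pverts G - S - M) = S" "frag_compl G (pverts G - S - M) = M"
    "fragment CARD('n) G (pverts G - S - M)"
proof -
  let ?X = "pverts G - S - M"
  note Sd = tight_separatorsD[OF S]
  obtain x w where x: "x \<in> ?X" and w: "w \<in> M" using M by blast
  have nl: "\<not> linked S x w"
  proof
    assume "linked S x w"
    then have "x \<in> M" by (rule closed[OF w linked_sym])
    then show False using x by blast
  qed
  have xS: "x \<in> pverts G - S" and wS: "w \<in> pverts G - S" using x w M(1) by blast+
  have adj: "\<exists>y. linked S x y \<and> (y, s) \<in> parcs G" if "s \<in> S" for s
    by (rule separator_adjacent[OF Sd(1,2) xS wS nl that])
  have step: "b \<notin> M" if ab: "a \<in> ?X" "(a, b) \<in> parcs G" for a b
  proof
    assume b: "b \<in> M"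
    have "linked S b a"
      by (rule linked_step[OF rtrancl.rtrancl_refl arcs_symmetric[OF ab(2)]]) (use ab(1) b M(1) in blast)+
    then have "a \<in> M" by (rule closed[OF b])
    then show False using ab(1) by blast
  qed
  show nb: "nbhd G ?X = S"
  proof
    show "nbhd G ?X \<subseteq> S"
    proof
      fix z assume "z \<in> nbhd G ?X"
      then obtain a where a: "a \<in> ?X" "(a, z) \<in> parcs G" and z: "z \<in> pverts G" "z \<notin> ?X"
        unfolding nbhd_def by blast
      then show "z \<in> S" using step[OF a] by blast
    qed
    show "S \<subseteq> nbhd G ?X"
    proof
      fix s assume s: "s \<in> S"
      from adj[OF s] obtain y where y: "linked S x y" "(y, s) \<in> parcs G" by (elim exE conjE)
      have "y \<in> pverts G - S" by (rule linked_closed[OF y(1) xS])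
      moreover have "y \<notin> M"
      proof
        assume "y \<in> M"
        then have "x \<in> M" using linked_sym[OF y(1)] by (rule closed)
        then show False using x by blast
      qed
      ultimately have yX: "y \<in> ?X" by blast
      have "s \<in> pverts G - ?X" using s Sd(1) by blast
      then show "s \<in> nbhd G ?X" unfolding nbhd_def using yX y(2) by (intro CollectI conjI bexI[of _ y])
    qed
  qed
  show compl: "frag_compl G ?X = M" unfolding frag_compl_def nb using M(1) by blast
  have "?X \<subseteq> pverts G" by blast
  then show "fragment CARD('n) G ?X" unfolding fragment_def nb compl using M(2,3) Sd(2) by (intro conjI)
qed

text \<open>Each step aligns \<open>q\<close> with \<open>p'\<close> on \<open>S\<close> and repairs
  the pairs that only \<open>S\<close> splits, so that \<open>S\<close> drops out of the hypothesis
  on distances. The framework \<open>p'\<close> is arbitrary because it changes along the induction;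
  the two properties assumed of it survive a step.\<close>

lemma realization_by_reflections:
  fixes p' q :: "'a \<Rightarrow> real ^ 'n"
  assumes "finite \<S>" "\<S> \<subseteq> tight_separators" "\<And>S. S \<in> \<S> \<Longrightarrow> aff_dim (p' ` S) = int CARD('n) - 1"
    and "\<And>u v. u \<in> pverts G \<Longrightarrow> v \<in> pverts G \<Longrightarrow> unsplit \<S> u v \<Longrightarrow> norm (p' u - p' v) = norm (q u - q v)"
  shows "\<exists>Xs. (\<forall>X\<in>set Xs. fragment CARD('n) G X \<and> nbhd G X \<in> \<S>) \<and> distinct (map (nbhd G) Xs) \<and>
    congruent_fw G q (apply_reflections G Xs p')"
  using assms
proof (induction \<S> arbitrary: p' rule: finite_induct)
  case empty
  have "congruent_fw G q p'"
    unfolding congruent_fw_def using empty.prems(3) by (simp add: unsplit_def)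
  then show ?case by (intro exI[of _ "[]"]) (simp add: apply_reflections_def)
next
  case (insert S \<S>)
  have S: "S \<in> tight_separators" and \<S>: "\<S> \<subseteq> tight_separators" using insert.prems(1) by blast+
  note Sd = tight_separatorsD[OF S]
  have iso: "norm (q s - q t) = norm (p' s - p' t)" if st: "s \<in> S" "t \<in> S" for s t
  proof -
    have "s \<in> pverts G" "t \<in> pverts G" using st Sd(1) by blast+
    then have "norm (p' s - p' t) = norm (q s - q t)"
      using unsplit_tight_separator[OF insert.prems(1) S st] by (rule insert.prems(3))
    then show ?thesis by (rule sym)
  qed
  have "\<exists>\<phi>. (\<forall>x y. norm (\<phi> x - \<phi> y) = norm (x - y)) \<and> (\<forall>s\<in>S. \<phi> (q s) = p' s)"
    by (rule isometry_extension[OF Sd(3)]) (rule iso)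
  then obtain \<phi> where
    \<phi>: "\<forall>x y. norm (\<phi> x - \<phi> y) = norm (x - y)" "\<forall>s\<in>S. \<phi> (q s) = p' s"
    by (elim exE conjE)
  define q' where "q' z = \<phi> (q z)" for z
  have q': "norm (q' u - q' v) = norm (q u - q v)" for u v
    unfolding q'_def by (rule \<phi>(1)[rule_format])
  have q'S: "q' s = p' s" if "s \<in> S" for s unfolding q'_def using \<phi>(2) that by (rule bspec)
  obtain g c where g: "g \<noteq> 0" and hull: "affine hull (p' ` S) = {x. g \<bullet> x = - c}"
    by (rule aff_dim_hyperplane_form[OF insert.prems(2)[OF insertI1]])
  define r where "r = hyperplane_reflection g c"
  have r_iso: "norm (r x - r y) = norm (x - y)" for x y
    unfolding r_def by (rule hyperplane_reflection_isometry[OF g])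
  have r_fix: "r (p' s) = p' s" if "s \<in> S" for s
  proof -
    have "p' s \<in> affine hull (p' ` S)" using that by (intro hull_inc imageI)
    then show ?thesis unfolding hull r_def by (intro hyperplane_reflection_fixes) simp
  qed
  \<comment> \<open>The distances from these vertices to all of \<open>S\<close> are known. By
    \<open>split_only_by\<close>, every pair that still needs repair consists of such
    vertices.\<close>
  define U where "U = {u \<in> pverts G - S. \<forall>s\<in>S. unsplit (insert S \<S>) u s}"
  have U_dich: "q' u = p' u \<or> q' u = r (p' u)" if u: "u \<in> U" for u
    unfolding r_def
  proof (rule equidistant_from_hyperplane[OF hull g])
    fix x assume "x \<in> p' ` S"
    then obtain s where s: "s \<in> S" "x = p' s" by blast
    have "norm (p' u - p' s) = norm (q u - q s)"
    proof (rule insert.prems(3))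
      show "u \<in> pverts G" "s \<in> pverts G" "unsplit (insert S \<S>) u s"
        using u s(1) Sd(1) unfolding U_def by blast+
    qed
    then show "norm (q' u - x) = norm (p' u - x)" using q'[of u s] q'S[OF s(1)] s(2) by simp
  qed
  \<comment> \<open>The components of \<open>G - S\<close> containing a misplaced vertex of
    \<open>U\<close>; each is reflected as a whole.\<close>
  define M where "M = {z \<in> pverts G - S. \<exists>u\<in>U. linked S z u \<and> q' u \<noteq> p' u}"
  have M_closed: "b \<in> M" if aM: "a \<in> M" and ab: "linked S a b" for a b
  proof -
    obtain u where u: "u \<in> U" "linked S a u" "q' u \<noteq> p' u" and a: "a \<in> pverts G - S"
      using aM unfolding M_def by blast
    have "linked S b u" using linked_sym[OF ab] u(2) by (rule rtrancl_trans)
    then show ?thesis using u linked_closed[OF ab a] unfolding M_def by blast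
  qed
  have M_iff: "a \<in> M \<longleftrightarrow> b \<in> M" if "linked S a b" for a b
    using M_closed[OF _ that] M_closed[OF _ linked_sym[OF that]] by (rule iffI)
  define p2 where "p2 z = (if z \<in> M then r (p' z) else p' z)" for z
  \<comment> \<open>A separator \<open>T\<close> other than \<open>S\<close> has the same size and
    so misses some \<open>s\<close> in \<open>S\<close>. Outside \<open>T\<close> both vertices are
    linked to \<open>s\<close>.\<close>
  have U_unsplit: "unsplit (insert S \<S>) u u'" if u: "u \<in> U" "u' \<in> U" "linked S u u'" for u u'
    unfolding unsplit_def
  proof
    fix T assume T: "T \<in> insert S \<S>"
    show "u \<in> T \<or> u' \<in> T \<or> linked T u u'"
    proof (cases "T = S")
      case True
      then show ?thesis using u(3) by blast
    next
      case False
      have "T \<in> tight_separators" using T insert.prems(1) by blast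
      then have "finite T" "card T = card S" using tight_separatorsD Sd(2) by simp_all
      then have "\<not> S \<subseteq> T" using False card_subset_eq[of T S] by auto
      then obtain s where s: "s \<in> S" "s \<notin> T" by blast
      have *: "u \<in> T \<or> s \<in> T \<or> linked T u s" "u' \<in> T \<or> s \<in> T \<or> linked T u' s"
        using u(1,2) s(1) T unfolding U_def unsplit_def by blast+
      show ?thesis
      proof (cases "u \<in> T \<or> u' \<in> T")
        case False
        then have "linked T u s" "linked T s u'" using * s(2) linked_sym by blast+
        then have "linked T u u'" by (rule rtrancl_trans)
        then show ?thesis by blast
      qed blast
    qed
  qed
  have U_p2: "p2 u = q' u" if u: "u \<in> U" for u
  proof (cases "u \<in> M")
    case True
    then obtain u' where u': "u' \<in> U" "linked S u u'" "q' u' \<noteq> p' u'" unfolding M_def by blast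
    have eq: "q' u' = r (p' u')" using U_dich[OF u'(1)] u'(3) by blast
    have "r (p' u) = q' u"
    proof (cases "q' u = p' u")
      case True
      \<comment> \<open>Here \<open>u\<close> is already in place although its component is
        reflected because of \<open>u'\<close>. Their distance is the same with \<open>u'\<close>
        replaced by its mirror image, and the misplaced \<open>u'\<close> is off the hyperplane; so
        \<open>u\<close> lies on it and is fixed.\<close>
      have "norm (p' u - p' u') = norm (q' u - q' u')"
        unfolding q'
      proof (rule insert.prems(3))
        show "u \<in> pverts G" "u' \<in> pverts G" using u u'(1) unfolding U_def by blast+
      qed (rule U_unsplit[OF u u'(1,2)])
      then have "(norm (p' u - r (p' u')))\<^sup>2 = (norm (p' u - p' u'))\<^sup>2" using True eq by simp
      then have "4 * (g \<bullet> p' u + c) * (g \<bullet> p' u' + c) / (g \<bullet> g) = 0"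
        using norm_diff_hyperplane_reflection[OF g, of "p' u" c "p' u'"] unfolding r_def by simp
      moreover have "4 * A * B / D = 0 \<Longrightarrow> D \<noteq> 0 \<Longrightarrow> A = 0 \<or> B = 0" for A B D :: real by simp
      ultimately have "g \<bullet> p' u + c = 0 \<or> g \<bullet> p' u' + c = 0" using g inner_eq_zero_iff by blast
      moreover have "g \<bullet> p' u' + c \<noteq> 0"
        using u'(3) eq hyperplane_reflection_fixes[of g "p' u'" c] unfolding r_def by auto
      ultimately show ?thesis using hyperplane_reflection_fixes[of g "p' u" c] True unfolding r_def by simp
    next
      case False
      then show ?thesis using U_dich[OF u] by simp
    qed
    then show ?thesis using True by (simp add: p2_def)
  next
    case False
    have "u \<in> pverts G - S" using u unfolding U_def by blast
    then have "q' u = p' u" using False u unfolding M_def by blast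
    then show ?thesis using False by (simp add: p2_def)
  qed
  have M_S: "z \<notin> M" if "z \<in> S" for z using that unfolding M_def by blast
  have p2_dist: "norm (p2 u - p2 v) = norm (p' u - p' v)" if uSv: "u \<in> S \<or> v \<in> S \<or> linked S u v" for u v
  proof -
    consider "u \<in> S" | "v \<in> S" | "u \<in> M \<longleftrightarrow> v \<in> M" using uSv M_iff[of u v] by blast
    then show ?thesis
    proof cases
      case 1
      then show ?thesis using M_S[OF 1] r_fix[OF 1] r_iso[of "p' u" "p' v"] by (simp add: p2_def)
    next
      case 2
      then show ?thesis using M_S[OF 2] r_fix[OF 2] r_iso[of "p' u" "p' v"] by (simp add: p2_def)
    next
      case 3
      then show ?thesis by (simp add: p2_def r_iso)
    qed
  qed
  have p2_q: "norm (p2 u - p2 v) = norm (q u - q v)"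
    if u: "u \<in> pverts G" and v: "v \<in> pverts G" and uv: "unsplit \<S> u v" for u v
  proof (cases "u \<in> S \<or> v \<in> S \<or> linked S u v")
    case True
    then have "unsplit (insert S \<S>) u v" using uv unfolding unsplit_def by blast
    then show ?thesis using p2_dist[OF True] insert.prems(3)[OF u v] by simp
  next
    case False
    then have u': "u \<in> pverts G - S" and v': "v \<in> pverts G - S" and n: "\<not> linked S u v" "\<not> linked S v u"
      using u v linked_sym by blast+
    have "u \<in> U" using split_only_by[OF \<S> S insert.hyps(2) u' v' n(1) uv] u' unfolding U_def by blast
    moreover have "v \<in> U"
      using split_only_by[OF \<S> S insert.hyps(2) v' u' n(2) unsplit_sym[OF uv]] v' unfolding U_def by blast
    ultimately show ?thesis using U_p2 q' by simp
  qed
  \<comment> \<open>By noncrossing, \<open>T - S\<close> lies in one component of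
    \<open>G - S\<close>, so \<open>T\<close> is moved as a whole by the identity or by
    \<open>r\<close>.\<close>
  have p2_aff: "aff_dim (p2 ` T) = int CARD('n) - 1" if T: "T \<in> \<S>" for T
  proof -
    have T': "T \<in> tight_separators" using T \<S> by blast
    have same: "t \<in> M \<longleftrightarrow> t' \<in> M" if "t \<in> T - S" "t' \<in> T - S" for t t'
    proof (rule M_iff)
      have "unsplit (insert S \<S>) t t'" using that by (intro unsplit_tight_separator[OF insert.prems(1) T']) blast+
      then have "t \<in> S \<or> t' \<in> S \<or> linked S t t'" unfolding unsplit_def by (rule bspec) simp
      then show "linked S t t'" using that by blast
    qed
    have "p2 ` T = p' ` T \<or> p2 ` T = r ` (p' ` T)"
    proof (cases "T \<inter> M = {}")
      case True
      have "p2 ` T = p' ` T" using True by (intro image_cong) (auto simp: p2_def)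
      then show ?thesis by blast
    next
      case False
      then obtain t where t: "t \<in> T" "t \<in> M" by blast
      have "p2 z = r (p' z)" if "z \<in> T" for z
      proof (cases "z \<in> S")
        case True
        then show ?thesis using M_S r_fix by (simp add: p2_def)
      next
        case False
        have "t \<in> T - S" "z \<in> T - S" using t M_S False that by blast+
        then have "z \<in> M" using same t(2) by blast
        then show ?thesis by (simp add: p2_def)
      qed
      then have "p2 ` T = r ` (p' ` T)" by (simp add: image_image)
      then show ?thesis by blast
    qed
    moreover have "aff_dim (r ` (p' ` T)) = aff_dim (p' ` T)" by (rule aff_dim_isometry_image[OF r_iso])
    moreover have "aff_dim (p' ` T) = int CARD('n) - 1" using T by (intro insert.prems(2)) simp
    ultimately show ?thesis by auto
  qed
  show ?case
  proof (cases "M = {} \<or> pverts G - S - M = {}")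
    case True
    \<comment> \<open>With nothing or everything reflected, \<open>p2\<close> is congruent to
      \<open>p'\<close>. A fragment would have an empty side, so \<open>S\<close> contributes no
      reflection.\<close>
    have p'_q: "norm (p' u - p' v) = norm (q u - q v)"
      if u: "u \<in> pverts G" and v: "v \<in> pverts G" and uv: "unsplit \<S> u v" for u v
    proof -
      have "u \<in> S \<or> v \<in> S \<or> (u \<in> M \<longleftrightarrow> v \<in> M)" using True u v by blast
      then have "norm (p2 u - p2 v) = norm (p' u - p' v)"
      proof (elim disjE)
        assume "u \<in> M \<longleftrightarrow> v \<in> M"
        then show ?thesis by (simp add: p2_def r_iso)
      qed (simp_all add: p2_dist)
      then show ?thesis using p2_q[OF u v uv] by simp
    qed
    have "\<exists>Xs. (\<forall>X\<in>set Xs. fragment CARD('n) G X \<and> nbhd G X \<in> \<S>) \<and> distinct (map (nbhd G) Xs) \<and>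
        congruent_fw G q (apply_reflections G Xs p')"
    proof (rule insert.IH[OF \<S>])
      show "aff_dim (p' ` T) = int CARD('n) - 1" if "T \<in> \<S>" for T
        by (rule insert.prems(2)[OF insertI2[OF that]])
    qed (rule p'_q)
    then obtain Xs where Xs: "\<forall>X\<in>set Xs. fragment CARD('n) G X \<and> nbhd G X \<in> \<S>"
        "distinct (map (nbhd G) Xs)" "congruent_fw G q (apply_reflections G Xs p')" by (elim exE conjE)
    have "\<forall>X\<in>set Xs. fragment CARD('n) G X \<and> nbhd G X \<in> insert S \<S>" using Xs(1) by simp
    then show ?thesis using Xs(2,3) by (intro exI[of _ Xs] conjI)
  next
    case False
    let ?X = "pverts G - S - M"
    have MS: "M \<subseteq> pverts G - S" unfolding M_def by blast
    have M1: "M \<noteq> {}" and M2: "?X \<noteq> {}" using False by blast+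
    note frag = fragment_of_component_union[OF S MS M1 M2]
    have X1: "nbhd G ?X = S" by (rule frag(1)) (rule M_closed)
    have X2: "frag_compl G ?X = M" by (rule frag(2)) (rule M_closed)
    have X3: "fragment CARD('n) G ?X" by (rule frag(3)) (rule M_closed)
    note X = X1 X2 X3
    have refl: "partial_reflection G ?X p' = p2"
    proof
      fix z
      show "partial_reflection G ?X p' z = p2 z"
        unfolding partial_reflection_def X(1,2) hull reflect_in_hyperplane[OF g] p2_def r_def ..
    qed
    have "\<exists>Xs. (\<forall>X\<in>set Xs. fragment CARD('n) G X \<and> nbhd G X \<in> \<S>) \<and> distinct (map (nbhd G) Xs) \<and>
        congruent_fw G q (apply_reflections G Xs p2)"
    proof (rule insert.IH[OF \<S>])
      show "aff_dim (p2 ` T) = int CARD('n) - 1" if "T \<in> \<S>" for T using that by (rule p2_aff)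
    qed (rule p2_q)
    then obtain Xs where Xs: "\<forall>X\<in>set Xs. fragment CARD('n) G X \<and> nbhd G X \<in> \<S>"
        "distinct (map (nbhd G) Xs)" "congruent_fw G q (apply_reflections G Xs p2)" by (elim exE conjE)
    have notin: "S \<notin> nbhd G ` set Xs"
    proof
      assume "S \<in> nbhd G ` set Xs"
      then obtain X where "X \<in> set Xs" "S = nbhd G X" by (rule imageE)
      then show False using Xs(1) insert.hyps(2) by blast
    qed
    have app: "apply_reflections G (?X # Xs) p' = apply_reflections G Xs p2"
      by (simp only: apply_reflections_def fold_simps refl)
    show ?thesis
    proof (intro exI[of _ "?X # Xs"] conjI)
      show "\<forall>Y\<in>set (?X # Xs). fragment CARD('n) G Y \<and> nbhd G Y \<in> insert S \<S>"
      proof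
        fix Y assume "Y \<in> set (?X # Xs)"
        then have "Y = ?X \<or> Y \<in> set Xs" by (simp only: list.set insert_iff)
        then show "fragment CARD('n) G Y \<and> nbhd G Y \<in> insert S \<S>"
        proof
          assume Y: "Y = ?X"
          show ?thesis unfolding Y X(1) using X(3) insertI1 by (rule conjI)
        next
          assume "Y \<in> set Xs"
          then show ?thesis using Xs(1) by blast
        qed
      qed
      have "distinct (S # map (nbhd G) Xs)" using Xs(2) notin by simp
      then show "distinct (map (nbhd G) (?X # Xs))" unfolding list.map X(1) .
      show "congruent_fw G q (apply_reflections G (?X # Xs) p')" unfolding app by (rule Xs(3))
    qed
  qed
qed

end

section \<open>Local connectivity\<close>

lemma vwalk_arcs_subset_iff:
  "set (vwalk_arcs xs) \<subseteq> E \<longleftrightarrow> successively (\<lambda>a b. (a, b) \<in> E) xs"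
  by (induction xs rule: induct_list012) auto

lemma path_in_avoids:
  assumes "successively (\<lambda>a b. (a, b) \<in> avoiding E S) xs" "xs \<noteq> [] \<Longrightarrow> hd xs \<notin> S"
  shows "set xs \<inter> S = {}"
  using assms by (induction xs rule: induct_list012) (auto simp: avoiding_def)

context pair_graph
begin

text \<open>A walk from \<open>u\<close> to \<open>v\<close> contains a stretch from a neighbour of
  \<open>u\<close> to a neighbour of \<open>v\<close> that meets neither. The induction follows the
  walk and starts afresh whenever it returns to \<open>u\<close>; \<open>done\<close> records that a
  stretch has been found.\<close>

lemma linked_imp_arc_walk:
  assumes z: "linked S u z" and uv: "u \<noteq> v" "(u, v) \<notin> parcs G" and S: "W \<inter> pverts G - {u, v} \<subseteq> S"
  defines "R \<equiv> (avoiding (avoiding (parcs G) {u, v}) W)\<^sup>*"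
  defines "done \<equiv> \<exists>a b. (u, a) \<in> parcs G \<and> (v, b) \<in> parcs G \<and> a \<notin> W \<and> b \<notin> W \<and> (a, b) \<in> R"
  shows "done \<or> z = u \<or> z \<noteq> u \<and> z \<noteq> v \<and> z \<notin> W \<and> (\<exists>a. (u, a) \<in> parcs G \<and> a \<notin> W \<and> (a, z) \<in> R)"
  using z
proof (induction rule: rtrancl_induct)
  case (step y z)
  then have yz: "(y, z) \<in> parcs G" and nS: "y \<notin> S" "z \<notin> S" by (auto simp: avoiding_def)
  have zW: "z \<notin> W" if "z \<noteq> u" "z \<noteq> v" using S nS(2) in_arcsD2[OF yz] that by blast
  show ?case
  proof (cases "done \<or> z = u")
    case True
    then show ?thesis by blast
  next
    case nd: False
    show ?thesis
    proof (cases "y = u")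
      case True
      then have "z \<noteq> v" using yz uv by blast
      then have "z \<notin> W" using zW nd by blast
      moreover have "(z, z) \<in> R" by (simp add: R_def)
      ultimately show ?thesis using nd \<open>z \<noteq> v\<close> yz True by blast
    next
      case False
      then obtain a where y: "y \<noteq> v" "y \<notin> W" and a: "(u, a) \<in> parcs G" "a \<notin> W" "(a, y) \<in> R"
        using step.IH nd by blast
      have "z \<noteq> v"
      proof
        assume "z = v"
        then have "(v, y) \<in> parcs G" using arcs_symmetric[OF yz] by simp
        then have "done" unfolding done_def using a y by blast
        then show False using nd by blast
      qed
      then have "z \<notin> W" using zW nd by blast
      then have "(y, z) \<in> avoiding (avoiding (parcs G) {u, v}) W"
        using yz False y nd \<open>z \<noteq> v\<close> by (auto simp: avoiding_def)
      then have "(a, z) \<in> R" using a(3) unfolding R_def by (rule rtrancl_into_rtrancl[rotated])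
      then show ?thesis using nd \<open>z \<noteq> v\<close> \<open>z \<notin> W\<close> a by blast
    qed
  qed
qed simp

text \<open>Menger's theorem is applied to the neighbours of \<open>u\<close> and of
  \<open>v\<close> in the graph without these two vertices, and the paths are extended by both ends.
  Nonadjacency keeps \<open>u\<close> and \<open>v\<close> out of the neighbour sets.\<close>

lemma kappa_ge:
  assumes u: "u \<in> pverts G" and v: "v \<in> pverts G" and uv: "u \<noteq> v" "(u, v) \<notin> parcs G"
    and conn: "\<And>S. S \<subseteq> pverts G - {u, v} \<Longrightarrow> card S < k \<Longrightarrow> linked S u v"
  shows "k \<le> kappa G u v"
proof -
  let ?E = "avoiding (parcs G) {u, v}"
  let ?A = "{a. (u, a) \<in> parcs G}" and ?B = "{b. (v, b) \<in> parcs G}"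
  have "?A \<subseteq> pverts G" "?B \<subseteq> pverts G" using in_arcsD2 by blast+
  then have fin: "finite ?A" "finite ?B" using pair_finite_verts finite_subset by blast+
  have "finite ?E" using finite_subset[OF _ pair_finite_arcs, of ?E] by (auto simp: avoiding_def)
  moreover have "k \<le> card W" if W: "finite W" "separates ?E ?A ?B W" for W
  proof (rule ccontr)
    assume "\<not> k \<le> card W"
    \<comment> \<open>\<open>W\<close> may contain \<open>u\<close>, \<open>v\<close> or elements
      that are not vertices; dropping them gives a set to which \<open>conn\<close> applies.\<close>
    moreover have "card (W \<inter> pverts G - {u, v}) \<le> card W" using W(1) by (intro card_mono) auto
    ultimately have "linked (W \<inter> pverts G - {u, v}) u v" by (intro conn) auto
    from linked_imp_arc_walk[OF this uv subset_refl] uv(1)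
    obtain a b where "(u, a) \<in> parcs G" "(v, b) \<in> parcs G" "a \<notin> W" "b \<notin> W" "(a, b) \<in> (avoiding ?E W)\<^sup>*"
      by blast
    then show False using W(2) unfolding separates_def by blast
  qed
  ultimately have "\<exists>P. card P = k \<and> finite P \<and> (\<forall>xs\<in>P. path_in ?E xs \<and> hd xs \<in> ?A \<and> last xs \<in> ?B) \<and>
      pairwise (\<lambda>xs ys. set xs \<inter> set ys = {}) P"
    using fin by (intro Menger)
  then obtain P where P: "card P = k" "\<forall>xs\<in>P. path_in ?E xs \<and> hd xs \<in> ?A \<and> last xs \<in> ?B"
      "pairwise (\<lambda>xs ys. set xs \<inter> set ys = {}) P" by (elim exE conjE)
  define h where "h xs = u # xs @ [v]" for xs
  have path: "h xs \<in> paths_between G u v" if xs: "xs \<in> P" for xs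
  proof -
    have ne: "xs \<noteq> []" and dist: "distinct xs" and succ: "successively (\<lambda>a b. (a, b) \<in> ?E) xs"
      and ends: "(u, hd xs) \<in> parcs G" "(v, last xs) \<in> parcs G"
      using bspec[OF P(2) xs] by (simp_all add: path_in_def)
    have "hd xs \<noteq> u" using pair_no_loops[OF ends(1)] by auto
    moreover have "hd xs \<noteq> v" using ends(1) uv by blast
    ultimately have "set xs \<inter> {u, v} = {}" by (intro path_in_avoids[OF succ]) simp
    moreover have succ': "successively (\<lambda>a b. (a, b) \<in> parcs G) xs"
      using succ by (rule successively_mono) (auto simp: avoiding_def)
    moreover have "set xs \<subseteq> pverts G"
    proof -
      have "set ys \<subseteq> pverts G" if "successively (\<lambda>a b. (a, b) \<in> parcs G) ys" "ys \<noteq> [] \<Longrightarrow> hd ys \<in> pverts G" for ys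
        using that by (induction ys rule: induct_list012) (auto dest: in_arcsD2)
      then show ?thesis using succ' in_arcsD2[OF ends(1)] by blast
    qed
    moreover have "successively (\<lambda>a b. (a, b) \<in> parcs G) (h xs)"
      using succ' ends(1) arcs_symmetric[OF ends(2)] ne
      by (simp add: h_def successively_Cons successively_append_iff)
    ultimately show ?thesis
      using u v uv(1) dist
      by (auto simp: paths_between_def vpath_def vwalk_def h_def vwalk_arcs_subset_iff)
  qed
  have inj: "inj_on h P" by (auto simp: inj_on_def h_def)
  have "pairwise (\<lambda>xs ys. set xs \<inter> set ys \<subseteq> {u, v}) (h ` P)"
  proof (rule pairwiseI)
    fix xs ys assume "xs \<in> h ` P" "ys \<in> h ` P" "xs \<noteq> ys"
    then obtain xs' ys' where x: "xs' \<in> P" "ys' \<in> P" "xs = h xs'" "ys = h ys'" "xs' \<noteq> ys'" by blast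
    have "set xs' \<inter> set ys' = {}" using pairwiseD[OF P(3) x(1,2,5)] .
    then show "set xs \<inter> set ys \<subseteq> {u, v}" using x(3,4) by (auto simp: h_def)
  qed
  moreover have "h ` P \<subseteq> paths_between G u v" using path by blast
  moreover have "card (h ` P) = k" using inj P(1) by (simp only: card_image)
  ultimately have "k \<in> {card Q |Q. Q \<subseteq> paths_between G u v \<and>
      pairwise (\<lambda>xs ys. set xs \<inter> set ys \<subseteq> {u, v}) Q}" by blast
  then show ?thesis
    unfolding kappa_def by (rule Max_ge[OF finite_disjoint_path_counts(1)[OF pair_graph]])
qed

section \<open>Fragments, disjoint paths and components\<close>

lemma walk_crosses_nbhd:
  assumes "successively (\<lambda>a b. (a, b) \<in> parcs G) xs" "xs \<noteq> []" "hd xs \<in> X" "last xs \<notin> X"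
  shows "\<exists>z\<in>set xs. z \<in> nbhd G X"
  using assms
proof (induction xs rule: induct_list012)
  case (3 a b xs)
  show ?case
  proof (cases "b \<in> X")
    case True
    then show ?thesis using 3 by auto
  next
    case False
    then have "b \<in> nbhd G X" using 3 in_arcsD2[of a b] by (auto simp: nbhd_def)
    then show ?thesis by auto
  qed
qed auto

text \<open>The easy half of Menger: each path meets the neighbour set, and since neither
  \<open>u\<close> nor \<open>v\<close> lies in it, disjointness makes the chosen meeting points
  distinct.\<close>

lemma kappa_le_fragment:
  assumes frag: "fragment d G X" and uv: "u \<in> X \<and> v \<in> frag_compl G X \<or> v \<in> X \<and> u \<in> frag_compl G X"
  shows "kappa G u v \<le> d"
proof -
  let ?C = "{card Q |Q. Q \<subseteq> paths_between G u v \<and> pairwise (\<lambda>xs ys. set xs \<inter> set ys \<subseteq> {u, v}) Q}"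
  have "kappa G u v \<in> ?C"
    unfolding kappa_def by (rule Max_in[OF finite_disjoint_path_counts[OF pair_graph]])
  then obtain Q where Q: "kappa G u v = card Q" "Q \<subseteq> paths_between G u v"
      "pairwise (\<lambda>xs ys. set xs \<inter> set ys \<subseteq> {u, v}) Q" by blast
  have uv': "u \<notin> nbhd G X" "v \<notin> nbhd G X" and sides: "u \<in> X \<and> v \<notin> X \<or> v \<in> X \<and> u \<notin> X"
    using uv by (auto simp: nbhd_def frag_compl_def)
  have "\<exists>z\<in>set xs. z \<in> nbhd G X" if xs: "xs \<in> Q" for xs
  proof -
    have p: "vpath xs (with_proj G)" and e: "hd xs = u" "last xs = v"
      using xs Q(2) by (auto simp: paths_between_def)
    from p have ne: "xs \<noteq> []" and succ: "successively (\<lambda>a b. (a, b) \<in> parcs G) xs"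
      by (auto simp: vpath_def vwalk_def vwalk_arcs_subset_iff)
    have "successively (\<lambda>a b. (a, b) \<in> parcs G) (rev xs)"
      unfolding successively_rev using succ by (rule successively_mono) (rule arcs_symmetric)
    then have "\<exists>z\<in>set (rev xs). z \<in> nbhd G X" if "v \<in> X" "u \<notin> X"
      by (rule walk_crosses_nbhd) (use ne e that in \<open>simp_all add: hd_rev last_rev\<close>)
    moreover have "\<exists>z\<in>set xs. z \<in> nbhd G X" if "u \<in> X" "v \<notin> X"
      using succ ne by (rule walk_crosses_nbhd) (use e that in simp_all)
    ultimately show ?thesis using sides by auto
  qed
  then obtain n where n: "\<And>xs. xs \<in> Q \<Longrightarrow> n xs \<in> set xs \<and> n xs \<in> nbhd G X"
    by (metis (no_types))
  have "inj_on n Q"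
  proof (rule inj_onI, rule ccontr)
    fix xs ys assume xy: "xs \<in> Q" "ys \<in> Q" "n xs = n ys" "xs \<noteq> ys"
    have "n xs \<in> {u, v}" using pairwiseD[OF Q(3) xy(1,2,4)] n[OF xy(1)] n[OF xy(2)] xy(3) by auto
    then show False using n[OF xy(1)] uv' by auto
  qed
  moreover have "n ` Q \<subseteq> nbhd G X" using n by blast
  moreover have "finite (nbhd G X)" using pair_finite_verts by (simp add: nbhd_def)
  ultimately have "card Q \<le> card (nbhd G X)" by (rule card_inj_on_le)
  then show ?thesis using Q(1) frag by (simp add: fragment_def)
qed

text \<open>Strong connectivity asks for walks both ways; the symmetry of the arcs supplies the
  return walk.\<close>

lemma components_minus_linked:
  assumes C: "C \<in> components_minus G T" and s: "s \<in> C"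
  shows "s \<in> pverts G - T" "linked T s z \<Longrightarrow> z \<in> C"
proof -
  let ?H = "with_proj G \<restriction> (pverts G - T)"
  interpret H: wf_digraph ?H by (rule wellformed_induce_subgraph)
  have CH: "C \<in> pre_digraph.sccs_verts ?H" using C by (simp add: components_minus_def)
  then have sub: "C \<subseteq> pverts G - T" using H.sccs_verts_subsets by auto
  then show sT: "s \<in> pverts G - T" using s by blast
  assume sz: "linked T s z"
  have dom: "x \<rightarrow>\<^bsub>?H\<^esub> y" if "(x, y) \<in> avoiding (parcs G) T" for x y
    using that in_arcsD1[of x y] in_arcsD2[of x y]
    by (auto simp: avoiding_def arcs_ends_def arc_to_ends_def intro!: image_eqI[of _ _ "(x, y)"])
  have reach: "x \<rightarrow>\<^sup>*\<^bsub>?H\<^esub> y" if "linked T x y" "x \<in> pverts G - T" for x y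
    using that
  proof (induction rule: rtrancl_induct)
    case base
    then show ?case by (intro H.reachable_refl) simp
  next
    case (step y z)
    then show ?case using dom by (meson H.reachable_adj_trans)
  qed
  have "s \<rightarrow>\<^sup>*\<^bsub>?H\<^esub> z" "z \<rightarrow>\<^sup>*\<^bsub>?H\<^esub> s"
    using reach[OF sz sT] reach[OF linked_sym[OF sz] linked_closed[OF sz sT]] by blast+
  then show "z \<in> C" using CH s unfolding H.in_sccs_verts_conv_reachable by blast
qed

lemma fragments_crossD:
  assumes "fragments_cross G X Y"
  shows "\<exists>s\<in>nbhd G X - nbhd G Y. \<exists>s'\<in>nbhd G X - nbhd G Y. \<not> linked (nbhd G Y) s s'"
proof -
  let ?T = "nbhd G Y"
  obtain C D s s' where C: "C \<in> components_minus G ?T" and D: "D \<in> components_minus G ?T" and CD: "C \<noteq> D"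
    and s: "s \<in> nbhd G X" "s \<in> C" and s': "s' \<in> nbhd G X" "s' \<in> D"
    using assms unfolding fragments_cross_def separators_cross_def by blast
  have nT: "s \<notin> ?T" "s' \<notin> ?T" using components_minus_linked(1)[OF C s(2)] components_minus_linked(1)[OF D s'(2)] by blast+
  have "\<not> linked ?T s s'"
  proof
    assume "linked ?T s s'"
    then have "s' \<in> C" using components_minus_linked(2)[OF C s(2)] by blast
    interpret H: wf_digraph "with_proj G \<restriction> (pverts G - ?T)" by (rule wellformed_induce_subgraph)
    have "C \<inter> D = {}"
      using C D CD unfolding components_minus_def by (rule H.sccs_verts_disjoint)
    then show False using \<open>s' \<in> C\<close> s'(2) by blast
  qed
  then show ?thesis using s(1) s'(1) nT by blast
qed

end

section \<open>The characterization of d-joined graphs\<close>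

text \<open>Split a point into its projection and a vector orthogonal to \<open>H\<close>;
  reflection changes the sign of the latter. \<open>H\<close> is any nonempty affine subspace,
  because the span of a separator is not controlled in the intermediate frameworks of a
  sequence.\<close>

lemma reflect_in_isometry:
  fixes H :: "'e::euclidean_space set"
  assumes "affine H" "H \<noteq> {}"
  shows "norm (reflect_in H x - reflect_in H y) = norm (x - y)"
proof -
  define m where "m z = midpoint z (reflect_in H z)" for z
  define d where "d z = (1 / 2) *\<^sub>R (reflect_in H z - z)" for z
  have m: "m z \<in> H" for z unfolding m_def by (rule reflect_in_affine(1)[OF assms])
  have eqs: "z = m z - d z" "reflect_in H z = m z + d z" for z
    by (simp_all add: m_def d_def midpoint_def scaleR_diff_right scaleR_add_right flip: scaleR_add_left)
  have orth: "d z \<bullet> (m x - m y) = 0" for z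
    unfolding d_def using reflect_in_affine(2)[OF assms m m, of z x y] by simp
  define a where "a = m x - m y"
  define b where "b = d x - d y"
  have ab: "b \<bullet> a = 0" using orth by (simp add: a_def b_def inner_diff_left)
  have "reflect_in H x - reflect_in H y = a + b"
    unfolding eqs(2) by (simp add: a_def b_def)
  moreover have "x - y = a - b"
  proof -
    have "x - y = (m x - d x) - (m y - d y)" by (rule arg_cong2[where f = minus, OF eqs(1) eqs(1)])
    also have "\<dots> = a - b"
    proof -
      have "(k - l) - (k' - l') = (k - k') - (l - l')" for k l k' l' :: 'e by simp
      then show ?thesis unfolding a_def b_def .
    qed
    finally show ?thesis .
  qed
  moreover have "norm (a + b) = norm (a - b)"
  proof -
    have "(norm (a + b))\<^sup>2 = (norm (a - b))\<^sup>2"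
      using ab by (simp add: power2_norm_eq_inner inner_add_left inner_add_right inner_diff_left inner_diff_right inner_commute)
    then show ?thesis by (simp only: power2_eq_iff_nonneg norm_ge_zero)
  qed
  ultimately show ?thesis by (simp only:)
qed

lemma reflect_in_fixes:
  fixes H :: "'e::euclidean_space set"
  shows "x \<in> H \<Longrightarrow> reflect_in H x = x"
  by (simp add: reflect_in_def closest_point_self scaleR_2)

lemma partial_reflection_dist:
  fixes p :: "'a \<Rightarrow> real ^ 'n"
  assumes frag: "fragment CARD('n) G X" and u: "u \<in> pverts G" and v: "v \<in> pverts G"
    and side: "\<not> (u \<in> X \<and> v \<in> frag_compl G X)" "\<not> (v \<in> X \<and> u \<in> frag_compl G X)"
  shows "norm (partial_reflection G X p u - partial_reflection G X p v) = norm (p u - p v)"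
proof -
  let ?H = "affine hull (p ` nbhd G X)"
  \<comment> \<open>The dimension \<open>CARD('n)\<close> is positive, so the affine hull is
    nonempty.\<close>
  have "card (nbhd G X) \<noteq> 0" using frag by (simp add: fragment_def)
  then have "nbhd G X \<noteq> {}" by auto
  then have H: "affine ?H" "?H \<noteq> {}" by simp_all
  have fix_nbhd: "reflect_in ?H (p z) = p z" if "z \<in> nbhd G X" for z
    using that by (intro reflect_in_fixes hull_inc imageI)
  have iso: "norm (reflect_in ?H a - reflect_in ?H b) = norm (a - b)" for a b
    by (rule reflect_in_isometry[OF H])
  let ?C = "frag_compl G X"
  have cases: "z \<in> X \<or> z \<in> nbhd G X \<or> z \<in> ?C" if "z \<in> pverts G" for z
    using that by (auto simp: frag_compl_def)
  have nC: "z \<notin> ?C" if "z \<in> nbhd G X" for z using that by (auto simp: frag_compl_def)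
  consider "u \<in> ?C" "v \<in> ?C" | "u \<notin> ?C" "v \<notin> ?C" | "u \<in> ?C" "v \<notin> ?C" "v \<in> nbhd G X" | "u \<notin> ?C" "v \<in> ?C" "u \<in> nbhd G X"
    using cases[OF u] cases[OF v] side nC by blast
  then show ?thesis
  proof cases
    case 1
    then show ?thesis by (simp add: partial_reflection_def iso)
  next
    case 2
    then show ?thesis by (simp add: partial_reflection_def)
  next
    case 3
    then show ?thesis using iso[of "p u" "p v"] fix_nbhd[OF 3(3)] by (simp add: partial_reflection_def)
  next
    case 4
    then show ?thesis using iso[of "p u" "p v"] fix_nbhd[OF 4(3)] by (simp add: partial_reflection_def)
  qed
qed

lemma apply_reflections_dist:
  fixes p :: "'a \<Rightarrow> real ^ 'n"
  assumes "reflection_sequence CARD('n) G Xs" "u \<in> pverts G" "v \<in> pverts G"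
    and "\<And>X. X \<in> set Xs \<Longrightarrow> \<not> (u \<in> X \<and> v \<in> frag_compl G X) \<and> \<not> (v \<in> X \<and> u \<in> frag_compl G X)"
  shows "norm (apply_reflections G Xs p u - apply_reflections G Xs p v) = norm (p u - p v)"
  using assms(1,4)
proof (induction Xs arbitrary: p)
  case Nil
  then show ?case by (simp add: apply_reflections_def)
next
  case (Cons X Xs)
  let ?p = "partial_reflection G X p"
  have "norm (apply_reflections G Xs ?p u - apply_reflections G Xs ?p v) = norm (?p u - ?p v)"
    using Cons.prems by (intro Cons.IH) (auto simp: reflection_sequence_def)
  also have "\<dots> = norm (p u - p v)"
    using Cons.prems assms(2,3) by (intro partial_reflection_dist) (auto simp: reflection_sequence_def)
  finally show ?case by (simp add: apply_reflections_def)
qed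

lemma d_joined_imp_reflections:
  fixes G :: "'a pair_pre_digraph" and p q :: "'a \<Rightarrow> real ^ 'n"
  assumes pg: "pair_graph G" and card: "CARD('n) + 1 \<le> card (pverts G)"
    and dj: "d_joined TYPE('n) G" and gen: "generic G p" and eq: "equivalent_fw G p q"
  shows "\<exists>Xs. reflection_sequence CARD('n) G Xs \<and> reduced_sequence G Xs \<and>
    congruent_fw G q (apply_reflections G Xs p)"
proof -
  interpret pair_graph G by (rule pg)
  have "rigid_graph TYPE('n) G" using dj unfolding d_joined_def by (elim conjE)
  then have "rigid_fw G p" using gen unfolding rigid_graph_def by (elim allE impE)
  then interpret generic_rigid G p
    using gen card by (intro generic_rigid.intro generic_rigid_axioms.intro pg)
  have "tight_separators \<subseteq> Pow (pverts G)" unfolding tight_separators_def by blast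
  then have fin: "finite tight_separators" by (rule finite_subset) (simp add: pair_finite_verts)
  have aff: "aff_dim (p ` S) = int CARD('n) - 1" if "S \<in> tight_separators" for S
    using tight_separatorsD(1,2)[OF that] by (rule aff_dim_generic[OF gen_on pair_finite_verts card_V])
  have dist: "norm (p u - p v) = norm (q u - q v)"
    if u: "u \<in> pverts G" and v: "v \<in> pverts G" and uns: "unsplit tight_separators u v" for u v
  proof (cases "u = v \<or> (u, v) \<in> parcs G")
    case True
    then show ?thesis using eq unfolding equivalent_fw_def by auto
  next
    case False
    then have uv: "u \<noteq> v" "(u, v) \<notin> parcs G" by blast+
    \<comment> \<open>Fewer than d vertices cannot separate the pair by \<open>connectivity\<close>,
      and exactly d cannot because it is unsplit.\<close>
    have "CARD('n) + 1 \<le> kappa G u v"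
    proof (rule kappa_ge[OF u v uv])
      fix S assume S: "S \<subseteq> pverts G - {u, v}" "card S < CARD('n) + 1"
      have V: "S \<subseteq> pverts G" "u \<in> pverts G - S" "v \<in> pverts G - S" using S(1) u v by blast+
      show "linked S u v"
      proof (cases "card S < CARD('n)")
        case True
        then show ?thesis using V(2,3) by (rule connectivity[OF V(1)])
      next
        case False
        show ?thesis
        proof (rule ccontr)
          assume not: "\<not> linked S u v"
          have "card S = CARD('n)" using S(2) False by linarith
          then have "S \<in> tight_separators" using V not unfolding tight_separators_def by blast
          then show False using uns V(2,3) not unfolding unsplit_def by blast
        qed
      qed
    qed
    then have "globally_linked TYPE('n) G u v" using dj u v uv(1) unfolding d_joined_def by blast
    then show ?thesis using gen eq unfolding globally_linked_def by blast
  qed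
  have "\<exists>Xs. (\<forall>X\<in>set Xs. fragment CARD('n) G X \<and> nbhd G X \<in> tight_separators) \<and>
      distinct (map (nbhd G) Xs) \<and> congruent_fw G q (apply_reflections G Xs p)"
  proof (rule realization_by_reflections[OF fin subset_refl])
    show "aff_dim (p ` S) = int CARD('n) - 1" if "S \<in> tight_separators" for S using that by (rule aff)
  qed (rule dist)
  then obtain Xs where Xs: "\<forall>X\<in>set Xs. fragment CARD('n) G X \<and> nbhd G X \<in> tight_separators"
      "distinct (map (nbhd G) Xs)" "congruent_fw G q (apply_reflections G Xs p)"
    by (elim exE conjE)
  have "\<not> fragments_cross G (Xs ! i) (Xs ! j) \<and> nbhd G (Xs ! i) \<noteq> nbhd G (Xs ! j)"
    if i: "i < length Xs" and j: "j < length Xs" and ij: "i \<noteq> j" for i j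
  proof
    have t: "nbhd G (Xs ! i) \<in> tight_separators" "nbhd G (Xs ! j) \<in> tight_separators"
      using Xs(1) i j by simp_all
    show "\<not> fragments_cross G (Xs ! i) (Xs ! j)"
    proof
      assume "fragments_cross G (Xs ! i) (Xs ! j)"
      from fragments_crossD[OF this] obtain s s' where
        s: "s \<in> nbhd G (Xs ! i) - nbhd G (Xs ! j)" "s' \<in> nbhd G (Xs ! i) - nbhd G (Xs ! j)"
          "\<not> linked (nbhd G (Xs ! j)) s s'" by blast
      have "unsplit tight_separators s s'"
        using s(1,2) by (intro unsplit_tight_separator[OF subset_refl t(1)]) blast+
      then show False using s t(2) unfolding unsplit_def by blast
    qed
    show "nbhd G (Xs ! i) \<noteq> nbhd G (Xs ! j)"
      using nth_eq_iff_index_eq[OF Xs(2), of i j] i j ij by simp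
  qed
  then have "reduced_sequence G Xs" unfolding reduced_sequence_def by blast
  moreover have "reflection_sequence CARD('n) G Xs" using Xs(1) unfolding reflection_sequence_def by blast
  ultimately show ?thesis using Xs(3) by blast
qed

section \<open>The converse: rigidity and linked pairs from reflections\<close>

lemma finite_reduced_sequences:
  assumes "pair_graph G"
  shows "finite {Xs. reflection_sequence d G Xs \<and> reduced_sequence G Xs}"
proof -
  interpret pair_graph G by (rule assms)
  have "set Xs \<subseteq> Pow (pverts G) \<and> distinct Xs" if Xs: "reflection_sequence d G Xs" "reduced_sequence G Xs" for Xs
  proof
    show "set Xs \<subseteq> Pow (pverts G)" using Xs(1) unfolding reflection_sequence_def fragment_def by blast
    show "distinct Xs" unfolding distinct_conv_nth
    proof (intro allI impI notI)
      fix i j assume "i < length Xs" "j < length Xs" "i \<noteq> j" "Xs ! i = Xs ! j"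
      then show False using Xs(2) unfolding reduced_sequence_def by metis
    qed
  qed
  then have "{Xs. reflection_sequence d G Xs \<and> reduced_sequence G Xs} \<subseteq> {xs. set xs \<subseteq> Pow (pverts G) \<and> distinct xs}"
    by blast
  moreover have "finite {xs. set xs \<subseteq> Pow (pverts G) \<and> distinct xs}"
    using pair_finite_verts by (intro finite_subset_distinct) simp
  ultimately show ?thesis by (rule finite_subset)
qed

text \<open>Each of the finitely many candidates not congruent to \<open>p\<close> differs from it
  in some distance by a fixed gap, which small displacements cannot bridge.\<close>

lemma finitely_many_realizations_imp_rigid:
  fixes p :: "'a \<Rightarrow> real ^ 'n" and f :: "'s \<Rightarrow> 'a \<Rightarrow> real ^ 'n"
  assumes fin: "finite F"
    and eq: "\<And>q :: 'a \<Rightarrow> real ^ 'n. equivalent_fw G p q \<Longrightarrow> \<exists>x\<in>F. congruent_fw G q (f x)"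
  shows "rigid_fw G p"
proof -
  define B where "B = {x \<in> F. \<not> congruent_fw G p (f x)}"
  have "\<forall>x\<in>B. \<exists>\<delta>>0. \<exists>u\<in>pverts G. \<exists>v\<in>pverts G. \<delta> \<le> \<bar>norm (f x u - f x v) - norm (p u - p v)\<bar>"
  proof
    fix x assume "x \<in> B"
    then obtain u v where uv: "u \<in> pverts G" "v \<in> pverts G" "norm (p u - p v) \<noteq> norm (f x u - f x v)"
      unfolding B_def congruent_fw_def by blast
    then have "\<bar>norm (f x u - f x v) - norm (p u - p v)\<bar> > 0" by simp
    then show "\<exists>\<delta>>0. \<exists>u\<in>pverts G. \<exists>v\<in>pverts G. \<delta> \<le> \<bar>norm (f x u - f x v) - norm (p u - p v)\<bar>"
      using uv(1,2) by blast
  qed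
  then obtain \<delta> where \<delta>: "\<forall>x\<in>B. \<delta> x > 0 \<and> (\<exists>u\<in>pverts G. \<exists>v\<in>pverts G.
      \<delta> x \<le> \<bar>norm (f x u - f x v) - norm (p u - p v)\<bar>)" by (rule bchoice[THEN exE])
  \<comment> \<open>Half of the smallest gap, since both ends of a pair may move by \<epsilon>; the
    1 keeps the minimum defined when \<open>B\<close> is empty.\<close>
  define \<epsilon> where "\<epsilon> = Min (insert 1 (\<delta> ` B)) / 2"
  have fB: "finite (insert 1 (\<delta> ` B))" using fin by (simp add: B_def)
  have "Min (insert 1 (\<delta> ` B)) > 0" using \<delta> fB by (subst Min_gr_iff) auto
  then have pos: "\<epsilon> > 0" by (simp add: \<epsilon>_def)
  have le: "2 * \<epsilon> \<le> \<delta> x" if "x \<in> B" for x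
    using Min_le[OF fB, of "\<delta> x"] that by (simp add: \<epsilon>_def)
  have "congruent_fw G p q" if q: "equivalent_fw G p q" "\<forall>v\<in>pverts G. norm (p v - q v) < \<epsilon>" for q
  proof -
    obtain x where x: "x \<in> F" "congruent_fw G q (f x)" using eq[OF q(1)] by blast
    have "x \<notin> B"
    proof
      assume xB: "x \<in> B"
      then obtain u v where uv: "u \<in> pverts G" "v \<in> pverts G"
          "\<delta> x \<le> \<bar>norm (f x u - f x v) - norm (p u - p v)\<bar>" using \<delta> by blast
      have "norm (q u - q v) = norm (f x u - f x v)" using x(2) uv(1,2) unfolding congruent_fw_def by blast
      moreover have "\<bar>norm (q u - q v) - norm (p u - p v)\<bar> \<le> norm ((q u - q v) - (p u - p v))"
        by (rule norm_triangle_ineq3)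
      moreover have "norm ((q u - q v) - (p u - p v)) \<le> norm (p u - q u) + norm (p v - q v)"
      proof -
        have eq: "(q u - q v) - (p u - p v) = (p v - q v) - (p u - q u)" by simp
        show ?thesis unfolding eq by (subst add.commute) (rule norm_triangle_ineq4)
      qed
      moreover have "norm (p u - q u) < \<epsilon>" "norm (p v - q v) < \<epsilon>" using q(2) uv(1,2) by blast+
      ultimately show False using uv(3) le[OF xB] by linarith
    qed
    then have "congruent_fw G p (f x)" using x(1) unfolding B_def by blast
    then show ?thesis using x(2) unfolding congruent_fw_def by simp
  qed
  then show ?thesis using pos unfolding rigid_fw_def by blast
qed

lemma separated_not_globally_linked:
  fixes G :: "'a pair_pre_digraph"
  assumes pg: "pair_graph G" and card: "CARD('n::finite) + 1 \<le> card (pverts G)"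
    and u: "u \<in> pverts G" and v: "v \<in> pverts G" and uv: "u \<noteq> v" "(u, v) \<notin> parcs G"
    and kappa: "kappa G u v < CARD('n) + 1"
  shows "\<not> globally_linked TYPE('n) G u v"
proof
  assume gl: "globally_linked TYPE('n) G u v"
  interpret pair_graph G by (rule pg)
  have "\<exists>S. S \<subseteq> pverts G - {u, v} \<and> card S < CARD('n) + 1 \<and> \<not> linked S u v"
    using kappa_ge[OF u v uv, of "CARD('n) + 1"] kappa by (meson not_le)
  then obtain S where S: "S \<subseteq> pverts G - {u, v}" "card S < CARD('n) + 1" "\<not> linked S u v" by blast
  have SV: "S \<subseteq> pverts G" and uS: "u \<in> pverts G - S" and vS: "v \<in> pverts G - S" using S(1) u v by blast+
  have fS: "finite S" using SV pair_finite_verts by (rule finite_subset)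
  obtain p :: "'a \<Rightarrow> real ^ 'n" where gen: "generic_on (pverts G) p"
    using ex_generic_on[OF pair_finite_verts] by blast
  note ip = generic_interpolation[OF gen pair_finite_verts card]
  \<comment> \<open>If \<open>S\<close> has fewer than d vertices, the values at \<open>u\<close>
    and \<open>v\<close> can both be prescribed; 1 and -1 differ, so \<open>g\<close> is not 0. If
    it has exactly d, only the value at \<open>u\<close> is chosen, and the value at
    \<open>v\<close> is nonzero because d + 1 generic points lie in no hyperplane.\<close>
  have "\<exists>g c. g \<noteq> 0 \<and> (\<forall>s\<in>S. g \<bullet> p s + c = 0) \<and> g \<bullet> p u + c \<noteq> 0 \<and> g \<bullet> p v + c \<noteq> 0"
  proof (cases "card S < CARD('n)")
    case True
    let ?U = "insert u (insert v S)"
    have U: "?U \<subseteq> pverts G" "card ?U \<le> CARD('n) + 1"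
      using SV u v True uS vS uv(1) fS by simp_all
    obtain g c where g: "\<forall>z\<in>?U. g \<bullet> p z + c = (if z = u then 1 else if z = v then -1 else 0)"
      using ip[OF U, of "\<lambda>z. if z = u then 1 else if z = v then -1 else 0"] by (elim exE)
    have gu: "g \<bullet> p u + c = 1" using bspec[OF g, of u] by simp
    have gv: "g \<bullet> p v + c = -1" using bspec[OF g, of v] uv(1) by simp
    have gS: "g \<bullet> p s + c = 0" if "s \<in> S" for s
    proof -
      have "s \<noteq> u" "s \<noteq> v" using that uS vS by blast+
      then show ?thesis using bspec[OF g, of s] that by simp
    qed
    have "g \<noteq> 0" using gu gv by auto
    then show ?thesis using gu gv gS by (intro exI[of _ g] exI[of _ c]) simp
  next
    case False
    then have cS: "card S = CARD('n)" using S(2) by linarith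
    have U: "insert u S \<subseteq> pverts G" "card (insert u S) \<le> CARD('n) + 1" using SV u cS uS fS by simp_all
    obtain g c where g: "\<forall>z\<in>insert u S. g \<bullet> p z + c = (if z = u then 1 else 0)"
      using ip[OF U, of "\<lambda>z. if z = u then 1 else 0"] by (elim exE)
    have gu: "g \<bullet> p u + c = 1" using bspec[OF g, of u] by simp
    have gS: "g \<bullet> p s + c = 0" if "s \<in> S" for s
    proof -
      have "s \<noteq> u" using that uS by blast
      then show ?thesis using bspec[OF g, of s] that by simp
    qed
    have "S \<noteq> {}" using cS by auto
    then obtain s where "s \<in> S" by blast
    then have "g \<noteq> 0" using gS[of s] gu by auto
    moreover have "g \<bullet> p v + c \<noteq> 0"
    proof
      assume "g \<bullet> p v + c = 0"
      then have 0: "\<forall>z\<in>insert v S. g \<bullet> p z + c = 0" using gS by blast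
      have "finite (insert v S)" "insert v S \<subseteq> pverts G" "CARD('n) + 1 \<le> card (insert v S)"
        using SV v cS vS fS by simp_all
      then have "g = 0 \<and> c = 0" using 0 by (rule generic_affine_eq_0[OF gen])
      then show False using gu by simp
    qed
    ultimately show ?thesis using gu gS by (intro exI[of _ g] exI[of _ c]) simp
  qed
  then obtain g c where g: "g \<noteq> 0" and gS: "\<forall>s\<in>S. g \<bullet> p s + c = 0"
    and gu: "g \<bullet> p u + c \<noteq> 0" and gv: "g \<bullet> p v + c \<noteq> 0" by (elim exE conjE)
  define r where "r = hyperplane_reflection g c"
  have r_iso: "norm (r x - r y) = norm (x - y)" for x y
    unfolding r_def by (rule hyperplane_reflection_isometry[OF g])
  have r_fix: "r (p s) = p s" if "s \<in> S" for s
    unfolding r_def using bspec[OF gS that] by (rule hyperplane_reflection_fixes)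
  define q where "q z = (if linked S v z then r (p z) else p z)" for z
  have half: "norm (p a - p b) = norm (q a - q b)" if ab: "(a, b) \<in> parcs G" "linked S v a" for a b
  proof (cases "linked S v b")
    case True
    then show ?thesis using ab(2) by (simp add: q_def r_iso)
  next
    case False
    have "a \<notin> S" using linked_closed[OF ab(2) vS] by blast
    then have "b \<in> S" using linked_step[OF ab(2,1)] False by blast
    then have "q a - q b = r (p a) - r (p b)" using False ab(2) r_fix by (simp add: q_def)
    then show ?thesis by (simp add: r_iso)
  qed
  have "norm (p a - p b) = norm (q a - q b)" if ab: "(a, b) \<in> parcs G" for a b
  proof -
    consider "linked S v a" | "linked S v b" | "\<not> linked S v a" "\<not> linked S v b" by blast
    then show ?thesis
    proof cases
      case 1
      with ab show ?thesis by (rule half)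
    next
      case 2
      then have "norm (p b - p a) = norm (q b - q a)" by (rule half[OF arcs_symmetric[OF ab]])
      then show ?thesis by (simp only: norm_minus_commute)
    next
      case 3
      then show ?thesis by (simp add: q_def)
    qed
  qed
  then have "equivalent_fw G p q" unfolding equivalent_fw_def by blast
  moreover have "generic G p" using gen by (simp add: generic_def generic_on_def)
  ultimately have "norm (p u - p v) = norm (q u - q v)" using gl unfolding globally_linked_def by blast
  moreover have "\<not> linked S v u" using S(3) linked_sym by blast
  ultimately have "(norm (p u - r (p v)))\<^sup>2 = (norm (p u - p v))\<^sup>2" by (simp add: q_def)
  then have "4 * (g \<bullet> p u + c) * (g \<bullet> p v + c) / (g \<bullet> g) = 0"
    unfolding r_def norm_diff_hyperplane_reflection[OF g] by simp
  moreover have "4 * A * B / D = 0 \<Longrightarrow> D \<noteq> 0 \<Longrightarrow> A = 0 \<or> B = 0" for A B D :: real by simp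
  ultimately show False using g gu gv inner_eq_zero_iff by blast
qed

theorem theorem4p5:
  fixes G :: "'a pair_pre_digraph"
  assumes "pair_graph G"
    and "card (pverts G) \<ge> CARD('n::finite) + 1"
  shows "d_joined TYPE('n) G \<longleftrightarrow>
    (\<forall>p :: 'a \<Rightarrow> real ^ 'n. generic G p \<longrightarrow>
      (\<forall>q :: 'a \<Rightarrow> real ^ 'n. equivalent_fw G p q \<longrightarrow>
        (\<exists>Xs. reflection_sequence CARD('n) G Xs \<and> reduced_sequence G Xs \<and>
          congruent_fw G q (apply_reflections G Xs p))))"
    (is "_ \<longleftrightarrow> ?R")
proof
  assume "d_joined TYPE('n) G"
  then show ?R using d_joined_imp_reflections[OF assms] by (intro allI impI)
next
  assume R: ?R
  interpret pair_graph G by (rule assms(1))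
  \<comment> \<open>Distinct neighbour sets bound the length of a reduced sequence, so up to
    congruence only finitely many frameworks are equivalent to \<open>p\<close>.\<close>
  have "rigid_fw G p" if gen: "generic G p" for p :: "'a \<Rightarrow> real ^ 'n"
  proof (rule finitely_many_realizations_imp_rigid)
    show "finite {Xs. reflection_sequence CARD('n) G Xs \<and> reduced_sequence G Xs}"
      by (rule finite_reduced_sequences[OF assms(1)])
    fix q :: "'a \<Rightarrow> real ^ 'n"
    assume "equivalent_fw G p q"
    from R[rule_format, OF gen this]
    show "\<exists>Xs\<in>{Xs. reflection_sequence CARD('n) G Xs \<and> reduced_sequence G Xs}.
        congruent_fw G q (apply_reflections G Xs p)" by blast
  qed
  then have "rigid_graph TYPE('n) G" unfolding rigid_graph_def by (intro allI impI)
  moreover have "globally_linked TYPE('n) G u v \<longleftrightarrow> (u, v) \<in> parcs G \<or> CARD('n) + 1 \<le> kappa G u v"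
    if u: "u \<in> pverts G" and v: "v \<in> pverts G" and uv: "u \<noteq> v" for u v
  proof
    assume gl: "globally_linked TYPE('n) G u v"
    show "(u, v) \<in> parcs G \<or> CARD('n) + 1 \<le> kappa G u v"
    proof (rule ccontr)
      assume "\<not> ?thesis"
      then have "(u, v) \<notin> parcs G" "kappa G u v < CARD('n) + 1" by simp_all
      from separated_not_globally_linked[OF assms u v uv this] gl show False by (rule notE)
    qed
  next
    assume linked: "(u, v) \<in> parcs G \<or> CARD('n) + 1 \<le> kappa G u v"
    show "globally_linked TYPE('n) G u v"
      unfolding globally_linked_def
    proof (intro allI impI, elim conjE)
      fix p q :: "'a \<Rightarrow> real ^ 'n"
      assume gen: "generic G p" and eq: "equivalent_fw G p q"
      show "norm (p u - p v) = norm (q u - q v)"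
      proof (cases "(u, v) \<in> parcs G")
        case True
        then show ?thesis using eq unfolding equivalent_fw_def by blast
      next
        case False
        then have kappa: "\<not> kappa G u v \<le> CARD('n)" using linked by simp
        obtain Xs where Xs: "reflection_sequence CARD('n) G Xs" "congruent_fw G q (apply_reflections G Xs p)"
          using R[rule_format, OF gen eq] by (elim exE conjE)
        \<comment> \<open>More than d disjoint paths cannot pass through the d neighbours of a
          fragment, so no reflection has \<open>u\<close> and \<open>v\<close> on opposite
          sides.\<close>
        have "norm (apply_reflections G Xs p u - apply_reflections G Xs p v) = norm (p u - p v)"
        proof (rule apply_reflections_dist[OF Xs(1) u v])
          fix X assume "X \<in> set Xs"
          then have "fragment CARD('n) G X" using Xs(1) unfolding reflection_sequence_def by (rule bspec[rotated])
          from kappa_le_fragment[OF this, of u v] kappa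
          show "\<not> (u \<in> X \<and> v \<in> frag_compl G X) \<and> \<not> (v \<in> X \<and> u \<in> frag_compl G X)" by blast
        qed
        moreover have "norm (q u - q v) = norm (apply_reflections G Xs p u - apply_reflections G Xs p v)"
          using Xs(2) u v unfolding congruent_fw_def by blast
        ultimately show ?thesis by simp
      qed
    qed
  qed
  ultimately show "d_joined TYPE('n) G"
    using assms(2) unfolding d_joined_def by (intro conjI ballI impI)
qed

end
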